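(* The $1$-cocycle $C:\mathcal{O}_q(S_t^2)\to\mathcal{D}_2^+\oplus\mathcal{D}_2^-$ is purely non-Gaussian.
   Context: Fix $0<q<1$, $a\in\mathbb{R}$, $t=q^a-q^{-a}$. Put $[x]=\frac{q^x-q^{-x}}{q-q^{-1}}$, $\{x\}=q^x+q^{-x}$ and $i=\sqrt{-1}$. Inner products are linear in the second variable. $U_q=U_q(\mathfrak{su}(2))$ is the Hopf $*$-algebra generated by $k^{\pm1},e,f$ with $ke=q^2ek$, $kf=q^{-2}fk$, $[e,f]=\frac{k-k^{-1}}{q-q^{-1}}$, $\Delta(k)=k\otimes k$, $\Delta(e)=e\otimes1+k\otimes e$, $\Delta(f)=1\otimes f+f\otimes k^{-1}$, $\epsilon(k)=1$, $\epsilon(e)=\epsilon(f)=0$, $S(k)=k^{-1}$, $S(e)=-k^{-1}e$, $S(f)=-fk$, $k^*=k$, $e^*=fk$, $f^*=k^{-1}e$. For $s\in\frac12\mathbb{Z}_{\ge0}$, $(\pi_s,H_s)$ is the $*$-representation with orthonormal basis $\xi^s_j$ ($j=-s,\dots,s$), $\pi_s(k)\xi^s_j=q^{2j}\xi^s_j$, $\pi_s(e)\xi^s_j=q^{j+1}([s-j][s+j+1])^{1/2}\xi^s_{j+1}$, $\pi_s(f)\xi^s_j=q^{-j}([s+j][s-j+1])^{1/2}\xi^s_{j-1}$. $\mathcal{A}=\mathcal{O}_q(SU(2))$ is the dual Hopf $*$-algebra spanned by the matrix coefficients $u^s_{\xi,\eta}$, $(u^s_{\xi,\eta},h)=\langle\xi,\pi_s(h)\eta\rangle$,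 with product dual to $\Delta$, coproduct dual to the product of $U_q$, counit $\epsilon(u)=(u,1)$, and $(x^*,h)=\overline{(x,S(h)^* )}$. For $h\in U_q$, $x\in\mathcal{A}$ put $h\rhd x=x_{(1)}(x_{(2)},h)$ and $x\lhd h=(x_{(1)},h)x_{(2)}$. Let $B_t=q^{-1/2}(e-fk)-i(q-q^{-1})^{-1}tk$, and let $R$ be the unitary antipode of $U_q$ (the $*$-preserving anti-automorphism with $R(k)=k^{-1}$, $R(e)=-qk^{-1}e$, $R(f)=-q^{-1}fk$). Let $I=\mathbb{C}[R(B_t)]$, a right coideal of $U_q$. The Podleś sphere is the unital left coideal $*$-subalgebra $\mathcal{B}=\mathcal{O}_q(S_t^2)=\{x\in\mathcal{A}: R(B_t)\rhd x=\epsilon(B_t)x\}$. For $n\in\mathbb{Z}_{\ge0}$ the operator $\pi_n(iR(B_t))$ is self-adjoint with simple eigenvalues $[a+2j]$, $j=-n,\dots,n$; let $\eta^n_{[a+2j]}\in H_n$ be unit eigenvectors and $u^n_{[a+2j],[a]}=u^n_{\eta^n_{[a+2j]},\eta^n_{[a]}}$. These elements form a basis of $\mathcal{B}$. An admissible $*$-representation (of $\mathcal{B}\bowtie I$) is a pre-Hilbert space with $*$-representations of $\mathcal{B}$ and $I$ by adjointable operators such that $bh=h_{(1)}(b\lhd h_{(2)})$ for $b\in\mathcal{B},h\in I$, and on which $iR(B_t)$ is diagonalizable with eigenvalues (weights) in $\{[a+n]:n\in\mathbb{Z}\}$, each of finite multiplicity. For $0<\lambda<q+q^{-1}$, $\mathcal{L}_\lambda^+=(\pi_\lambda,\mathcal{L}^+_\lambda)$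 is the irreducible admissible $*$-representation (unique up to unitary equivalence) with weights $[a+2n]$, $n\in\mathbb{Z}$, each of multiplicity one, whose unit vector $e_a^\lambda$ of weight $[a]$ satisfies $$\pi_\lambda(u^1_{[a],[a]})e_a^\lambda=\frac{\lambda+(q+q^{-1})^{-1}t^2}{q+q^{-1}+(q+q^{-1})^{-1}t^2}\,e_a^\lambda .$$ The module $\mathcal{M}_{q+q^{-1},a}$ is the module of $\mathcal{B}\bowtie I$ generated by a vector $e_a$ of weight $[a]$ with $u^1_{[a],[a]}e_a=e_a$, universal with this property; it has one-dimensional weight spaces of weights $[a+2n]$, $n\in\mathbb{Z}$, and as a $\mathcal{B}$-module it is $\mathcal{B}/\mathcal{B}(1-u^1_{[a],[a]})$ with $e_a$ the class of $1$. The sum of the discrete series $\mathcal{D}_2^+$ (weights $[a+2n]$, $n\ge1$) and $\mathcal{D}_2^-$ (weights $[a+2n]$, $n\le-1$) is the submodule $\mathcal{H}:=\mathcal{D}_2^+\oplus\mathcal{D}_2^-=\ker(\epsilon|_{\mathcal{B}})e_a$, of codimension one; $\pi$ denotes the action of $\mathcal{B}$ on it. The 1-cocycle is $C(b)=be_a-\epsilon(b)e_a$; it satisfies $C(bc)=\pi(b)C(c)+C(b)\epsilon(c)$ and is surjective onto $\mathcal{H}$. The invariant inner product on $\mathcal{H}$, for which $\pi$ is a $*$-representation, is the (well-defined, positive definite) one given by $$\langle C(x),C(y)\rangle=\lim_{\lambda\uparrow q+q^{-1}}\kappa\,\frac{\langle\pi_\lambda(x)e_a^\lambda-\epsilon(x)e_a^\lambda,\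 \pi_\lambda(y)e_a^\lambda-\epsilon(y)e_a^\lambda\rangle}{q+q^{-1}-\lambda},\qquad \kappa=\frac{\{a+2\}}{\{a\}(\{2a+1\}+q+q^{-1})}.$$ Purely non-Gaussian: let $H$ be the Hilbert space completion of $\mathcal{H}$, $H_G=\{(\pi(b)-\epsilon(b))C(c): b,c\in\mathcal{B}\}^\perp\subset H$, $P_G$ the orthogonal projection of $H$ onto $H_G$, and $\mathcal{H}_G=P_G\mathcal{H}$. The cocycle $C$ is called purely non-Gaussian if $\mathcal{H}_G=0$.
   Formalization: With the stated relation bh=h_(1)(b◁h_(2)), the vector u^1_{[a],[a]}e_a is not of weight [a], so the L_λ^+ as described do not exist; the theorem is stated with either u^1_{[a],[a]} or its adjoint (the consistent choice) in the definitions of L_λ^+ and M. *)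

theory Defs
  imports
    "HOL-Analysis.Analysis"
    "HOL-Library.Poly_Mapping"
    "HOL-Library.Product_Plus"
    "HOL-Library.Function_Algebras"
begin

section \<open>The Hopf *-algebra \<open>U\<^sub>q(su(2))\<close>\<close>

text \<open>
  \<open>U\<^sub>q\<close> depends on the term \<open>q\<close>, so it cannot be a type. It is the quotient of the free algebra
  \<open>ualg\<close> on the letters \<open>k, k\<^sup>-\<^sup>1, e, f\<close> by the two-sided ideal \<open>uq_ideal q\<close>: elements of \<open>U\<^sub>q\<close> are
  written through representatives in \<open>ualg\<close>, and functionals on \<open>U\<^sub>q\<close> are functionals on \<open>ualg\<close>
  vanishing on \<open>uq_ideal q\<close>. All structure maps below are given on \<open>ualg\<close> and descend to \<open>U\<^sub>q\<close>.
\<close>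

datatype gen = GK | GKi | GE | GF

datatype word = Word (letters: "gen list")

instantiation word :: monoid_add
begin
definition zero_word_def: "0 = Word []"
definition plus_word_def: "v + w = Word (letters v @ letters w)"
instance by standard (auto simp: zero_word_def plus_word_def)
end

type_synonym ualg = "word \<Rightarrow>\<^sub>0 complex"

text \<open>The monoid algebra of \<open>word \<times> word\<close> is the tensor square of \<open>ualg\<close>.\<close>
type_synonym ualg2 = "(word \<times> word) \<Rightarrow>\<^sub>0 complex"

definition cst :: "complex \<Rightarrow> 'a::monoid_add \<Rightarrow>\<^sub>0 complex" where
  "cst c = Poly_Mapping.single 0 c"

definition gel :: "gen \<Rightarrow> ualg" where
  "gel g = Poly_Mapping.single (Word [g]) 1"

abbreviation "uK \<equiv> gel GK"
abbreviation "uKi \<equiv> gel GKi"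
abbreviation "uE \<equiv> gel GE"
abbreviation "uF \<equiv> gel GF"

definition uq_rels :: "real \<Rightarrow> ualg set" where
  "uq_rels q =
    {uK * uKi - 1,
     uKi * uK - 1,
     uK * uE - cst (of_real (q\<^sup>2)) * uE * uK,
     uK * uF - cst (of_real (1 / q\<^sup>2)) * uF * uK,
     uE * uF - uF * uE - cst (of_real (1 / (q - 1 / q))) * (uK - uKi)}"

definition uq_ideal :: "real \<Rightarrow> ualg set" where
  "uq_ideal q = module.span (\<lambda>c h. cst c * h) {g * r * h | g r h. r \<in> uq_rels q}"

definition tensor :: "ualg \<Rightarrow> ualg \<Rightarrow> ualg2" where
  "tensor g h = (\<Sum>v\<in>Poly_Mapping.keys g. \<Sum>w\<in>Poly_Mapping.keys h.
     Poly_Mapping.single (v, w) (Poly_Mapping.lookup g v * Poly_Mapping.lookup h w))"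

text \<open>The kernel of the canonical map from \<open>ualg2\<close> onto \<open>U\<^sub>q \<otimes> U\<^sub>q\<close>.\<close>
definition uq_ideal2 :: "real \<Rightarrow> ualg2 set" where
  "uq_ideal2 q = module.span (\<lambda>c h. cst c * h)
     ({tensor j g | j g. j \<in> uq_ideal q} \<union> {tensor g j | j g. j \<in> uq_ideal q})"

definition hom_ext :: "(gen \<Rightarrow> 'b::monoid_add \<Rightarrow>\<^sub>0 complex) \<Rightarrow> ualg \<Rightarrow> ('b \<Rightarrow>\<^sub>0 complex)" where
  "hom_ext \<phi> h = (\<Sum>w\<in>Poly_Mapping.keys h.
     cst (Poly_Mapping.lookup h w) * prod_list (map \<phi> (letters w)))"

definition antihom_ext :: "(gen \<Rightarrow> ualg) \<Rightarrow> ualg \<Rightarrow> ualg" where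
  "antihom_ext \<phi> h = (\<Sum>w\<in>Poly_Mapping.keys h.
     cst (Poly_Mapping.lookup h w) * prod_list (map \<phi> (rev (letters w))))"

fun Delta_gen :: "gen \<Rightarrow> ualg2" where
  "Delta_gen GK = tensor uK uK"
| "Delta_gen GKi = tensor uKi uKi"
| "Delta_gen GE = tensor uE 1 + tensor uK uE"
| "Delta_gen GF = tensor 1 uF + tensor uF uKi"

definition Delta :: "ualg \<Rightarrow> ualg2" where
  "Delta = hom_ext Delta_gen"

fun S_gen :: "gen \<Rightarrow> ualg" where
  "S_gen GK = uKi"
| "S_gen GKi = uK"
| "S_gen GE = - (uKi * uE)"
| "S_gen GF = - (uF * uK)"

definition antipode :: "ualg \<Rightarrow> ualg" where
  "antipode = antihom_ext S_gen"

fun star_gen :: "gen \<Rightarrow> ualg" where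
  "star_gen GK = uK"
| "star_gen GKi = uKi"
| "star_gen GE = uF * uK"
| "star_gen GF = uKi * uE"

definition ustar :: "ualg \<Rightarrow> ualg" where
  "ustar h = (\<Sum>w\<in>Poly_Mapping.keys h.
     cst (cnj (Poly_Mapping.lookup h w)) * prod_list (map star_gen (rev (letters w))))"

fun R_gen :: "real \<Rightarrow> gen \<Rightarrow> ualg" where
  "R_gen q GK = uKi"
| "R_gen q GKi = uK"
| "R_gen q GE = - (cst (of_real q) * uKi * uE)"
| "R_gen q GF = - (cst (of_real (1 / q)) * uF * uK)"

definition unitary_antipode :: "real \<Rightarrow> ualg \<Rightarrow> ualg" where
  "unitary_antipode q = antihom_ext (R_gen q)"

definition counit :: "ualg \<Rightarrow> complex" where
  "counit h = (\<Sum>w\<in>Poly_Mapping.keys h.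
     Poly_Mapping.lookup h w *
     prod_list (map (\<lambda>g. if g = GK \<or> g = GKi then 1 else 0) (letters w)))"


section \<open>The representations \<open>\<pi>\<^sub>s\<close> and \<open>\<O>\<^sub>q(SU(2))\<close>\<close>

definition qbr :: "real \<Rightarrow> real \<Rightarrow> real" where
  "qbr q x = (q powr x - q powr (- x)) / (q - 1 / q)"

definition qcurl :: "real \<Rightarrow> real \<Rightarrow> real" where
  "qcurl q x = q powr x + q powr (- x)"

definition spins :: "real set" where
  "spins = {s. 0 \<le> s \<and> 2 * s \<in> \<nat>}"

definition wts :: "real \<Rightarrow> real set" where
  "wts s = {- s + real m | m::nat. real m \<le> 2 * s}"

text \<open>A vector \<open>v \<in> H\<^sub>s\<close> is the family of its coordinates \<open>v j\<close> with respect to \<open>\<xi>\<^sup>s\<^sub>j\<close>.\<close>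
definition Hs :: "real \<Rightarrow> (real \<Rightarrow> complex) set" where
  "Hs s = {v. \<forall>j. j \<notin> wts s \<longrightarrow> v j = 0}"

definition ipHs :: "real \<Rightarrow> (real \<Rightarrow> complex) \<Rightarrow> (real \<Rightarrow> complex) \<Rightarrow> complex" where
  "ipHs s v w = (\<Sum>j\<in>wts s. cnj (v j) * w j)"

definition e_coef :: "real \<Rightarrow> real \<Rightarrow> real \<Rightarrow> real" where
  "e_coef q s j = q powr (j + 1) * sqrt (qbr q (s - j) * qbr q (s + j + 1))"

definition f_coef :: "real \<Rightarrow> real \<Rightarrow> real \<Rightarrow> real" where
  "f_coef q s j = q powr (- j) * sqrt (qbr q (s + j) * qbr q (s - j + 1))"

text \<open>\<open>e_coef q s j\<close> is the coefficient of \<open>\<xi>\<^sup>s\<^sub>j\<^sub>+\<^sub>1\<close> in \<open>\<pi>\<^sub>s(e)\<xi>\<^sup>s\<^sub>j\<close>, hence the index shifts on coordinates.\<close>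
fun rep_gen :: "real \<Rightarrow> real \<Rightarrow> gen \<Rightarrow> (real \<Rightarrow> complex) \<Rightarrow> (real \<Rightarrow> complex)" where
  "rep_gen q s GK v = (\<lambda>j. of_real (q powr (2 * j)) * v j)"
| "rep_gen q s GKi v = (\<lambda>j. of_real (q powr (- 2 * j)) * v j)"
| "rep_gen q s GE v = (\<lambda>j. of_real (e_coef q s (j - 1)) * v (j - 1))"
| "rep_gen q s GF v = (\<lambda>j. of_real (f_coef q s (j + 1)) * v (j + 1))"

definition rep :: "real \<Rightarrow> real \<Rightarrow> ualg \<Rightarrow> (real \<Rightarrow> complex) \<Rightarrow> (real \<Rightarrow> complex)" where
  "rep q s h v = (\<lambda>j. \<Sum>w\<in>Poly_Mapping.keys h.
     Poly_Mapping.lookup h w * foldr (rep_gen q s) (letters w) v j)"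

type_synonym func = "ualg \<Rightarrow> complex"

definition mcoef :: "real \<Rightarrow> real \<Rightarrow> (real \<Rightarrow> complex) \<Rightarrow> (real \<Rightarrow> complex) \<Rightarrow> func" where
  "mcoef q s \<xi> \<eta> h = ipHs s \<xi> (rep q s h \<eta>)"

definition fscale :: "complex \<Rightarrow> func \<Rightarrow> func" where
  "fscale c x = (\<lambda>h. c * x h)"

definition Oq :: "real \<Rightarrow> func set" where
  "Oq q = module.span fscale {mcoef q s \<xi> \<eta> | s \<xi> \<eta>. s \<in> spins \<and> \<xi> \<in> Hs s \<and> \<eta> \<in> Hs s}"

text \<open>
  The product dual to \<open>Delta\<close>, with unit the counit of \<open>U\<^sub>q\<close>. (The pointwise product and the constant
  function \<open>1\<close> on \<open>func\<close> from \<^theory>\<open>HOL-Library.Function_Algebras\<close> play no role;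
  only the pointwise additive structure is used.)
\<close>
definition amul :: "func \<Rightarrow> func \<Rightarrow> func" where
  "amul x y h = (\<Sum>p\<in>Poly_Mapping.keys (Delta h).
     Poly_Mapping.lookup (Delta h) p *
     x (Poly_Mapping.single (fst p) 1) * y (Poly_Mapping.single (snd p) 1))"

definition aone :: func where
  "aone = counit"

definition astar :: "func \<Rightarrow> func" where
  "astar x h = cnj (x (ustar (antipode h)))"

definition acounit :: "func \<Rightarrow> complex" where
  "acounit x = x 1"

text \<open>
  Since the coproduct of \<open>\<O>\<^sub>q(SU(2))\<close> is dual to the product of \<open>U\<^sub>q\<close>,
  \<open>(x\<^sub>(\<^sub>1\<^sub>)(x\<^sub>(\<^sub>2\<^sub>), h), g) = (x, g h)\<close> and \<open>((x\<^sub>(\<^sub>1\<^sub>), h) x\<^sub>(\<^sub>2\<^sub>), g) = (x, h g)\<close>.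
\<close>
definition lact :: "ualg \<Rightarrow> func \<Rightarrow> func" where
  "lact h x = (\<lambda>g. x (g * h))"

definition ract :: "func \<Rightarrow> ualg \<Rightarrow> func" where
  "ract x h = (\<lambda>g. x (h * g))"


section \<open>The Podles sphere and the coideal \<open>I\<close>\<close>

definition tpar :: "real \<Rightarrow> real \<Rightarrow> real" where
  "tpar q a = q powr a - q powr (- a)"

definition Bt :: "real \<Rightarrow> real \<Rightarrow> ualg" where
  "Bt q a = cst (of_real (q powr (- 1 / 2))) * (uE - uF * uK)
            - cst (\<i> * of_real (tpar q a / (q - 1 / q))) * uK"

definition RB :: "real \<Rightarrow> real \<Rightarrow> ualg" where
  "RB q a = unitary_antipode q (Bt q a)"

text \<open>The preimage in \<open>ualg\<close> of the unital subalgebra of \<open>U\<^sub>q\<close> generated by \<open>R(B\<^sub>t)\<close>.\<close>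
definition Icoid :: "real \<Rightarrow> real \<Rightarrow> ualg set" where
  "Icoid q a = {h. \<exists>g \<in> module.span (\<lambda>c h. cst c * h) (range (\<lambda>n::nat. RB q a ^ n)).
                     h - g \<in> uq_ideal q}"

definition podles :: "real \<Rightarrow> real \<Rightarrow> func set" where
  "podles q a = {x \<in> Oq q. lact (RB q a) x = fscale (counit (Bt q a)) x}"

text \<open>A unit eigenvector of \<open>\<pi>\<^sub>n(iR(B\<^sub>t))\<close>; it is unique up to a phase, which cancels in \<open>u1\<close>.\<close>
definition eta :: "real \<Rightarrow> real \<Rightarrow> nat \<Rightarrow> real \<Rightarrow> (real \<Rightarrow> complex)" where
  "eta q a n x = (SOME v. v \<in> Hs (real n) \<and> ipHs (real n) v v = 1 \<and>
     rep q (real n) (cst \<i> * RB q a) v = (\<lambda>j. of_real x * v j))"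

definition u1 :: "real \<Rightarrow> real \<Rightarrow> func" where
  "u1 q a = mcoef q 1 (eta q a 1 (qbr q a)) (eta q a 1 (qbr q a))"


section \<open>Modules of \<open>\<B> \<bowtie> I\<close>\<close>

record 'v bimodule =
  sc :: "complex \<Rightarrow> 'v \<Rightarrow> 'v"
  bact :: "func \<Rightarrow> 'v \<Rightarrow> 'v"
  iact :: "ualg \<Rightarrow> 'v \<Rightarrow> 'v"

text \<open>
  The last clause is \<open>b h = h\<^sub>(\<^sub>1\<^sub>) (b \<lhd> h\<^sub>(\<^sub>2\<^sub>))\<close>, where \<open>ps\<close> runs through all ways of
  writing \<open>\<Delta>(h)\<close> as an element of \<open>I \<otimes> U\<^sub>q\<close>.
\<close>
definition bowtie_module :: "real \<Rightarrow> real \<Rightarrow> ('v::ab_group_add) bimodule \<Rightarrow> bool" where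
  "bowtie_module q a V \<longleftrightarrow>
     vector_space (sc V) \<and>
     (\<forall>b\<in>podles q a. Vector_Spaces.linear (sc V) (sc V) (bact V b)) \<and>
     (\<forall>b\<in>podles q a. \<forall>c\<in>podles q a. \<forall>v. bact V (b + c) v = bact V b v + bact V c v) \<and>
     (\<forall>b\<in>podles q a. \<forall>z v. bact V (fscale z b) v = sc V z (bact V b v)) \<and>
     (\<forall>v. bact V aone v = v) \<and>
     (\<forall>b\<in>podles q a. \<forall>c\<in>podles q a. \<forall>v. bact V (amul b c) v = bact V b (bact V c v)) \<and>
     (\<forall>h\<in>Icoid q a. Vector_Spaces.linear (sc V) (sc V) (iact V h)) \<and>
     (\<forall>g\<in>Icoid q a. \<forall>h\<in>Icoid q a. \<forall>v. iact V (g + h) v = iact V g v + iact V h v) \<and>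
     (\<forall>h\<in>Icoid q a. \<forall>z v. iact V (cst z * h) v = sc V z (iact V h v)) \<and>
     (\<forall>v. iact V 1 v = v) \<and>
     (\<forall>g\<in>Icoid q a. \<forall>h\<in>Icoid q a. \<forall>v. iact V (g * h) v = iact V g (iact V h v)) \<and>
     (\<forall>h\<in>uq_ideal q. \<forall>v. iact V h v = 0) \<and>
     (\<forall>b\<in>podles q a. \<forall>h\<in>Icoid q a. \<forall>ps :: (ualg \<times> ualg) list.
        (\<forall>(g, g')\<in>set ps. g \<in> Icoid q a) \<longrightarrow>
        Delta h - (\<Sum>(g, g')\<leftarrow>ps. tensor g g') \<in> uq_ideal2 q \<longrightarrow>
        (\<forall>v. bact V b (iact V h v) = (\<Sum>(g, g')\<leftarrow>ps. iact V g (bact V (ract b g') v))))"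

definition weight_space :: "real \<Rightarrow> real \<Rightarrow> ('v::ab_group_add) bimodule \<Rightarrow> real \<Rightarrow> 'v set" where
  "weight_space q a V x = {v. iact V (cst \<i> * RB q a) v = sc V (of_real x) v}"

definition is_weight :: "real \<Rightarrow> real \<Rightarrow> ('v::ab_group_add) bimodule \<Rightarrow> real \<Rightarrow> bool" where
  "is_weight q a V x \<longleftrightarrow> weight_space q a V x \<noteq> {0}"

text \<open>Inner products are linear in the second variable.\<close>
definition inner_product_on ::
  "(complex \<Rightarrow> 'v::ab_group_add \<Rightarrow> 'v) \<Rightarrow> 'v set \<Rightarrow> ('v \<Rightarrow> 'v \<Rightarrow> complex) \<Rightarrow> bool" where
  "inner_product_on scl W ip \<longleftrightarrow>
     (\<forall>u\<in>W. \<forall>v\<in>W. \<forall>w\<in>W. ip u (v + w) = ip u v + ip u w) \<and>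
     (\<forall>u\<in>W. \<forall>v\<in>W. \<forall>c. ip u (scl c v) = c * ip u v) \<and>
     (\<forall>u\<in>W. \<forall>v\<in>W. ip v u = cnj (ip u v)) \<and>
     (\<forall>v\<in>W. v \<noteq> 0 \<longrightarrow> Re (ip v v) > 0)"

definition admissible_star_rep ::
  "real \<Rightarrow> real \<Rightarrow> ('v::ab_group_add) bimodule \<Rightarrow> ('v \<Rightarrow> 'v \<Rightarrow> complex) \<Rightarrow> bool" where
  "admissible_star_rep q a V ip \<longleftrightarrow>
     bowtie_module q a V \<and>
     inner_product_on (sc V) UNIV ip \<and>
     (\<forall>b\<in>podles q a. \<forall>v w. ip (bact V b v) w = ip v (bact V (astar b) w)) \<and>
     (\<forall>h\<in>Icoid q a. \<forall>v w. ip (iact V h v) w = ip v (iact V (ustar h) w)) \<and>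
     module.span (sc V) (\<Union>n::int. weight_space q a V (qbr q (a + of_int n))) = UNIV \<and>
     (\<forall>x. \<exists>T. finite T \<and> weight_space q a V x \<subseteq> module.span (sc V) T)"

definition irreducible_bimodule :: "real \<Rightarrow> real \<Rightarrow> ('v::ab_group_add) bimodule \<Rightarrow> bool" where
  "irreducible_bimodule q a V \<longleftrightarrow>
     (\<exists>v::'v. v \<noteq> 0) \<and>
     (\<forall>W. module.subspace (sc V) W \<and>
          (\<forall>b\<in>podles q a. bact V b ` W \<subseteq> W) \<and> (\<forall>h\<in>Icoid q a. iact V h ` W \<subseteq> W)
          \<longrightarrow> W = {0} \<or> W = UNIV)"

text \<open>
  In the next two definitions \<open>w\<close> stands for the spherical element \<open>u\<^sup>1\<^sub>[\<^sub>a\<^sub>]\<^sub>,\<^sub>[\<^sub>a\<^sub>]\<close> that acts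
  diagonally on \<open>e\<^sub>a\<close>, and will be taken from \<open>{u1 q a, astar (u1 q a)}\<close>. The reason is the
  convention for left modules: \<open>b h = h\<^sub>(\<^sub>1\<^sub>) (b \<lhd> h\<^sub>(\<^sub>2\<^sub>))\<close> gives
  \<open>h c\<^sup>* e\<^sub>a = (c \<lhd> h\<^sup>*)\<^sup>* e\<^sub>a\<close> if \<open>h e\<^sub>a = \<epsilon>(h) e\<^sub>a\<close> for \<open>h \<in> I\<close>, so that it is the adjoint of
  \<open>u1 q a\<close> which preserves the weight of \<open>e\<^sub>a\<close>. The two elements have the same (real) diagonal
  coefficient \<open>\<langle>e\<^sub>a, w e\<^sub>a\<rangle>\<close>.
\<close>

definition is_L_plus ::
  "real \<Rightarrow> real \<Rightarrow> func \<Rightarrow> real \<Rightarrow> ('v::ab_group_add) bimodule \<Rightarrow> ('v \<Rightarrow> 'v \<Rightarrow> complex) \<Rightarrow> 'v \<Rightarrow> bool"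
where
  "is_L_plus q a w lam V ip e \<longleftrightarrow>
     admissible_star_rep q a V ip \<and>
     irreducible_bimodule q a V \<and>
     (\<forall>x. is_weight q a V x \<longleftrightarrow> (\<exists>n::int. x = qbr q (a + 2 * of_int n))) \<and>
     (\<forall>x. is_weight q a V x \<longrightarrow> (\<exists>v. v \<noteq> 0 \<and> weight_space q a V x = module.span (sc V) {v})) \<and>
     e \<in> weight_space q a V (qbr q a) \<and>
     ip e e = 1 \<and>
     bact V w e =
       sc V (of_real ((lam + (tpar q a)\<^sup>2 / (q + 1 / q)) / (q + 1 / q + (tpar q a)\<^sup>2 / (q + 1 / q)))) e"

text \<open>
  The module \<open>\<M>\<close> for the parameter \<open>q + q\<^sup>-\<^sup>1\<close>. The last two clauses say that, as a \<open>\<B>\<close>-module, it is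
  \<open>\<B>/\<B>(1 - w)\<close> with \<open>e\<close> the class of \<open>1\<close>; this expresses generation and universality
  without quantifying over all types of modules.
\<close>
definition is_M_module ::
  "real \<Rightarrow> real \<Rightarrow> func \<Rightarrow> ('v::ab_group_add) bimodule \<Rightarrow> 'v \<Rightarrow> bool" where
  "is_M_module q a w V e \<longleftrightarrow>
     bowtie_module q a V \<and>
     e \<in> weight_space q a V (qbr q a) \<and>
     bact V w e = e \<and>
     (\<forall>v. \<exists>b\<in>podles q a. v = bact V b e) \<and>
     (\<forall>b\<in>podles q a. bact V b e = 0 \<longleftrightarrow> (\<exists>c\<in>podles q a. b = amul c (aone - w)))"

definition cocycle :: "('v::ab_group_add) bimodule \<Rightarrow> 'v \<Rightarrow> func \<Rightarrow> 'v" where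
  "cocycle V e b = bact V b e - sc V (acounit b) e"

definition D2_sum :: "real \<Rightarrow> real \<Rightarrow> ('v::ab_group_add) bimodule \<Rightarrow> 'v \<Rightarrow> 'v set" where
  "D2_sum q a V e = {bact V b e | b. b \<in> podles q a \<and> acounit b = 0}"

definition kappa :: "real \<Rightarrow> real \<Rightarrow> real" where
  "kappa q a = qcurl q (a + 2) / (qcurl q a * (qcurl q (2 * a + 1) + q + 1 / q))"

text \<open>
  \<open>ip\<close> is the invariant inner product on \<open>D2_sum q a M e\<close> obtained from the family
  \<open>(L lam, ipL lam, eL lam)\<close> in the limit of \<open>lam\<close> increasing to \<open>q + q\<^sup>-\<^sup>1\<close>.
\<close>
definition is_limit_inner_product ::
  "real \<Rightarrow> real \<Rightarrow> (real \<Rightarrow> ('l::ab_group_add) bimodule) \<Rightarrow> (real \<Rightarrow> 'l \<Rightarrow> 'l \<Rightarrow> complex) \<Rightarrow> (real \<Rightarrow> 'l)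
   \<Rightarrow> ('v::ab_group_add) bimodule \<Rightarrow> 'v \<Rightarrow> ('v \<Rightarrow> 'v \<Rightarrow> complex) \<Rightarrow> bool" where
  "is_limit_inner_product q a L ipL eL M e ip \<longleftrightarrow>
     inner_product_on (sc M) (D2_sum q a M e) ip \<and>
     (\<forall>b\<in>podles q a. \<forall>v\<in>D2_sum q a M e. \<forall>w\<in>D2_sum q a M e.
        ip (bact M b v) w = ip v (bact M (astar b) w)) \<and>
     (\<forall>x\<in>podles q a. \<forall>y\<in>podles q a.
        ((\<lambda>lam. of_real (kappa q a) *
                ipL lam (cocycle (L lam) (eL lam) x) (cocycle (L lam) (eL lam) y)
                / of_real (q + 1 / q - lam))
         \<longlongrightarrow> ip (cocycle M e x) (cocycle M e y)) (at_left (q + 1 / q)))"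


section \<open>Completions and purely non-Gaussian cocycles\<close>

definition ipnorm :: "('h \<Rightarrow> 'h \<Rightarrow> complex) \<Rightarrow> 'h \<Rightarrow> real" where
  "ipnorm ip v = sqrt (Re (ip v v))"

definition hilbert_space ::
  "(complex \<Rightarrow> 'h::ab_group_add \<Rightarrow> 'h) \<Rightarrow> ('h \<Rightarrow> 'h \<Rightarrow> complex) \<Rightarrow> bool" where
  "hilbert_space scl ip \<longleftrightarrow>
     vector_space scl \<and> inner_product_on scl UNIV ip \<and>
     (\<forall>X :: nat \<Rightarrow> 'h.
        (\<forall>\<epsilon>>0. \<exists>N. \<forall>m\<ge>N. \<forall>n\<ge>N. ipnorm ip (X m - X n) < \<epsilon>) \<longrightarrow>
        (\<exists>l. (\<lambda>n. ipnorm ip (X n - l)) \<longlonglongrightarrow> 0))"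

definition hilbert_completion ::
  "(complex \<Rightarrow> 'v::ab_group_add \<Rightarrow> 'v) \<Rightarrow> 'v set \<Rightarrow> ('v \<Rightarrow> 'v \<Rightarrow> complex)
   \<Rightarrow> (complex \<Rightarrow> 'h::ab_group_add \<Rightarrow> 'h) \<Rightarrow> ('h \<Rightarrow> 'h \<Rightarrow> complex) \<Rightarrow> ('v \<Rightarrow> 'h) \<Rightarrow> bool" where
  "hilbert_completion scl W ip sclH ipH \<iota> \<longleftrightarrow>
     hilbert_space sclH ipH \<and>
     (\<forall>v\<in>W. \<forall>w\<in>W. \<iota> (v + w) = \<iota> v + \<iota> w) \<and>
     (\<forall>v\<in>W. \<forall>c. \<iota> (scl c v) = sclH c (\<iota> v)) \<and>
     (\<forall>v\<in>W. \<forall>w\<in>W. ipH (\<iota> v) (\<iota> w) = ip v w) \<and>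
     (\<forall>h. \<forall>\<epsilon>>0. \<exists>v\<in>W. ipnorm ipH (h - \<iota> v) < \<epsilon>)"

definition orth_complement :: "('h::ab_group_add \<Rightarrow> 'h \<Rightarrow> complex) \<Rightarrow> 'h set \<Rightarrow> 'h set" where
  "orth_complement ip S = {h. \<forall>s\<in>S. ip s h = 0}"

definition orth_projection ::
  "('h::ab_group_add \<Rightarrow> 'h \<Rightarrow> complex) \<Rightarrow> 'h set \<Rightarrow> 'h \<Rightarrow> 'h" where
  "orth_projection ip K h = (THE p. p \<in> K \<and> h - p \<in> orth_complement ip K)"

text \<open>
  \<open>C\<close> is a cocycle on the algebra \<open>B\<close> with values in the subspace \<open>W\<close> of \<open>V\<close>, and \<open>(ipH, \<iota>)\<close> is a
  Hilbert space completion of \<open>W\<close>.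
\<close>
definition gaussian_space ::
  "func set \<Rightarrow> ('v::ab_group_add) bimodule \<Rightarrow> (func \<Rightarrow> 'v)
   \<Rightarrow> ('h::ab_group_add \<Rightarrow> 'h \<Rightarrow> complex) \<Rightarrow> ('v \<Rightarrow> 'h) \<Rightarrow> 'h set" where
  "gaussian_space B V C ipH \<iota> =
     orth_complement ipH {\<iota> (bact V b (C c) - sc V (acounit b) (C c)) | b c. b \<in> B \<and> c \<in> B}"

definition purely_non_gaussian ::
  "func set \<Rightarrow> ('v::ab_group_add) bimodule \<Rightarrow> (func \<Rightarrow> 'v) \<Rightarrow> 'v set
   \<Rightarrow> ('h::ab_group_add \<Rightarrow> 'h \<Rightarrow> complex) \<Rightarrow> ('v \<Rightarrow> 'h) \<Rightarrow> bool" where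
  "purely_non_gaussian B V C W ipH \<iota> \<longleftrightarrow>
     orth_projection ipH (gaussian_space B V C ipH \<iota>) ` (\<iota> ` W) = {0}"

end

theory Submission
  imports Defs
begin

text \<open>
  A vector \<open>h\<close> of the Gaussian subspace gives an \<open>\<epsilon>\<close>-derivation \<open>\<phi>(b) = \<langle>h, C(b)\<rangle>\<close> of the sphere.
  Let \<open>Z\<close> and \<open>A\<close> be the normalised spin-one elements of weight \<open>-1\<close> and \<open>0\<close>, so \<open>\<epsilon>(Z) = 1\<close> and
  \<open>\<epsilon>(A) = 0\<close>. From \<open>A Z = q\<^sup>2 Z A\<close> one gets \<open>\<phi>(A) = 0\<close>. Weight vectors of the sphere are determined by
  their values on the powers of \<open>e\<close>, so those of weight \<open>-n \<le> 0\<close> are the polynomials \<open>Z\<^sup>n p(A)\<close>; a vector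
  \<open>x\<close> of weight \<open>n > 0\<close> is reduced to \<open>Z\<^sup>n x\<close>. Hence \<open>\<phi>(x) = - n \<phi>(Z) \<epsilon>(x)\<close> for \<open>x\<close> of weight \<open>n\<close>, that is,
  the \<open>\<epsilon>\<close>-derivations form a line, spanned by differentiation along the circle of characters.
  This derivation does not vanish on \<open>w\<close> because the components of weight \<open>1\<close> and \<open>-1\<close> of the spherical
  vector have different length, whereas \<open>\<phi>(w) = 0\<close> because \<open>C(w) = 0\<close>. So \<open>\<phi> = 0\<close>, and \<open>h = 0\<close> as
  \<open>C\<close> has dense range.
\<close>

section \<open>Functionals and the product of \<open>\<O>\<^sub>q(SU(2))\<close>\<close>

text \<open>Applying \<phi> to \<open>A Z = q^2 Z A\<close> gives
  \<open>\<phi> A = q^2 * \<phi> A\<close>, because the counit is 0 on \<open>A\<close> and 1 on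
  \<open>Z\<close>. Polynomials in \<open>A\<close> suffice because left multiplication by
  \<open>Z\<close> is diagonal on the values at powers of \<open>e\<close>, while left
  multiplication by \<open>A\<close> raises the degree by one with a nonzero factor. So
  \<open>Z^n A^N\<close> has degree exactly \<open>N\<close>, and elimination from the top degree
  works. The main obstacle is that products such as \<open>Z^n x\<close> must again lie in the
  sphere, while \<open>Oq\<close> is only a span of matrix coefficients. Its closure under the
  product takes the Clebsch--Gordan decomposition with the spin-1/2 representation. The sphere is
  cut out of all of \<open>Oq\<close>, so half-integer weights are not excluded by its definition,
  and the formula for \<phi> covers integer weights only. Products of two vectors whose weights
  differ by an integer bring the remaining ones back to integer weights. The unequal lengths come
  from the middle coordinate of the eigenvector equation, which forces
  \<open>v (-1) = v 1 / q\<close>. Passing from \<open>u1\<close> to its adjoint reverses weights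
  and changes only the sign of \<phi>.\<close>

lemma poly_mapping_induct_single [case_names zero add]:
  assumes "P 0" and "\<And>g w c. P g \<Longrightarrow> P (g + Poly_Mapping.single w c)"
  shows "P (h :: 'k \<Rightarrow>\<^sub>0 'b::comm_monoid_add)"
proof (induction h rule: Poly_Mapping.update_induct)
  case const
  show ?case by (fact assms)
next
  case (update f a b)
  have "Poly_Mapping.update a b f = f + Poly_Mapping.single a b"
    using update by (intro poly_mapping_eqI)
      (auto simp: lookup_update lookup_add lookup_single in_keys_iff when_def)
  with update assms show ?case by simp
qed

text \<open>Cancellation may remove keys from \<open>g + h\<close>. An additive \<open>T k\<close>
  vanishes at 0, so the missing keys contribute nothing.\<close>

lemma sum_keys_add:
  fixes h g :: "'k \<Rightarrow>\<^sub>0 'b::ab_group_add" and T :: "'k \<Rightarrow> 'b \<Rightarrow> 'r::ab_group_add"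
  assumes "\<And>k a b. T k (a + b) = T k a + T k b"
  shows "(\<Sum>k\<in>Poly_Mapping.keys (g + h). T k (Poly_Mapping.lookup (g + h) k)) =
    (\<Sum>k\<in>Poly_Mapping.keys g. T k (Poly_Mapping.lookup g k)) +
    (\<Sum>k\<in>Poly_Mapping.keys h. T k (Poly_Mapping.lookup h k))"
proof (rule setsum_keys_plus_distrib)
  fix k show "T k 0 = 0" using assms[of k 0 0] by simp
qed (simp add: assms)

lemma cst_0 [simp]: "cst 0 = 0" and cst_1 [simp]: "cst 1 = 1"
  by (simp_all add: cst_def)

lemma cst_add: "cst (c + d) = cst c + cst d"
  by (simp add: cst_def single_add)

lemma cst_mult: "cst (c * d) = cst c * cst d"
  by (simp add: cst_def mult_single)

lemma cst_single: "cst c * Poly_Mapping.single w d = Poly_Mapping.single w (c * d)"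
  by (simp add: cst_def mult_single)

lemma cst_central: "h * cst c = cst c * h"
  by (induction h rule: poly_mapping_induct_single)
     (simp_all add: algebra_simps cst_def mult_single)

lemma cst_left_commute: "g * (cst c * h) = cst c * (g * h)"
  by (metis cst_central mult.assoc)

lemma cst_uminus_1: "cst (-1) * h = - h"
  by (simp add: cst_def single_uminus)

lemma hom_ext_0 [simp]: "hom_ext \<phi> 0 = 0"
  by (simp add: hom_ext_def)

lemma hom_ext_add: "hom_ext \<phi> (g + h) = hom_ext \<phi> g + hom_ext \<phi> h"
  unfolding hom_ext_def
  by (rule sum_keys_add) (simp add: cst_add algebra_simps)

lemma hom_ext_single:
  "hom_ext \<phi> (Poly_Mapping.single w c) = cst c * prod_list (map \<phi> (letters w))"
  by (cases "c = 0") (simp_all add: hom_ext_def)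

lemma hom_ext_mult: "hom_ext \<phi> (g * h) = hom_ext \<phi> g * hom_ext \<phi> h"
proof (induction g rule: poly_mapping_induct_single)
  case zero
  show ?case by simp
next
  case (add g v c)
  have "hom_ext \<phi> (Poly_Mapping.single v c * h) = hom_ext \<phi> (Poly_Mapping.single v c) * hom_ext \<phi> h"
  proof (induction h rule: poly_mapping_induct_single)
    case (add h w d)
    have "cst c * P * (cst d * Q) = cst c * (cst d * (P * Q))" for P Q :: "'a \<Rightarrow>\<^sub>0 complex"
      by (simp only: mult.assoc cst_left_commute[of P])
    with add show ?case
      by (simp add: distrib_left hom_ext_add mult_single hom_ext_single plus_word_def cst_mult mult.assoc)
  qed simp
  with add show ?case by (simp add: distrib_right hom_ext_add)
qed

lemma Delta_add: "Delta (g + h) = Delta g + Delta h"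
  by (simp add: Delta_def hom_ext_add)

lemma Delta_mult: "Delta (g * h) = Delta g * Delta h"
  by (simp add: Delta_def hom_ext_mult)

lemma Delta_gel: "Delta (gel g) = Delta_gen g"
  by (simp add: Delta_def gel_def hom_ext_single)

lemma Delta_cst: "Delta (cst c) = cst c"
  by (simp add: Delta_def cst_def[of c] hom_ext_single zero_word_def)

lemma single_0_1_word: "(1::ualg) = Poly_Mapping.single (Word []) 1"
  by (metis single_one zero_word_def)

lemma tensor_single:
  "tensor (Poly_Mapping.single v c) (Poly_Mapping.single w d) = Poly_Mapping.single (v, w) (c * d)"
  by (cases "c = 0"; cases "d = 0") (simp_all add: tensor_def)

text \<open>The type \<open>func\<close> contains arbitrary functions on \<open>ualg\<close>, so
  linearity has to be carried as a predicate. Linear functionals may then be compared on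
  words.\<close>

definition lin :: "func \<Rightarrow> bool" where
  "lin x \<longleftrightarrow> (\<forall>g h. x (g + h) = x g + x h) \<and> (\<forall>c h. x (cst c * h) = c * x h)"

lemma lin_add: "lin x \<Longrightarrow> x (g + h) = x g + x h"
  and lin_cst: "lin x \<Longrightarrow> x (cst c * h) = c * x h"
  by (auto simp: lin_def)

lemma lin_0: "lin x \<Longrightarrow> x 0 = 0"
  using lin_cst[of x 0 0] by simp

lemma lin_uminus: "lin x \<Longrightarrow> x (- h) = - x h"
  using lin_cst[of x "-1" h] by (simp add: cst_uminus_1)

lemma lin_diff: "lin x \<Longrightarrow> x (g - h) = x g - x h"
  using lin_add[of x g "- h"] by (simp add: lin_uminus)

lemmas lin_simps = lin_add lin_cst lin_uminus lin_diff lin_0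

lemma single_eq_cst: "Poly_Mapping.single w c = cst c * Poly_Mapping.single w 1"
  by (simp add: cst_single)

lemma single_Cons: "Poly_Mapping.single (Word (g # ws)) (1::complex) = gel g * Poly_Mapping.single (Word ws) 1"
  by (simp add: gel_def mult_single plus_word_def)

lemma single_snoc: "Poly_Mapping.single (Word (ws @ [g])) (1::complex) = Poly_Mapping.single (Word ws) 1 * gel g"
  by (simp add: gel_def mult_single plus_word_def)

lemma lin_eqI:
  assumes "lin x" "lin y" and "\<And>w. x (Poly_Mapping.single w 1) = y (Poly_Mapping.single w 1)"
  shows "x = y"
proof
  fix h show "x h = y h"
  proof (induction h rule: poly_mapping_induct_single)
    case (add g w c)
    have "x (cst c * Poly_Mapping.single w 1) = y (cst c * Poly_Mapping.single w 1)"
      using assms by (simp add: lin_cst)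
    with add show ?case using assms by (simp add: lin_add flip: single_eq_cst)
  qed (use assms in \<open>simp add: lin_0\<close>)
qed

section \<open>Left and right translations of functionals\<close>

lemma lin_lact: "lin x \<Longrightarrow> lin (lact g x)"
  by (auto simp: lin_def lact_def distrib_right mult.assoc)

lemma lin_ract: "lin x \<Longrightarrow> lin (ract x g)"
  by (auto simp: lin_def ract_def distrib_left cst_left_commute)

lemma lin_plus: "lin x \<Longrightarrow> lin y \<Longrightarrow> lin (x + y)"
  and lin_fscale: "lin x \<Longrightarrow> lin (fscale c x)"
  by (auto simp: lin_def fscale_def algebra_simps)

lemma lin_zero_func: "lin 0"
  by (auto simp: lin_def)

lemma lin_minus: "lin x \<Longrightarrow> lin y \<Longrightarrow> lin (x - y)"
  by (auto simp: lin_def algebra_simps)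

interpretation fs: vector_space fscale
  by unfold_locales (auto simp: fscale_def algebra_simps)

lemma fs_sum_apply: "(\<Sum>i\<in>I. x i) h = (\<Sum>i\<in>I. x i h)" for x :: "'i \<Rightarrow> func"
  by (induction I rule: infinite_finite_induct) auto

lemma lact_lact: "lact g (lact h x) = lact (g * h) x"
  by (simp add: lact_def mult.assoc)

lemma ract_ract: "ract (ract x g) h = ract x (g * h)"
  by (simp add: ract_def mult.assoc)

lemma lact_ract: "lact g (ract x h) = ract (lact g x) h"
  by (simp add: lact_def ract_def mult.assoc)

lemma lact_plus: "lact g (x + y) = lact g x + lact g y"
  and lact_minus: "lact g (x - y) = lact g x - lact g y"
  and lact_fscale: "lact g (fscale c x) = fscale c (lact g x)"
  and lact_zero: "lact g 0 = 0"
  and ract_plus: "ract (x + y) g = ract x g + ract y g"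
  and ract_minus: "ract (x - y) g = ract x g - ract y g"
  and ract_fscale: "ract (fscale c x) g = fscale c (ract x g)"
  and ract_zero: "ract 0 g = 0"
  by (auto simp: lact_def ract_def fscale_def)

lemmas act_simps = lact_plus lact_minus lact_fscale lact_zero ract_plus ract_minus ract_fscale ract_zero

lemma ract_sum: "ract (\<Sum>i\<in>I. x i) g = (\<Sum>i\<in>I. ract (x i) g)"
  by (rule ext) (simp add: lact_def ract_def fs_sum_apply)

lemma lact_sum: "lact g (\<Sum>i\<in>I. x i) = (\<Sum>i\<in>I. lact g (x i))"
  by (rule ext) (simp add: lact_def ract_def fs_sum_apply)

text \<open>The tensor product of \<open>x\<close> and \<open>y\<close> as a functional on the
  tensor square. Only values on words enter, so it is linear in \<open>T\<close> for arbitrary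
  \<open>x\<close> and \<open>y\<close>, which is why \<open>lin_amul\<close> has no
  hypotheses.\<close>

definition pair :: "func \<Rightarrow> func \<Rightarrow> ualg2 \<Rightarrow> complex" where
  "pair x y T = (\<Sum>p\<in>Poly_Mapping.keys T. Poly_Mapping.lookup T p *
     x (Poly_Mapping.single (fst p) 1) * y (Poly_Mapping.single (snd p) 1))"

lemma amul_pair: "amul x y h = pair x y (Delta h)"
  by (simp add: amul_def pair_def)

lemma pair_add: "pair x y (S + T) = pair x y S + pair x y T"
  unfolding pair_def by (rule sum_keys_add) (simp add: algebra_simps)

lemma pair_0 [simp]: "pair x y 0 = 0"
  by (simp add: pair_def)

lemma pair_single: "pair x y (Poly_Mapping.single (v, w) c) =
    c * x (Poly_Mapping.single v 1) * y (Poly_Mapping.single w 1)"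
  by (cases "c = 0") (simp_all add: pair_def)

lemma pair_cst: "pair x y (cst c * T) = c * pair x y T"
  by (induction T rule: poly_mapping_induct_single)
     (auto simp: distrib_left pair_add cst_single pair_single algebra_simps)

lemma pair_mult_single:
  "pair x y (T * Poly_Mapping.single (v, w) 1) =
   pair (lact (Poly_Mapping.single v 1) x) (lact (Poly_Mapping.single w 1) y) T"
  by (induction T rule: poly_mapping_induct_single)
     (auto simp: distrib_right pair_add mult_single pair_single lact_def)

lemma pair_single_mult:
  "pair x y (Poly_Mapping.single (v, w) 1 * T) =
   pair (ract x (Poly_Mapping.single v 1)) (ract y (Poly_Mapping.single w 1)) T"
  by (induction T rule: poly_mapping_induct_single)
     (auto simp: distrib_left pair_add mult_single pair_single ract_def)

lemma Delta_gen_single: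
  "Delta_gen GK = Poly_Mapping.single (Word [GK], Word [GK]) 1"
  "Delta_gen GKi = Poly_Mapping.single (Word [GKi], Word [GKi]) 1"
  "Delta_gen GE = Poly_Mapping.single (Word [GE], Word []) 1 + Poly_Mapping.single (Word [GK], Word [GE]) 1"
  "Delta_gen GF = Poly_Mapping.single (Word [], Word [GF]) 1 + Poly_Mapping.single (Word [GF], Word [GKi]) 1"
  by (simp_all add: gel_def tensor_single single_0_1_word)

lemma lact_1 [simp]: "lact 1 x = x" and ract_1 [simp]: "ract x 1 = x"
  by (simp_all add: lact_def ract_def)

lemma lact_Nil [simp]: "lact (Poly_Mapping.single (Word []) 1) x = x"
  and ract_Nil [simp]: "ract x (Poly_Mapping.single (Word []) 1) = x"
  by (simp_all flip: single_0_1_word)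

text \<open>The coproducts of the generators become twisted Leibniz rules. Associativity, the unit
  law, the Clebsch--Gordan formula and the membership of products in the sphere are deduced from
  these rules.\<close>

lemma amul_lact:
  "lact uK (amul x y) = amul (lact uK x) (lact uK y)"
  "lact uKi (amul x y) = amul (lact uKi x) (lact uKi y)"
  "lact uE (amul x y) = amul (lact uE x) y + amul (lact uK x) (lact uE y)"
  "lact uF (amul x y) = amul x (lact uF y) + amul (lact uF x) (lact uKi y)"
  unfolding lact_def[of uK "amul x y"] lact_def[of uKi "amul x y"] lact_def[of uE "amul x y"]
    lact_def[of uF "amul x y"] amul_pair
  by (auto simp: Delta_mult Delta_gel Delta_gen_single distrib_left pair_add
      pair_mult_single gel_def[symmetric] amul_pair simp del: Delta_gen.simps)

lemma amul_ract:
  "ract (amul x y) uK = amul (ract x uK) (ract y uK)"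
  "ract (amul x y) uKi = amul (ract x uKi) (ract y uKi)"
  "ract (amul x y) uE = amul (ract x uE) y + amul (ract x uK) (ract y uE)"
  "ract (amul x y) uF = amul x (ract y uF) + amul (ract x uF) (ract y uKi)"
  unfolding ract_def[of "amul x y" uK] ract_def[of "amul x y" uKi] ract_def[of "amul x y" uE]
    ract_def[of "amul x y" uF] amul_pair
  by (auto simp: Delta_mult Delta_gel Delta_gen_single distrib_right pair_add
      pair_single_mult gel_def[symmetric] amul_pair simp del: Delta_gen.simps)

lemma lin_amul: "lin (amul x y)"
  by (auto simp: lin_def amul_pair Delta_add pair_add Delta_mult Delta_cst pair_cst)

lemma amul_plus_left: "amul (x + x') y = amul x y + amul x' y"
  and amul_plus_right: "amul x (y + y') = amul x y + amul x y'"
  and amul_minus_left: "amul (x - x') y = amul x y - amul x' y"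
  and amul_minus_right: "amul x (y - y') = amul x y - amul x y'"
  and amul_fscale_left: "amul (fscale c x) y = fscale c (amul x y)"
  and amul_fscale_right: "amul x (fscale c y) = fscale c (amul x y)"
  and amul_zero_left: "amul 0 y = 0"
  and amul_zero_right: "amul x 0 = 0"
  by (auto simp: amul_def fscale_def algebra_simps sum.distrib sum_subtractf sum_distrib_left)

lemmas amul_simps = amul_plus_left amul_plus_right amul_minus_left amul_minus_right
  amul_fscale_left amul_fscale_right amul_zero_left amul_zero_right

lemma acounit_amul: "acounit (amul x y) = acounit x * acounit y"
  using pair_single[of x y "Word []" "Word []" 1] Delta_cst[of 1]
  by (simp add: acounit_def amul_pair single_0_1_word)
     (metis single_0_1_word single_one zero_prod_def zero_word_def)

lemma acounit_simps: "acounit (x + y) = acounit x + acounit y" "acounit (x - y) = acounit x - acounit y"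
  "acounit (fscale c x) = c * acounit x" "acounit 0 = 0"
  by (auto simp: acounit_def fscale_def)

lemma single_snoc_apply:
  "x (Poly_Mapping.single (Word (ws @ [g])) 1) = lact (gel g) x (Poly_Mapping.single (Word ws) 1)"
  and single_Cons_apply:
  "x (Poly_Mapping.single (Word (g # ws)) 1) = ract x (gel g) (Poly_Mapping.single (Word ws) 1)"
  by (simp_all add: single_snoc single_Cons lact_def ract_def)

text \<open>Both sides obey the same Leibniz rules, so letters can be stripped from the right of a
  word, replacing \<open>x\<close>, \<open>y\<close>, \<open>z\<close> by translates. At the empty
  word the claim is multiplicativity of the counit.\<close>

lemma amul_assoc: "amul (amul x y) z = amul x (amul y z)"
proof (rule lin_eqI)
  fix w :: word
  have "amul (amul x y) z (Poly_Mapping.single (Word ws) 1) =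
    amul x (amul y z) (Poly_Mapping.single (Word ws) 1)" for ws
  proof (induction ws arbitrary: x y z rule: rev_induct)
    case Nil
    have "acounit (amul (amul x y) z) = acounit (amul x (amul y z))"
      by (simp only: acounit_amul mult.assoc)
    then show ?case by (simp add: acounit_def single_0_1_word)
  next
    case (snoc g ws)
    show ?case unfolding single_snoc_apply
      by (cases g) (simp_all add: amul_lact amul_simps snoc.IH)
  qed
  from this[of "letters w"] show "amul (amul x y) z (Poly_Mapping.single w 1) =
      amul x (amul y z) (Poly_Mapping.single w 1)"
    by simp
qed (rule lin_amul)+

section \<open>The unit of the product\<close>

lemma aone_add: "aone (g + h) = aone g + aone h"
  unfolding aone_def counit_def by (rule sum_keys_add) (simp add: algebra_simps)

lemma aone_single: "aone (Poly_Mapping.single w c) =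
    c * prod_list (map (\<lambda>g. if g = GK \<or> g = GKi then 1 else 0) (letters w))"
  by (cases "c = 0") (simp_all add: aone_def counit_def)

lemma lin_aone: "lin aone"
proof -
  have "aone (cst c * h) = c * aone h" for c h
  proof (induction h rule: poly_mapping_induct_single)
    case zero show ?case by (simp add: aone_def counit_def)
  qed (simp add: distrib_left aone_add cst_single aone_single algebra_simps)
  then show ?thesis by (simp add: lin_def aone_add)
qed

lemma aone_lact_gel: "lact (gel g) aone = fscale (if g = GK \<or> g = GKi then 1 else 0) aone"
  by (rule lin_eqI; simp add: lin_lact lin_aone lin_fscale;
      simp add: lact_def fscale_def gel_def mult_single aone_single plus_word_def)

lemma aone_ract_gel: "ract aone (gel g) = fscale (if g = GK \<or> g = GKi then 1 else 0) aone"
  by (rule lin_eqI; simp add: lin_ract lin_aone lin_fscale;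
      simp add: ract_def fscale_def gel_def mult_single aone_single plus_word_def)

lemma aone_lact: "lact uK aone = aone" "lact uKi aone = aone" "lact uE aone = 0" "lact uF aone = 0"
  and aone_ract: "ract aone uK = aone" "ract aone uKi = aone" "ract aone uE = 0" "ract aone uF = 0"
  by (simp_all add: aone_lact_gel aone_ract_gel)

lemma acounit_aone [simp]: "acounit aone = 1"
  by (simp add: acounit_def single_0_1_word aone_single)

lemma amul_aone_left:
  assumes "lin x"
  shows "amul aone x = x"
proof (rule lin_eqI)
  fix w :: word
  have "amul aone x (Poly_Mapping.single (Word ws) 1) = x (Poly_Mapping.single (Word ws) 1)" for ws
  proof (induction ws arbitrary: x rule: rev_induct)
    case Nil
    have "acounit (amul aone x) = acounit x" by (simp add: acounit_amul)
    then show ?case by (simp add: acounit_def single_0_1_word)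
  next
    case (snoc g ws)
    then show ?case unfolding single_snoc_apply
      by (cases g) (simp_all add: amul_lact amul_simps aone_lact)
  qed
  from this[of "letters w"] show "amul aone x (Poly_Mapping.single w 1) = x (Poly_Mapping.single w 1)"
    by simp
qed (use lin_amul assms in auto)

lemma lact_arg:
  assumes "lin x"
  shows "lact (g + h) x = lact g x + lact h x" "lact (g - h) x = lact g x - lact h x"
    "lact (cst c * h) x = fscale c (lact h x)" "lact (- h) x = - lact h x"
    and "ract x (g + h) = ract x g + ract x h" "ract x (g - h) = ract x g - ract x h"
    "ract x (cst c * h) = fscale c (ract x h)"
  using assms by (auto simp: lact_def ract_def fscale_def fun_eq_iff plus_fun_apply distrib_left distrib_right
      left_diff_distrib right_diff_distrib lin_simps cst_left_commute mult.assoc)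

lemma lact_cst: "lin x \<Longrightarrow> lact (cst c) x = fscale c x"
  by (simp add: lact_def fscale_def cst_central lin_cst)

lemma fscale_apply: "fscale c x h = c * x h"
  by (simp add: fscale_def)

lemma antihom_ext_add: "antihom_ext \<phi> (g + h) = antihom_ext \<phi> g + antihom_ext \<phi> h"
  unfolding antihom_ext_def
  by (rule sum_keys_add) (simp add: cst_add algebra_simps)

lemma antihom_ext_single:
  "antihom_ext \<phi> (Poly_Mapping.single w c) = cst c * prod_list (map \<phi> (rev (letters w)))"
  by (cases "c = 0") (simp_all add: antihom_ext_def)

declare plus_fun_apply [simp del] zero_fun_apply [simp del] minus_apply [simp del] uminus_apply [simp del]

section \<open>The representations \<open>\<pi>\<^sub>s\<close>\<close>

definition delta :: "real \<Rightarrow> real \<Rightarrow> complex" where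
  "delta j = (\<lambda>k. if k = j then 1 else 0)"

lemma rep_gen_add: "rep_gen q s g (\<lambda>j. v j + u j) = (\<lambda>j. rep_gen q s g v j + rep_gen q s g u j)"
  and rep_gen_scale: "rep_gen q s g (\<lambda>j. c * v j) = (\<lambda>j. c * rep_gen q s g v j)"
  by (cases g; simp add: algebra_simps fun_eq_iff)+

lemma foldr_rep_gen_add: "foldr (rep_gen q s) ws (\<lambda>j. v j + u j) =
    (\<lambda>j. foldr (rep_gen q s) ws v j + foldr (rep_gen q s) ws u j)"
  and foldr_rep_gen_scale: "foldr (rep_gen q s) ws (\<lambda>j. c * v j) =
    (\<lambda>j. c * foldr (rep_gen q s) ws v j)"
  by (induction ws) (simp_all add: rep_gen_add rep_gen_scale)

lemma rep_add: "rep q s (g + h) v = (\<lambda>j. rep q s g v j + rep q s h v j)"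
  unfolding rep_def by (rule ext, rule sum_keys_add) (simp add: algebra_simps)

lemma rep_single: "rep q s (Poly_Mapping.single w c) v = (\<lambda>j. c * foldr (rep_gen q s) (letters w) v j)"
  by (cases "c = 0") (simp_all add: rep_def)

lemma rep_0 [simp]: "rep q s 0 v = (\<lambda>j. 0)"
  by (simp add: rep_def)

lemma rep_add_right: "rep q s h (\<lambda>j. v j + u j) = (\<lambda>j. rep q s h v j + rep q s h u j)"
  and rep_scale_right: "rep q s h (\<lambda>j. c * v j) = (\<lambda>j. c * rep q s h v j)"
  by (induction h rule: poly_mapping_induct_single)
     (simp_all add: rep_add rep_single foldr_rep_gen_add foldr_rep_gen_scale algebra_simps)

lemma rep_zero_right: "rep q s h (\<lambda>j. 0) = (\<lambda>j. 0)"
  using rep_scale_right[of q s h 0 "\<lambda>j. 0"] by simp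

lemma rep_sum_right:
  "finite I \<Longrightarrow> rep q s h (\<lambda>j. \<Sum>i\<in>I. c i * v i j) = (\<lambda>j. \<Sum>i\<in>I. c i * rep q s h (v i) j)"
  by (induction I rule: finite_induct) (simp_all add: rep_zero_right rep_add_right rep_scale_right)

lemma rep_mult: "rep q s (g * h) v = rep q s g (rep q s h v)"
proof (induction g rule: poly_mapping_induct_single)
  case (add g w c)
  have "rep q s (Poly_Mapping.single w c * h) v = rep q s (Poly_Mapping.single w c) (rep q s h v)"
    by (induction h rule: poly_mapping_induct_single)
       (simp_all add: rep_add rep_single distrib_left mult_single plus_word_def
          foldr_rep_gen_add foldr_rep_gen_scale algebra_simps rep_zero_right)
  with add show ?case by (simp add: distrib_right rep_add)
qed simp

lemma rep_gel: "rep q s (gel g) v = rep_gen q s g v"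
  by (simp add: gel_def rep_single)

lemma rep_cst: "rep q s (cst c) v = (\<lambda>j. c * v j)"
  by (simp add: cst_def rep_single zero_word_def)

lemma rep_1: "rep q s 1 v = v"
  using rep_cst[of q s 1 v] by simp

lemma rep_uminus: "rep q s (- h) v = (\<lambda>j. - rep q s h v j)"
  by (simp add: rep_mult rep_cst flip: cst_uminus_1)

lemma rep_diff: "rep q s (g - h) v = (\<lambda>j. rep q s g v j - rep q s h v j)"
  using rep_add[of q s g "- h" v] by (simp add: rep_uminus)

lemmas rep_simps = rep_add rep_diff rep_uminus rep_mult rep_gel rep_cst rep_1

lemma wts_le: "j \<in> wts s \<Longrightarrow> - s \<le> j \<and> j \<le> s"
  by (auto simp: wts_def)

lemma wts_bot: "s \<in> spins \<Longrightarrow> - s \<in> wts s"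
  by (auto simp: spins_def wts_def intro!: exI[of _ "0::nat"])

lemma wts_Suc: "s \<in> spins \<Longrightarrow> j \<in> wts s \<Longrightarrow> j \<noteq> s \<Longrightarrow> j + 1 \<in> wts s"
proof -
  assume *: "s \<in> spins" "j \<in> wts s" "j \<noteq> s"
  then obtain m N :: nat where "j = - s + real m" "real m \<le> 2 * s" "2 * s = real N"
    by (auto simp: spins_def wts_def Nats_def)
  with * show ?thesis
    by (auto simp: wts_def intro!: exI[of _ "Suc m"])
qed

lemma wts_pred: "s \<in> spins \<Longrightarrow> j \<in> wts s \<Longrightarrow> j \<noteq> - s \<Longrightarrow> j - 1 \<in> wts s"
proof -
  assume *: "s \<in> spins" "j \<in> wts s" "j \<noteq> - s"
  then obtain m :: nat where m: "j = - s + real m" "real m \<le> 2 * s"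
    by (auto simp: wts_def)
  with * obtain m' where "m = Suc m'" by (cases m) auto
  with m show ?thesis
    by (auto simp: wts_def intro!: exI[of _ m'])
qed

lemma wts_uminus: "s \<in> spins \<Longrightarrow> j \<in> wts s \<Longrightarrow> - j \<in> wts s"
proof -
  assume "s \<in> spins" "j \<in> wts s"
  then obtain m N :: nat where "j = - s + real m" "real m \<le> 2 * s" "2 * s = real N"
    by (auto simp: spins_def wts_def Nats_def)
  then show ?thesis
    by (auto simp: wts_def intro!: exI[of _ "N - m"])
qed

lemma finite_wts [simp]: "finite (wts s)"
proof -
  have "wts s \<subseteq> (\<lambda>m. - s + real m) ` {.. nat \<lceil>2 * s\<rceil>}"
    unfolding wts_def by (auto intro!: image_eqI) linarith
  then show ?thesis by (rule finite_subset) simp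
qed

text \<open>Indices outside \<open>wts s\<close> are allowed, so that the translation formulas hold
  without case distinctions. The ends of the ladder are handled by \<open>coef_boundary\<close> and
  \<open>tco_eq_0\<close>.\<close>

definition tco :: "real \<Rightarrow> real \<Rightarrow> real \<Rightarrow> real \<Rightarrow> func" where
  "tco q s i j h = rep q s h (delta j) i"

lemma lin_tco: "lin (tco q s i j)"
  by (simp add: lin_def tco_def rep_simps)

lemma acounit_tco: "acounit (tco q s i j) = (if i = j then 1 else 0)"
  by (simp add: acounit_def tco_def rep_simps delta_def)

lemma delta_gen:
  "rep_gen q s GK (delta j) = (\<lambda>i. of_real (q powr (2 * j)) * delta j i)"
  "rep_gen q s GKi (delta j) = (\<lambda>i. of_real (q powr (- 2 * j)) * delta j i)"
  "rep_gen q s GE (delta j) = (\<lambda>i. of_real (e_coef q s j) * delta (j + 1) i)"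
  "rep_gen q s GF (delta j) = (\<lambda>i. of_real (f_coef q s j) * delta (j - 1) i)"
  by (auto simp: fun_eq_iff delta_def)

lemma lact_tco:
  "lact uK (tco q s i j) = fscale (of_real (q powr (2 * j))) (tco q s i j)"
  "lact uKi (tco q s i j) = fscale (of_real (q powr (- 2 * j))) (tco q s i j)"
  "lact uE (tco q s i j) = fscale (of_real (e_coef q s j)) (tco q s i (j + 1))"
  "lact uF (tco q s i j) = fscale (of_real (f_coef q s j)) (tco q s i (j - 1))"
  by (auto simp: lact_def tco_def fscale_def rep_mult rep_gel delta_gen rep_scale_right simp del: rep_gen.simps)

lemma ract_tco:
  "ract (tco q s i j) uK = fscale (of_real (q powr (2 * i))) (tco q s i j)"
  "ract (tco q s i j) uKi = fscale (of_real (q powr (- 2 * i))) (tco q s i j)"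
  "ract (tco q s i j) uE = fscale (of_real (e_coef q s (i - 1))) (tco q s (i - 1) j)"
  "ract (tco q s i j) uF = fscale (of_real (f_coef q s (i + 1))) (tco q s (i + 1) j)"
  by (auto simp: ract_def tco_def fscale_def rep_mult rep_gel)

lemma qbr_0 [simp]: "qbr q 0 = 0"
  by (simp add: qbr_def)

lemma coef_boundary: "e_coef q s s = 0" "f_coef q s (- s) = 0"
  by (simp_all add: e_coef_def f_coef_def)

lemma rep_gen_Hs:
  assumes s: "s \<in> spins" and v: "v \<in> Hs s"
  shows "rep_gen q s g v \<in> Hs s"
  unfolding Hs_def
proof (intro CollectI allI impI)
  fix j assume j: "j \<notin> wts s"
  show "rep_gen q s g v j = 0"
  proof (cases g)
    case GE
    \<comment> \<open>A step out of \<open>wts s\<close> can only start at the top weight, where the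
      ladder coefficient vanishes.\<close>
    have "v (j - 1) = 0 \<or> j - 1 = s"
      using wts_Suc[OF s, of "j - 1"] j v by (auto simp: Hs_def)
    with GE show ?thesis by (auto simp: coef_boundary)
  next
    case GF
    have "v (j + 1) = 0 \<or> j + 1 = - s"
      using wts_pred[OF s, of "j + 1"] j v by (auto simp: Hs_def)
    with GF show ?thesis by (auto simp: coef_boundary)
  qed (use j v in \<open>auto simp: Hs_def\<close>)
qed

lemma rep_Hs:
  assumes s: "s \<in> spins" and v: "v \<in> Hs s"
  shows "rep q s h v \<in> Hs s"
proof (induction h rule: poly_mapping_induct_single)
  case (add g w c)
  have "foldr (rep_gen q s) ws v \<in> Hs s" for ws
    by (induction ws) (use v in \<open>simp_all add: rep_gen_Hs[OF s]\<close>)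
  with add show ?case by (auto simp: rep_add rep_single Hs_def)
qed (simp add: Hs_def)

lemma delta_Hs: "j \<in> wts s \<Longrightarrow> delta j \<in> Hs s"
  by (auto simp: Hs_def delta_def)

lemma tco_eq_0:
  assumes "s \<in> spins" "j \<in> wts s" "i \<notin> wts s"
  shows "tco q s i j = 0"
  using rep_Hs[OF assms(1) delta_Hs[OF assms(2)]] assms(3) by (auto simp: Hs_def tco_def fun_eq_iff zero_fun_apply)

lemma mcoef_eq:
  assumes "\<eta> \<in> Hs s"
  shows "mcoef q s \<xi> \<eta> = (\<Sum>i\<in>wts s. \<Sum>j\<in>wts s. fscale (cnj (\<xi> i) * \<eta> j) (tco q s i j))"
proof
  fix h
  have "\<eta> = (\<lambda>k. \<Sum>j\<in>wts s. \<eta> j * delta j k)"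
  proof
    fix k show "\<eta> k = (\<Sum>j\<in>wts s. \<eta> j * delta j k)"
      using assms by (cases "k \<in> wts s") (auto simp: Hs_def delta_def if_distrib cong: if_cong)
  qed
  then have "rep q s h \<eta> = (\<lambda>k. \<Sum>j\<in>wts s. \<eta> j * rep q s h (delta j) k)"
    using rep_sum_right[of "wts s" q s h \<eta> delta] by simp
  then show "mcoef q s \<xi> \<eta> h = (\<Sum>i\<in>wts s. \<Sum>j\<in>wts s. fscale (cnj (\<xi> i) * \<eta> j) (tco q s i j)) h"
    by (simp add: mcoef_def ipHs_def fs_sum_apply fscale_def tco_def sum_distrib_left mult.assoc)
qed

lemma tco_mcoef:
  assumes "i \<in> wts s"
  shows "tco q s i j = mcoef q s (delta i) (delta j)"
proof
  fix h
  have "(\<Sum>k\<in>wts s. cnj (delta i k) * rep q s h (delta j) k) = (\<Sum>k\<in>wts s. if k = i then rep q s h (delta j) k else 0)"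
    by (rule sum.cong) (auto simp: delta_def)
  then show "tco q s i j h = mcoef q s (delta i) (delta j) h"
    using assms by (simp add: tco_def mcoef_def ipHs_def)
qed

lemma Oq_eq: "Oq q = fs.span {tco q s i j | s i j. s \<in> spins \<and> i \<in> wts s \<and> j \<in> wts s}"
  (is "_ = fs.span ?T")
proof
  have "mcoef q s \<xi> \<eta> \<in> fs.span ?T" if "s \<in> spins" "\<xi> \<in> Hs s" "\<eta> \<in> Hs s" for s \<xi> \<eta>
    unfolding mcoef_eq[OF that(3)]
    using that by (intro fs.span_sum fs.span_scale fs.span_base) auto
  then show "Oq q \<subseteq> fs.span ?T"
    unfolding Oq_def by (intro fs.span_minimal fs.subspace_span) auto
  show "fs.span ?T \<subseteq> Oq q"
    unfolding Oq_def using tco_mcoef delta_Hs by (intro fs.span_mono) blast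
qed

lemma Oq_tco: "s \<in> spins \<Longrightarrow> i \<in> wts s \<Longrightarrow> j \<in> wts s \<Longrightarrow> tco q s i j \<in> Oq q"
  unfolding Oq_eq by (rule fs.span_base) auto

lemma Oq_subspace: "fs.subspace (Oq q)"
  unfolding Oq_eq by (rule fs.subspace_span)

lemmas Oq_closed = fs.subspace_add[OF Oq_subspace] fs.subspace_diff[OF Oq_subspace]
  fs.subspace_scale[OF Oq_subspace] fs.subspace_0[OF Oq_subspace] fs.subspace_sum[OF Oq_subspace]

lemma Oq_induct [consumes 1, case_names zero add tco]:
  assumes "x \<in> Oq q" and "P 0"
    and "\<And>c x y. P x \<Longrightarrow> P y \<Longrightarrow> P (fscale c x + y)"
    and "\<And>s i j. s \<in> spins \<Longrightarrow> i \<in> wts s \<Longrightarrow> j \<in> wts s \<Longrightarrow> P (tco q s i j)"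
  shows "P x"
  using assms(1) unfolding Oq_eq
proof (induction rule: fs.span_induct_alt)
  case (step c x y)
  with assms(3,4) show ?case by blast
qed (fact assms(2))

lemma lin_Oq: "x \<in> Oq q \<Longrightarrow> lin x"
  by (induction rule: Oq_induct) (auto intro: lin_zero_func lin_plus lin_fscale lin_tco)

lemma tco_Oq_right: "s \<in> spins \<Longrightarrow> j \<in> wts s \<Longrightarrow> tco q s i j \<in> Oq q"
  by (cases "i \<in> wts s") (simp_all add: Oq_tco tco_eq_0 Oq_closed)

lemma Oq_ract_gel: "x \<in> Oq q \<Longrightarrow> ract x (gel g) \<in> Oq q"
proof (induction rule: Oq_induct)
  case (tco s i j)
  then show ?case by (cases g) (auto simp: ract_tco intro: Oq_closed tco_Oq_right)
qed (auto simp: act_simps intro: Oq_closed)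

lemma Oq_lact_gel: "x \<in> Oq q \<Longrightarrow> lact (gel g) x \<in> Oq q"
proof (induction rule: Oq_induct)
  case (tco s i j)
  have "fscale (of_real (e_coef q s j)) (tco q s i (j + 1)) \<in> Oq q"
    using tco wts_Suc[of s j] by (cases "j = s") (auto simp: coef_boundary intro: Oq_closed Oq_tco)
  moreover have "fscale (of_real (f_coef q s j)) (tco q s i (j - 1)) \<in> Oq q"
    using tco wts_pred[of s j] by (cases "j = - s") (auto simp: coef_boundary intro: Oq_closed Oq_tco)
  ultimately show ?case using tco by (cases g) (auto simp: lact_tco intro: Oq_closed Oq_tco)
qed (auto simp: act_simps intro: Oq_closed)

lemma qbr_uminus: "qbr q (- x) = - qbr q x"
  by (simp add: qbr_def minus_divide_left)

section \<open>\<open>q\<close>-numbers and the relations of \<open>U_q\<close> on matrix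
  coefficients\<close>

context
  fixes q :: real
  assumes q: "0 < q" "q < 1"
begin

lemma q_diff_neg: "q - 1 / q < 0"
  using q by (simp add: field_simps) (smt (verit) mult_less_cancel_left2)

lemma qbr_1 [simp]: "qbr q 1 = 1"
  using q q_diff_neg by (simp add: qbr_def powr_minus_divide)

lemma qbr_pos: "0 < x \<Longrightarrow> 0 < qbr q x"
proof -
  assume "0 < x"
  then have "q powr x < q powr (- x)"
    using q by (intro powr_less_mono') auto
  then show ?thesis
    unfolding qbr_def using q_diff_neg by (intro divide_neg_neg) auto
qed

lemma qbr_nonneg: "0 \<le> x \<Longrightarrow> 0 \<le> qbr q x"
  using qbr_pos[of x] by (cases "x = 0") auto

lemma qbr_add: "qbr q (x + y) = q powr y * qbr q x + q powr (- x) * qbr q y"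
proof -
  have "q powr (x + y) - q powr (- (x + y)) =
      q powr y * (q powr x - q powr (- x)) + q powr (- x) * (q powr y - q powr (- y))"
    using q by (simp add: powr_add powr_minus_divide minus_add_distrib powr_diff) (simp add: field_simps)
  then show ?thesis
    by (simp only: qbr_def times_divide_eq_right flip: add_divide_distrib)
qed

text \<open>With \<open>x = s + j\<close> and \<open>y = s - j\<close> this is the relation for
  \<open>[e, f]\<close> on the basis vector of weight \<open>j\<close>.\<close>

lemma qbr_commutator: "qbr q x * qbr q (y + 1) - qbr q (x + 1) * qbr q y = qbr q (x - y)"
proof -
  have "qbr q (x - y) = q powr (- y) * qbr q x - q powr (- x) * qbr q y"
    using qbr_add[of x "- y"] by (simp add: qbr_uminus)
  moreover have "qbr q (y + 1) = q * qbr q y + q powr (- y)" "qbr q (x + 1) = q * qbr q x + q powr (- x)"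
    using qbr_add[of _ 1] q by simp_all
  ultimately show ?thesis by (simp add: algebra_simps)
qed

lemma e_f_coef: "j \<in> wts s \<Longrightarrow> e_coef q s (j - 1) * f_coef q s j = qbr q (s + j) * qbr q (s - j + 1)"
  and f_e_coef: "j \<in> wts s \<Longrightarrow> f_coef q s (j + 1) * e_coef q s j = qbr q (s + j + 1) * qbr q (s - j)"
proof -
  assume "j \<in> wts s"
  \<comment> \<open>Membership in \<open>wts s\<close> makes the radicands nonnegative, so that the
    square roots multiply back.\<close>
  then have nn: "0 \<le> qbr q (s + j) * qbr q (s - j + 1)" "0 \<le> qbr q (s + j + 1) * qbr q (s - j)"
    using wts_le[of j s] by (auto intro!: mult_nonneg_nonneg qbr_nonneg)
  have 1: "q powr j * q powr (- j) = 1" "q powr (- (j + 1)) * q powr (j + 1) = 1"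
    using q by (simp_all flip: powr_add)
  show "e_coef q s (j - 1) * f_coef q s j = qbr q (s + j) * qbr q (s - j + 1)"
    using nn(1) 1(1) by (simp add: e_coef_def f_coef_def algebra_simps)
  show "f_coef q s (j + 1) * e_coef q s j = qbr q (s + j + 1) * qbr q (s - j)"
    using nn(2) 1(2) by (simp add: e_coef_def f_coef_def algebra_simps)
qed

lemma uq_rels_zero:
  assumes s: "s \<in> spins" and v: "v \<in> Hs s" and r: "r \<in> uq_rels q"
  shows "rep q s r v = (\<lambda>j. 0)"
proof
  fix j
  have kk: "q powr (2 * j) * q powr (- 2 * j) = 1" "q powr (- 2 * j) * q powr (2 * j) = 1"
    using q by (simp_all flip: powr_add)
  have shift: "q powr (2 * j) = q\<^sup>2 * q powr (2 * (j - 1))" "q powr (2 * j) = 1 / q\<^sup>2 * q powr (2 * (j + 1))"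
    using q by (simp_all add: right_diff_distrib distrib_left powr_diff powr_add)
  have ef: "rep q s (uE * uF - uF * uE - cst (of_real (1 / (q - 1 / q))) * (uK - uKi)) v j = 0"
  \<comment> \<open>At a weight the ladder coefficients can be multiplied out. Elsewhere the
    coordinate vanishes because \<open>Hs s\<close> is stable.\<close>
  proof (cases "j \<in> wts s")
    case True
    have "e_coef q s (j - 1) * f_coef q s j - f_coef q s (j + 1) * e_coef q s j = qbr q (2 * j)"
      using qbr_commutator[of "s + j" "s - j"] True by (simp add: e_f_coef f_e_coef)
    also have "\<dots> = (1 / (q - 1 / q)) * (q powr (2 * j) - q powr (- 2 * j))"
      by (simp add: qbr_def)
    finally have "complex_of_real (e_coef q s (j - 1) * f_coef q s j - f_coef q s (j + 1) * e_coef q s j) * v j =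
        of_real ((1 / (q - 1 / q)) * (q powr (2 * j) - q powr (- 2 * j))) * v j"
      by (rule arg_cong)
    then show ?thesis
      by (simp add: rep_simps algebra_simps)
  next
    case False
    have "rep q s (uE * uF - uF * uE - cst (of_real (1 / (q - 1 / q))) * (uK - uKi)) v \<in> Hs s"
      by (rule rep_Hs[OF s v])
    with False show ?thesis by (simp add: Hs_def)
  qed
  have kk': "complex_of_real (q powr (2 * j)) * of_real (q powr (- 2 * j)) = 1"
    "complex_of_real (q powr (- 2 * j)) * of_real (q powr (2 * j)) = 1"
    using kk by (simp_all only: of_real_mult[symmetric] of_real_1)
  have shift': "complex_of_real (q powr (2 * j)) = of_real (q\<^sup>2) * of_real (q powr (2 * (j - 1)))"
    "complex_of_real (q powr (2 * j)) = of_real (1 / q\<^sup>2) * of_real (q powr (2 * (j + 1)))"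
    using shift by (simp_all only: of_real_mult[symmetric])
  have "rep q s (uK * uKi - 1) v j = 0" "rep q s (uKi * uK - 1) v j = 0"
    using kk' by (simp_all only: rep_simps rep_gen.simps mult.assoc[symmetric] mult_1_left diff_self)
  moreover have "rep q s (uK * uE - cst (of_real (q\<^sup>2)) * uE * uK) v j = 0"
    by (simp only: rep_simps rep_gen.simps shift'(1)) (simp only: mult_ac diff_self)
  moreover have "rep q s (uK * uF - cst (of_real (1 / q\<^sup>2)) * uF * uK) v j = 0"
    by (simp only: rep_simps rep_gen.simps shift'(2)) (simp only: mult_ac diff_self)
  ultimately show "rep q s r v j = 0"
    using r ef unfolding uq_rels_def by auto
qed

text \<open>The relations of \<open>U_q\<close> fail in the free algebra \<open>ualg\<close> but act
  as zero on matrix coefficients. This and \<open>Oq_rel'\<close> are the source of all commutation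
  relations below.\<close>

lemma Oq_rel: "x \<in> Oq q \<Longrightarrow> r \<in> uq_rels q \<Longrightarrow> lact r x = 0"
proof (induction rule: Oq_induct)
  case (tco s i j)
  have "rep q s (g * r) (delta j) = (\<lambda>j. 0)" for g
    using tco by (simp add: rep_mult uq_rels_zero delta_Hs rep_zero_right)
  then show ?case by (simp add: lact_def tco_def fun_eq_iff zero_fun_apply)
qed (auto simp: act_simps)

lemma Oq_rel': "x \<in> Oq q \<Longrightarrow> r \<in> uq_rels q \<Longrightarrow> ract x r = 0"
proof (induction rule: Oq_induct)
  case (tco s i j)
  have "rep q s (r * g) (delta j) = (\<lambda>j. 0)" for g
    using tco by (simp add: rep_mult uq_rels_zero rep_Hs delta_Hs)
  then show ?case by (simp add: ract_def tco_def fun_eq_iff zero_fun_apply)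
qed (auto simp: act_simps)

lemma Oq_lact_rels:
  assumes x: "x \<in> Oq q"
  shows "lact uK (lact uKi x) = x" "lact uKi (lact uK x) = x"
    "lact uK (lact uE x) = fscale (of_real (q\<^sup>2)) (lact uE (lact uK x))"
    "lact uK (lact uF x) = fscale (of_real (1 / q\<^sup>2)) (lact uF (lact uK x))"
    "lact uE (lact uF x) = lact uF (lact uE x) + fscale (of_real (1 / (q - 1 / q))) (lact uK x - lact uKi x)"
proof -
  note rel = Oq_rel[OF x]
  note arg = lact_arg[OF lin_Oq[OF x]]
  show "lact uK (lact uKi x) = x" "lact uKi (lact uK x) = x"
    using rel[of "uK * uKi - 1"] rel[of "uKi * uK - 1"]
    by (simp_all add: uq_rels_def arg lact_lact)
  show "lact uK (lact uE x) = fscale (of_real (q\<^sup>2)) (lact uE (lact uK x))"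
    using rel[of "uK * uE - cst (of_real (q\<^sup>2)) * uE * uK"]
    by (simp add: uq_rels_def arg lact_lact mult.assoc)
  show "lact uK (lact uF x) = fscale (of_real (1 / q\<^sup>2)) (lact uF (lact uK x))"
    using rel[of "uK * uF - cst (of_real (1 / q\<^sup>2)) * uF * uK"]
    by (simp add: uq_rels_def arg lact_lact mult.assoc)
  have "uE * uF - uF * uE - cst (of_real (1 / (q - 1 / q))) * (uK - uKi) \<in> uq_rels q"
    by (simp add: uq_rels_def)
  from rel[OF this]
  show "lact uE (lact uF x) = lact uF (lact uE x) + fscale (of_real (1 / (q - 1 / q))) (lact uK x - lact uKi x)"
    by (simp add: arg lact_lact algebra_simps)
qed

lemma Oq_ract_rels:
  assumes x: "x \<in> Oq q"
  shows "ract (ract x uK) uKi = x" "ract (ract x uKi) uK = x"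
    "ract (ract x uK) uE = fscale (of_real (q\<^sup>2)) (ract (ract x uE) uK)"
    "ract (ract x uK) uF = fscale (of_real (1 / q\<^sup>2)) (ract (ract x uF) uK)"
    "ract (ract x uE) uF = ract (ract x uF) uE + fscale (of_real (1 / (q - 1 / q))) (ract x uK - ract x uKi)"
proof -
  note rel = Oq_rel'[OF x]
  note arg = lact_arg[OF lin_Oq[OF x]]
  show "ract (ract x uK) uKi = x" "ract (ract x uKi) uK = x"
    using rel[of "uK * uKi - 1"] rel[of "uKi * uK - 1"]
    by (simp_all add: uq_rels_def arg ract_ract)
  show "ract (ract x uK) uE = fscale (of_real (q\<^sup>2)) (ract (ract x uE) uK)"
    using rel[of "uK * uE - cst (of_real (q\<^sup>2)) * uE * uK"]
    by (simp add: uq_rels_def arg ract_ract mult.assoc)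
  show "ract (ract x uK) uF = fscale (of_real (1 / q\<^sup>2)) (ract (ract x uF) uK)"
    using rel[of "uK * uF - cst (of_real (1 / q\<^sup>2)) * uF * uK"]
    by (simp add: uq_rels_def arg ract_ract mult.assoc)
  have "uE * uF - uF * uE - cst (of_real (1 / (q - 1 / q))) * (uK - uKi) \<in> uq_rels q"
    by (simp add: uq_rels_def)
  from rel[OF this]
  show "ract (ract x uE) uF = ract (ract x uF) uE + fscale (of_real (1 / (q - 1 / q))) (ract x uK - ract x uKi)"
    by (simp add: arg ract_ract algebra_simps)
qed

end

section \<open>Clebsch--Gordan decomposition of \<open>H\<^sub>1\<^sub>/\<^sub>2 \<otimes> H\<^sub>s\<close>\<close>

text \<open>The Clebsch--Gordan coefficients of the projections of \<open>H\<^sub>1\<^sub>/\<^sub>2 \<otimes> H\<^sub>s\<close> onto the summands of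
  spin \<open>s + 1/2\<close> and \<open>s - 1/2\<close>; the boolean selects the basis vector of \<open>H\<^sub>1\<^sub>/\<^sub>2\<close> (true for weight \<open>1/2\<close>).\<close>
definition cgp :: "real \<Rightarrow> real \<Rightarrow> bool \<Rightarrow> real \<Rightarrow> real" where
  "cgp q s b j = (if b then q powr ((s - j) / 2) * sqrt (qbr q (s + j + 1)) / sqrt (qbr q (2 * s + 1))
     else q powr (- (s + j) / 2) * sqrt (qbr q (s - j + 1)) / sqrt (qbr q (2 * s + 1)))"

definition cgm :: "real \<Rightarrow> real \<Rightarrow> bool \<Rightarrow> real \<Rightarrow> real" where
  "cgm q s b j = (if b then q powr (- (s + j + 1) / 2) * sqrt (qbr q (s - j)) / sqrt (qbr q (2 * s + 1))
     else - (q powr ((s - j + 1) / 2)) * sqrt (qbr q (s + j)) / sqrt (qbr q (2 * s + 1)))"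

definition hsgn :: "bool \<Rightarrow> real" where
  "hsgn b = (if b then 1 / 2 else - 1 / 2)"

context
  fixes q :: real
  assumes q: "0 < q" "q < 1"
begin

text \<open>Compatibility of the two projections with \<open>Delta\<close> of \<open>e\<close> and
  \<open>f\<close>: one identity for each summand, each generator and each basis vector of spin 1/2.
  The generators \<open>k\<close> and its inverse only add weights.\<close>

lemma cg_intertwine:
  assumes j: "- s \<le> j" "j \<le> s"
  shows "cgp q s True j * e_coef q (s + 1/2) (j + 1/2) = q * e_coef q s j * cgp q s True (j + 1)"
    "cgp q s False j * e_coef q (s + 1/2) (j - 1/2) =
      q powr (1/2) * cgp q s True j + e_coef q s j / q * cgp q s False (j + 1)"
    "cgm q s True j * e_coef q (s - 1/2) (j + 1/2) = q * e_coef q s j * cgm q s True (j + 1)"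
    "cgm q s False j * e_coef q (s - 1/2) (j - 1/2) =
      q powr (1/2) * cgm q s True j + e_coef q s j / q * cgm q s False (j + 1)"
    "cgp q s True j * f_coef q (s + 1/2) (j + 1/2) =
      f_coef q s j * cgp q s True (j - 1) + q powr (- 1/2) * q powr (- 2 * j) * cgp q s False j"
    "cgp q s False j * f_coef q (s + 1/2) (j - 1/2) = f_coef q s j * cgp q s False (j - 1)"
    "cgm q s True j * f_coef q (s - 1/2) (j + 1/2) =
      f_coef q s j * cgm q s True (j - 1) + q powr (- 1/2) * q powr (- 2 * j) * cgm q s False j"
    "cgm q s False j * f_coef q (s - 1/2) (j - 1/2) = f_coef q s j * cgm q s False (j - 1)"
proof -
  \<comment> \<open>All powers of \<open>q\<close> that occur are monomials in \<open>B\<close>,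
    \<open>C\<close>, \<open>H\<close>, so the identities become rational in these and in the square
    roots.\<close>
  define B where "B = q powr ((s - j) / 2)"
  define C where "C = q powr ((s + j) / 2)"
  define H where "H = q powr (1 / 2)"
  define N where "N = sqrt (qbr q (2 * s + 1))"
  have pos: "B > 0" "C > 0" "H > 0" using q by (auto simp: B_def C_def H_def)
  have qH: "q = H * H" using q by (simp add: H_def flip: powr_add)
  have pw: "q powr ((s - j) / 2) = B" "q powr (- (s + j) / 2) = 1 / C"
    "q powr (- (s + j + 1) / 2) = 1 / (C * H)" "q powr ((s - j + 1) / 2) = B * H"
    "q powr ((s - (j + 1)) / 2) = B / H" "q powr (- (s + (j + 1)) / 2) = 1 / (C * H)"
    "q powr (- (s + (j + 1) + 1) / 2) = 1 / (C * H * H)" "q powr ((s - (j + 1) + 1) / 2) = B"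
    "q powr ((s - (j - 1)) / 2) = B * H" "q powr (- (s + (j - 1)) / 2) = H / C"
    "q powr (- (s + (j - 1) + 1) / 2) = 1 / C" "q powr ((s - (j - 1) + 1) / 2) = B * H * H"
    "q powr (j + 1) = C / B * H * H" "q powr (j + 1/2 + 1) = C / B * H * H * H"
    "q powr (j - 1/2 + 1) = C / B * H" "q powr (- j) = B / C" "q powr (- (j + 1/2)) = B / (C * H)"
    "q powr (- (j - 1/2)) = B * H / C" "q powr (1/2) = H" "q powr (- 1/2) = 1 / H"
    "q powr (- 2 * j) = B * B / (C * C)"
    unfolding B_def C_def H_def times_divide_eq_left
    using q by (simp_all only: powr_add[symmetric] powr_diff[symmetric] powr_minus_divide[symmetric])
      (simp_all add: powr_inj field_simps)
  define u where "u = sqrt (qbr q (s + j + 1))"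
  define v where "v = sqrt (qbr q (s + j))"
  define w where "w = sqrt (qbr q (s - j))"
  define z where "z = sqrt (qbr q (s - j + 1))"
  define y where "y = sqrt (qbr q (s + j + 2))"
  define x where "x = sqrt (qbr q (s - j + 2))"
  \<comment> \<open>At the ends of the ladder \<open>a\<close> and \<open>b\<close> are roots of
    negative numbers. They occur linearly on both sides; only \<open>u\<close>, \<open>v\<close>,
    \<open>w\<close>, \<open>z\<close> are ever squared.\<close>
  define a where "a = sqrt (qbr q (s - j - 1))"
  define b where "b = sqrt (qbr q (s + j - 1))"
  have N: "N > 0" using j qbr_pos[OF q, of "2 * s + 1"] by (simp add: N_def)
  have sq: "u * u = qbr q (s + j + 1)" "v * v = qbr q (s + j)" "w * w = qbr q (s - j)" "z * z = qbr q (s - j + 1)"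
    using j by (simp_all add: u_def v_def w_def z_def qbr_nonneg[OF q])
  have C1: "q powr (s + j) = C * C" "q powr (s - j) = B * B"
    by (simp_all add: B_def C_def flip: powr_add)
  have C2: "q powr (s + j) = C * C" "q powr (- (s + j)) = 1 / (C * C)"
    "q powr (s - j) = B * B" "q powr (- (s - j)) = 1 / (B * B)" "q powr (-1) = 1 / (H * H)"
    unfolding powr_minus_divide C1 using q qH by auto
  have q1: "q powr 1 = H * H" using qH q by simp
  \<comment> \<open>These are the two expansions of \<open>[x + 1]\<close>, namely
    \<open>q [x] + q^(-x)\<close> here and \<open>[x] / q + q^x\<close> in \<open>rec2\<close>. Four
    of the eight identities need one of them; the other four are comparisons of monomials.\<close>
  have rec1: "u * u = H * H * (v * v) + 1 / (C * C)" "z * z = H * H * (w * w) + 1 / (B * B)"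
    using qbr_add[OF q, of "s + j" 1] qbr_add[OF q, of "s - j" 1] unfolding C2 q1 sq
    by (simp_all add: qbr_1[OF q])
  have rec2: "u * u = v * v / (H * H) + C * C" "z * z = w * w / (H * H) + B * B"
    using qbr_add[OF q, of 1 "s + j"] qbr_add[OF q, of 1 "s - j"] unfolding C2 sq
    by (simp_all add: qbr_1[OF q] add_ac)
  have cg: "cgp q s True j = B * u / N" "cgp q s False j = z / (C * N)"
    "cgm q s True j = w / (C * H * N)" "cgm q s False j = - (B * H * v / N)"
    "cgp q s True (j + 1) = B * y / (H * N)" "cgp q s False (j + 1) = w / (C * H * N)"
    "cgm q s True (j + 1) = a / (C * H * H * N)" "cgm q s False (j + 1) = - (B * u / N)"
    "cgp q s True (j - 1) = B * H * v / N" "cgp q s False (j - 1) = H * x / (C * N)"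
    "cgm q s True (j - 1) = z / (C * N)" "cgm q s False (j - 1) = - (B * H * H * b / N)"
    unfolding cgp_def cgm_def if_True if_False simp_thms pw N_def[symmetric] u_def v_def w_def z_def y_def x_def a_def b_def
    by (simp_all add: algebra_simps)
  have ef: "e_coef q s j = C / B * H * H * (w * u)"
    "e_coef q (s + 1/2) (j + 1/2) = C / B * H * H * H * (w * y)"
    "e_coef q (s + 1/2) (j - 1/2) = C / B * H * (z * u)"
    "e_coef q (s - 1/2) (j + 1/2) = C / B * H * H * H * (a * u)"
    "e_coef q (s - 1/2) (j - 1/2) = C / B * H * (w * v)"
    "f_coef q s j = B / C * (v * z)"
    "f_coef q (s + 1/2) (j + 1/2) = B / (C * H) * (u * z)"
    "f_coef q (s + 1/2) (j - 1/2) = B * H / C * (v * x)"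
    "f_coef q (s - 1/2) (j + 1/2) = B / (C * H) * (v * w)"
    "f_coef q (s - 1/2) (j - 1/2) = B * H / C * (b * z)"
    unfolding e_coef_def f_coef_def real_sqrt_mult pw u_def v_def w_def z_def y_def x_def a_def b_def
    by (simp_all add: algebra_simps)
  show "cgp q s True j * e_coef q (s + 1/2) (j + 1/2) = q * e_coef q s j * cgp q s True (j + 1)"
    unfolding cg ef using pos N by (subst (1) qH) (simp add: field_simps)
  show "cgp q s False j * f_coef q (s + 1/2) (j - 1/2) = f_coef q s j * cgp q s False (j - 1)"
    unfolding cg ef using pos N by (simp add: field_simps)
  show "cgm q s True j * e_coef q (s - 1/2) (j + 1/2) = q * e_coef q s j * cgm q s True (j + 1)"
    unfolding cg ef using pos N by (subst (1) qH) (simp add: field_simps)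
  show "cgm q s False j * f_coef q (s - 1/2) (j - 1/2) = f_coef q s j * cgm q s False (j - 1)"
    unfolding cg ef using pos N by (simp add: field_simps)
  have "z / (C * N) * (C / B * H * (z * u)) = H / (B * N) * u * (z * z)"
    using pos N by (simp add: field_simps)
  also have "\<dots> = H * (B * u / N) + C / B * H * H * (w * u) / (H * H) * (w / (C * H * N))"
    unfolding rec2(2) using pos N by (simp add: field_simps)
  finally show "cgp q s False j * e_coef q (s + 1/2) (j - 1/2) =
      q powr (1/2) * cgp q s True j + e_coef q s j / q * cgp q s False (j + 1)"
    unfolding cg ef pw qH[symmetric] .
  have "H * (w / (C * H * N)) + C / B * H * H * (w * u) / (H * H) * - (B * u / N) =
      w / (C * N) - C * w / N * (u * u)"
    using pos N by (simp add: field_simps)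
  also have "\<dots> = - (B * H * v / N) * (C / B * H * (w * v))"
    unfolding rec1(1) using pos N by (simp add: field_simps)
  finally show "cgm q s False j * e_coef q (s - 1/2) (j - 1/2) =
      q powr (1/2) * cgm q s True j + e_coef q s j / q * cgm q s False (j + 1)"
    unfolding cg ef pw qH[symmetric] by (rule sym)
  have "B * u / N * (B / (C * H) * (u * z)) = B * B * z / (N * C * H) * (u * u)"
    using pos N by (simp add: field_simps)
  also have "\<dots> = B / C * (v * z) * (B * H * v / N) + 1 / H * (B * B / (C * C)) * (z / (C * N))"
    unfolding rec1(1) using pos N by (simp add: field_simps)
  finally show "cgp q s True j * f_coef q (s + 1/2) (j + 1/2) =
      f_coef q s j * cgp q s True (j - 1) + q powr (- 1/2) * q powr (- 2 * j) * cgp q s False j"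
    unfolding cg ef pw .
  have "B / C * (v * z) * (z / (C * N)) + 1 / H * (B * B / (C * C)) * - (B * H * v / N) =
      B * v / (C * C * N) * (z * z) - B * B * B * v / (C * C * N)"
    using pos N by (simp add: field_simps)
  also have "\<dots> = w / (C * H * N) * (B / (C * H) * (v * w))"
    unfolding rec2(2) using pos N by (simp add: field_simps)
  finally show "cgm q s True j * f_coef q (s - 1/2) (j + 1/2) =
      f_coef q s j * cgm q s True (j - 1) + q powr (- 1/2) * q powr (- 2 * j) * cgm q s False j"
    unfolding cg ef pw by (rule sym)
qed

text \<open>Orthogonality of the Clebsch--Gordan matrix, which is the value at 1 of the product
  formula below. The diagonal case is the addition formula for \<open>[2 s + 1]\<close>, split as
  \<open>(s + i + 1) + (s - i)\<close> or \<open>(s + i) + (s - i + 1)\<close>.\<close>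

lemma cg_unitary:
  assumes s: "s \<in> spins" and i: "i \<in> wts s" and j: "j \<in> wts s"
  shows "(if b = b' \<and> i = j then 1 else 0) =
    (if i + hsgn b = j + hsgn b' then cgp q s b i * cgp q s b' j + cgm q s b i * cgm q s b' j else 0)"
proof -
  have le: "- s \<le> i" "i \<le> s" "- s \<le> j" "j \<le> s" using wts_le i j by auto
  define N where "N = sqrt (qbr q (2 * s + 1))"
  have N: "N > 0" "N * N = qbr q (2 * s + 1)"
    using le qbr_pos[OF q, of "2 * s + 1"] by (simp_all add: N_def)
  have N0: "qbr q (2 * s + 1) \<noteq> 0"
    using N by (metis mult_pos_pos less_irrefl)
  have pw: "q powr ((s - i) / 2) * q powr ((s - i) / 2) = q powr (s - i)"
    "q powr (- (s + i + 1) / 2) * q powr (- (s + i + 1) / 2) = q powr (- (s + i + 1))"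
    "q powr ((s - i + 1) / 2) * q powr ((s - i + 1) / 2) = q powr (s - i + 1)"
    "q powr (- (s + i) / 2) * q powr (- (s + i) / 2) = q powr (- (s + i))"
    unfolding powr_add[symmetric] using q by (simp_all add: powr_inj field_simps)
  have sq: "sqrt (qbr q (s + i + 1)) * sqrt (qbr q (s + i + 1)) = qbr q (s + i + 1)"
    "sqrt (qbr q (s - i)) * sqrt (qbr q (s - i)) = qbr q (s - i)"
    "sqrt (qbr q (s - i + 1)) * sqrt (qbr q (s - i + 1)) = qbr q (s - i + 1)"
    "sqrt (qbr q (s + i)) * sqrt (qbr q (s + i)) = qbr q (s + i)"
    using le by (simp_all add: qbr_nonneg[OF q])
  have "cgp q s True i * cgp q s True i + cgm q s True i * cgm q s True i =
      (q powr ((s - i) / 2) * q powr ((s - i) / 2) * (sqrt (qbr q (s + i + 1)) * sqrt (qbr q (s + i + 1))) +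
       q powr (- (s + i + 1) / 2) * q powr (- (s + i + 1) / 2) * (sqrt (qbr q (s - i)) * sqrt (qbr q (s - i)))) / (N * N)"
    unfolding cgp_def cgm_def if_True N_def[symmetric]
    by (simp only: times_divide_times_eq add_divide_distrib mult_ac)
  also have "\<dots> = (q powr (s - i) * qbr q (s + i + 1) + q powr (- (s + i + 1)) * qbr q (s - i)) / (N * N)"
    unfolding pw sq ..
  also have "\<dots> = 1"
    unfolding qbr_add[OF q, symmetric] N(2) using N0 by simp
  finally have T: "cgp q s True i * cgp q s True i + cgm q s True i * cgm q s True i = 1" .
  have "cgp q s False i * cgp q s False i + cgm q s False i * cgm q s False i =
      (q powr ((s - i + 1) / 2) * q powr ((s - i + 1) / 2) * (sqrt (qbr q (s + i)) * sqrt (qbr q (s + i))) +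
       q powr (- (s + i) / 2) * q powr (- (s + i) / 2) * (sqrt (qbr q (s - i + 1)) * sqrt (qbr q (s - i + 1)))) / (N * N)"
    unfolding cgp_def cgm_def if_False N_def[symmetric]
    by (simp only: times_divide_times_eq add_divide_distrib mult_minus_left mult_minus_right minus_minus
        minus_divide_left[symmetric] mult_ac add_ac)
  also have "\<dots> = (q powr (s - i + 1) * qbr q (s + i) + q powr (- (s + i)) * qbr q (s - i + 1)) / (N * N)"
    unfolding pw sq ..
  also have "\<dots> = 1"
    unfolding qbr_add[OF q, symmetric] N(2) using N0 by simp
  finally have F: "cgp q s False i * cgp q s False i + cgm q s False i * cgm q s False i = 1" .
  have X: "cgp q s True i * cgp q s False (i + 1) + cgm q s True i * cgm q s False (i + 1) = 0" for i
    by (simp add: cgp_def cgm_def algebra_simps)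
  have X': "cgp q s False (i + 1) * cgp q s True i + cgm q s False (i + 1) * cgm q s True i = 0" for i
    using X[of i] by (simp add: mult.commute)
  show ?thesis
    using T F X[of i] X'[of j] by (cases b; cases b') (auto simp: hsgn_def add_ac)
qed

text \<open>Stripping letters from the right moves only the column indices \<open>b'\<close> and
  \<open>j\<close>. The two sides then agree by \<open>cg_intertwine\<close>, and at the empty word
  by \<open>cg_unitary\<close>.\<close>

lemma cg_product:
  assumes s: "s \<in> spins" and i: "i \<in> wts s" and j: "j \<in> wts s"
  shows "amul (tco q (1/2) (hsgn b) (hsgn b')) (tco q s i j) =
    fscale (of_real (cgp q s b i * cgp q s b' j)) (tco q (s + 1/2) (i + hsgn b) (j + hsgn b')) +
    fscale (of_real (cgm q s b i * cgm q s b' j)) (tco q (s - 1/2) (i + hsgn b) (j + hsgn b'))"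
    (is "?L b' j = ?R b' j")
proof -
  have *: "?L b' j (Poly_Mapping.single (Word ws) 1) = ?R b' j (Poly_Mapping.single (Word ws) 1)" for ws
    using j
  proof (induction ws arbitrary: b' j rule: rev_induct)
    case Nil
    have "acounit (?L b' j) = complex_of_real (if b = b' \<and> i = j then 1 else 0)"
      by (cases b; cases b') (auto simp: acounit_amul acounit_tco hsgn_def)
    also have "\<dots> = acounit (?R b' j)"
      unfolding cg_unitary[OF s i Nil, of b b'] by (simp add: acounit_simps acounit_tco)
    finally have "acounit (?L b' j) = acounit (?R b' j)" .
    then show ?case by (simp add: acounit_def single_0_1_word)
  next
    case (snoc g ws)
    note cgs = cg_intertwine[of s j]
    let ?w = "Poly_Mapping.single (Word ws) 1 :: ualg"
    have le: "- s \<le> j" "j \<le> s" using wts_le[OF snoc.prems] by auto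
    have up: "of_real (e_coef q s j) * ?L b' (j + 1) ?w = of_real (e_coef q s j) * ?R b' (j + 1) ?w" for b'
      using snoc.IH[of "j + 1" b'] wts_Suc[OF s snoc.prems] by (cases "j = s") (auto simp: coef_boundary)
    have down: "of_real (f_coef q s j) * ?L b' (j - 1) ?w = of_real (f_coef q s j) * ?R b' (j - 1) ?w" for b'
      using snoc.IH[of "j - 1" b'] wts_pred[OF s snoc.prems] by (cases "j = - s") (auto simp: coef_boundary)
    have hs: "hsgn True = 1/2" "hsgn False = - (1/2)" by (simp_all add: hsgn_def)
    note here = snoc.IH[OF snoc.prems]
    have half: "e_coef q (1/2) (1/2) = 0" "e_coef q (1/2) (- (1/2)) = q powr (1/2)"
      "f_coef q (1/2) (- (1/2)) = 0" "f_coef q (1/2) (1/2) = q powr (- 1/2)"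
      using qbr_1[OF q] by (simp_all add: e_coef_def f_coef_def)
    show ?case unfolding single_snoc_apply
    proof (cases g)
      case GK
      then show "lact (gel g) (?L b' j) ?w = lact (gel g) (?R b' j) ?w"
        using here[of b']
        by (simp add: amul_lact lact_tco act_simps amul_simps)
          (simp add: fscale_def plus_fun_apply algebra_simps powr_add)
    next
      case GKi
      have pk: "q powr (- 2 * (j + hsgn b')) = q powr (- 2 * hsgn b') * q powr (- 2 * j)"
        by (simp add: algebra_simps flip: powr_add)
      show "lact (gel g) (?L b' j) ?w = lact (gel g) (?R b' j) ?w"
        unfolding GKi amul_lact lact_tco act_simps amul_simps pk
        using here[of b'] by (simp add: fscale_def plus_fun_apply) (simp add: algebra_simps)
    next
      case GE
      have arg: "j + 1/2 + 1 = j + 1 + 1/2" "j - 1/2 + 1 = j + 1/2" "j + 1 - 1/2 = j + 1/2" by auto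
      show "lact (gel g) (?L b' j) ?w = lact (gel g) (?R b' j) ?w"
      proof (cases b')
        case True
        have R: "lact uE (?R True j) ?w =
            of_real (cgp q s b i) * of_real (cgp q s True j * e_coef q (s + 1/2) (j + 1/2)) *
              tco q (s + 1/2) (i + hsgn b) (j + 1 + 1/2) ?w +
            of_real (cgm q s b i) * of_real (cgm q s True j * e_coef q (s - 1/2) (j + 1/2)) *
              tco q (s - 1/2) (i + hsgn b) (j + 1 + 1/2) ?w"
          by (simp add: act_simps lact_tco hs arg) (simp add: fscale_def plus_fun_apply)
        note R = R[unfolded cgs(1)[OF le] cgs(3)[OF le]]
        have "lact uE (?L True j) ?w = q * (of_real (e_coef q s j) * ?L True (j + 1) ?w)"
          using q by (simp add: amul_lact lact_tco amul_simps half hs) (simp add: fscale_def)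
        also have "\<dots> = lact uE (?R True j) ?w"
          unfolding up R by (simp add: fscale_def plus_fun_apply hs arg algebra_simps)
        finally show ?thesis using GE True by simp
      next
        case False
        have R: "lact uE (?R False j) ?w =
            of_real (cgp q s b i) * of_real (cgp q s False j * e_coef q (s + 1/2) (j - 1/2)) *
              tco q (s + 1/2) (i + hsgn b) (j + 1/2) ?w +
            of_real (cgm q s b i) * of_real (cgm q s False j * e_coef q (s - 1/2) (j - 1/2)) *
              tco q (s - 1/2) (i + hsgn b) (j + 1/2) ?w"
          by (simp add: act_simps lact_tco hs arg) (simp add: fscale_def plus_fun_apply)
        note R = R[unfolded cgs(2)[OF le] cgs(4)[OF le]]
        have "lact uE (?L False j) ?w = q powr (1/2) * ?L True j ?w +
            1 / q * (of_real (e_coef q s j) * ?L False (j + 1) ?w)"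
          using q by (simp add: amul_lact lact_tco amul_simps half hs powr_minus_divide)
            (simp add: fscale_def plus_fun_apply)
        also have "\<dots> = lact uE (?R False j) ?w"
          unfolding up here R by (simp add: fscale_def plus_fun_apply hs arg algebra_simps)
        finally show ?thesis using GE False by simp
      qed
    next
      case GF
      have arg: "j - 1/2 - 1 = j - 1 - 1/2" "j + 1/2 - 1 = j - 1/2" "j - 1 + 1/2 = j - 1/2" by auto
      show "lact (gel g) (?L b' j) ?w = lact (gel g) (?R b' j) ?w"
      proof (cases b')
        case True
        have R: "lact uF (?R True j) ?w =
            of_real (cgp q s b i) * of_real (cgp q s True j * f_coef q (s + 1/2) (j + 1/2)) *
              tco q (s + 1/2) (i + hsgn b) (j - 1/2) ?w +
            of_real (cgm q s b i) * of_real (cgm q s True j * f_coef q (s - 1/2) (j + 1/2)) *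
              tco q (s - 1/2) (i + hsgn b) (j - 1/2) ?w"
          by (simp add: act_simps lact_tco hs arg) (simp add: fscale_def plus_fun_apply)
        note R = R[unfolded cgs(5)[OF le] cgs(7)[OF le]]
        have "lact uF (?L True j) ?w = of_real (f_coef q s j) * ?L True (j - 1) ?w +
            of_real (q powr (- 1/2) * q powr (- 2 * j)) * ?L False j ?w"
          using q by (simp add: amul_lact lact_tco amul_simps half hs)
            (simp add: fscale_def plus_fun_apply)
        also have "\<dots> = lact uF (?R True j) ?w"
          unfolding down here R by (simp add: fscale_def plus_fun_apply hs arg algebra_simps)
        finally show ?thesis using GF True by simp
      next
        case False
        have R: "lact uF (?R False j) ?w =
            of_real (cgp q s b i) * of_real (cgp q s False j * f_coef q (s + 1/2) (j - 1/2)) *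
              tco q (s + 1/2) (i + hsgn b) (j - 1 - 1/2) ?w +
            of_real (cgm q s b i) * of_real (cgm q s False j * f_coef q (s - 1/2) (j - 1/2)) *
              tco q (s - 1/2) (i + hsgn b) (j - 1 - 1/2) ?w"
          by (simp add: act_simps lact_tco hs arg) (simp add: fscale_def plus_fun_apply)
        note R = R[unfolded cgs(6)[OF le] cgs(8)[OF le]]
        have "lact uF (?L False j) ?w = of_real (f_coef q s j) * ?L False (j - 1) ?w"
          using q by (simp add: amul_lact lact_tco amul_simps half hs) (simp add: fscale_def)
        also have "\<dots> = lact uF (?R False j) ?w"
          unfolding down R by (simp add: fscale_def plus_fun_apply hs arg algebra_simps)
        finally show ?thesis using GF False by simp
      qed
    qed
  qed
  show ?thesis
  proof (rule lin_eqI)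
    show "?L b' j (Poly_Mapping.single w 1) = ?R b' j (Poly_Mapping.single w 1)" for w
      using *[of "letters w"] by simp
  qed (intro lin_amul lin_plus lin_fscale lin_tco)+
qed

end

section \<open>The Podles sphere as an algebra\<close>

definition pcoef :: "real \<Rightarrow> real \<Rightarrow> complex" where
  "pcoef q a = \<i> * of_real (tpar q a / (q - 1 / q)) * of_real (q powr (- 1/2))"

lemma spins_half: "s \<in> spins \<Longrightarrow> s + 1/2 \<in> spins"
proof -
  assume "s \<in> spins"
  then obtain n :: nat where "2 * s = real n" "0 \<le> s" by (auto simp: spins_def Nats_def)
  then have "2 * (s + 1/2) = real (Suc n)" by simp
  then show ?thesis using \<open>0 \<le> s\<close> unfolding spins_def by (metis (mono_tags, lifting) mem_Collect_eq of_nat_in_Nats add_nonneg_nonneg divide_nonneg_pos zero_le_one zero_less_numeral order.strict_implies_order)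
qed

lemma wts_half: "j \<in> wts s \<Longrightarrow> j + hsgn b \<in> wts (s + 1/2)"
  unfolding wts_def hsgn_def
  by (cases b) (auto intro: exI[where x = "Suc _"] simp: algebra_simps)

lemma half_cases: "i \<in> wts (1/2) \<Longrightarrow> \<exists>b. i = hsgn b"
proof -
  assume "i \<in> wts (1/2)"
  then obtain m :: nat where m: "i = - (1/2) + real m" "m \<le> 1" by (auto simp: wts_def)
  then have "m = 0 \<or> m = 1" by auto
  with m show ?thesis by (auto simp: hsgn_def)
qed

text \<open>The root in \<open>cgm\<close> vanishes at the end weight whose shift would leave the
  shorter ladder, and always for \<open>s = 0\<close>. So the term of spin \<open>s - 1/2\<close> in
  \<open>cg_product\<close> survives only when it is a genuine matrix coefficient.\<close>

lemma cgm_nonzero: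
  assumes "s \<in> spins" "j \<in> wts s" "cgm q s b j \<noteq> 0"
  shows "s - 1/2 \<in> spins" "j + hsgn b \<in> wts (s - 1/2)"
proof -
  obtain m n :: nat where m: "j = - s + real m" "2 * s = real n" "m \<le> n"
    using assms by (auto simp: wts_def spins_def Nats_def)
  have b: "if b then m < n else 0 < m"
    using m assms(3) by (cases b; cases "m = n"; cases "m = 0") (auto simp: cgm_def)
  then have n: "0 < n" using m by (cases b) auto
  then have "2 * (s - 1/2) = real (n - 1)" using m by (simp add: of_nat_diff)
  then show "s - 1/2 \<in> spins"
    unfolding spins_def by (metis (mono_tags, lifting) mem_Collect_eq of_nat_in_Nats of_nat_0_le_iff zero_le_mult_iff zero_less_numeral not_less)
  show "j + hsgn b \<in> wts (s - 1/2)"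
  proof (cases b)
    case True
    then have "real m \<le> 2 * (s - 1/2)" using b m n by (simp add: of_nat_diff)
    then show ?thesis using True m unfolding wts_def hsgn_def by (auto intro!: exI[of _ m])
  next
    case False
    then have "real (m - 1) \<le> 2 * (s - 1/2)" using b m n by (simp add: of_nat_diff)
    then show ?thesis using False b m unfolding wts_def hsgn_def
      by (auto intro!: exI[of _ "m - 1"] simp: of_nat_diff)
  qed
qed

lemma wts_half_cases:
  assumes "s - 1/2 \<in> spins" "i \<in> wts s"
  obtains b i' where "i' \<in> wts (s - 1/2)" "i = i' + hsgn b"
proof (cases "i = - s")
  case True
  then show ?thesis
    using that[of "- (s - 1/2)" False] wts_bot[OF assms(1)] by (auto simp: hsgn_def)
next
  case False
  from assms(2) obtain m :: nat where m: "i = - s + real m" "real m \<le> 2 * s" by (auto simp: wts_def)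
  with False obtain m' where "m = Suc m'" by (cases m) auto
  with m have "i - 1/2 \<in> wts (s - 1/2)" by (auto simp: wts_def intro!: exI[of _ m'])
  then show ?thesis using that[of "i - 1/2" True] by (auto simp: hsgn_def)
qed

lemma tco_0:
  assumes "0 < q"
  shows "tco q 0 0 0 = aone"
proof (rule lin_eqI)
  fix w :: word
  have "tco q 0 0 0 (Poly_Mapping.single (Word ws) 1) = aone (Poly_Mapping.single (Word ws) 1)" for ws
  proof (induction ws rule: rev_induct)
    case Nil
    have "acounit (tco q 0 0 0) = acounit aone" by (simp add: acounit_tco)
    then show ?case by (simp add: acounit_def single_0_1_word)
  next
    case (snoc g ws)
    then show ?case
      unfolding single_snoc_apply using coef_boundary[of q 0] assms
      by (cases g) (auto simp: lact_tco aone_lact fscale_def zero_fun_apply)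
  qed
  from this[of "letters w"] show "tco q 0 0 0 (Poly_Mapping.single w 1) = aone (Poly_Mapping.single w 1)"
    by simp
qed (rule lin_tco lin_aone)+

lemma spins_0: "0 \<in> spins" and wts_0: "0 \<in> wts 0"
  by (auto simp: spins_def wts_def)

lemma aone_Oq: "0 < q \<Longrightarrow> aone \<in> Oq q"
  using Oq_tco[OF spins_0 wts_0 wts_0, of q] tco_0[of q] by simp

context
  fixes q :: real
  assumes q: "0 < q" "q < 1"
begin

section \<open>Closure of \<open>Oq\<close> under the product\<close>

lemma cgp_pos: "j \<in> wts s \<Longrightarrow> cgp q s b j > 0"
  using wts_le[of j s] q unfolding cgp_def
  by (auto intro!: divide_pos_pos mult_pos_pos qbr_pos[OF q])

lemma half_Oq:
  assumes "y \<in> Oq q"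
  shows "amul (tco q (1/2) (hsgn b) (hsgn b')) y \<in> Oq q"
  using assms
proof (induction rule: Oq_induct)
  case (tco s i j)
  have "fscale (of_real (cgm q s b i * cgm q s b' j)) (tco q (s - 1/2) (i + hsgn b) (j + hsgn b')) \<in> Oq q"
  proof (cases "cgm q s b i * cgm q s b' j = 0")
    case True
    show ?thesis unfolding True by (simp add: Oq_closed)
  next
    case False
    then show ?thesis
      using cgm_nonzero[of s i q b] cgm_nonzero[of s j q b'] tco by (intro Oq_closed Oq_tco) auto
  qed
  moreover have "fscale (of_real (cgp q s b i * cgp q s b' j)) (tco q (s + 1/2) (i + hsgn b) (j + hsgn b')) \<in> Oq q"
    using tco by (intro Oq_closed(3) Oq_tco spins_half wts_half)
  ultimately show ?case
    unfolding cg_product[OF q tco] by (intro Oq_closed(1))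
qed (auto simp: amul_simps intro: Oq_closed)

text \<open>A product of coefficients of spin 1/2 and \<open>s - 1/2\<close> is a nonzero multiple
  of the given one of spin \<open>s\<close> plus a term of spin \<open>s - 1\<close>. By
  associativity and induction the product and the lower term multiply \<open>y\<close> into
  \<open>Oq\<close>, so the term of spin \<open>s\<close> does too.\<close>

lemma tco_mult_Oq:
  "s \<in> spins \<Longrightarrow> i \<in> wts s \<Longrightarrow> j \<in> wts s \<Longrightarrow> y \<in> Oq q \<Longrightarrow> amul (tco q s i j) y \<in> Oq q"
proof (induction "nat \<lfloor>2 * s\<rfloor>" arbitrary: s i j y rule: less_induct)
  case less
  from less.prems(1) obtain n :: nat where n: "2 * s = real n" by (auto simp: spins_def Nats_def)
  then have nat: "nat \<lfloor>2 * s\<rfloor> = n" by simp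
  consider "n = 0" | "n = 1" | "n \<ge> 2" by linarith
  then show ?case
  proof cases
    case 1
    then have "s = 0" "i = 0" "j = 0" using n wts_le less.prems by force+
    then show ?thesis using less.prems lin_Oq q by (simp add: tco_0 amul_aone_left)
  next
    case 2
    then have s: "s = 1/2" using n by simp
    then obtain b b' where "i = hsgn b" "j = hsgn b'" using half_cases less.prems by blast
    with s show ?thesis using half_Oq[OF less.prems(4)] by (simp only:)
  next
    case 3
    define r where "r = s - 1/2"
    have "2 * r = real (n - 1)" using n 3 by (simp add: r_def of_nat_diff)
    then have r: "r \<in> spins"
      unfolding spins_def by (metis (mono_tags, lifting) mem_Collect_eq of_nat_in_Nats of_nat_0_le_iff zero_le_mult_iff zero_less_numeral not_less)
    obtain b i' where i: "i' \<in> wts r" "i = i' + hsgn b"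
      using wts_half_cases[OF r[unfolded r_def] less.prems(2)] unfolding r_def by blast
    obtain b' j' where j: "j' \<in> wts r" "j = j' + hsgn b'"
      using wts_half_cases[OF r[unfolded r_def] less.prems(3)] unfolding r_def by blast
    define c d where "c = complex_of_real (cgp q r b i' * cgp q r b' j')"
      and "d = complex_of_real (cgm q r b i' * cgm q r b' j')"
    have c: "c \<noteq> 0" using cgp_pos i j by (simp add: c_def less_imp_neq[symmetric])
    have prod: "amul (tco q (1/2) (hsgn b) (hsgn b')) (tco q r i' j') =
        fscale c (tco q s i j) + fscale d (tco q (r - 1/2) i j)"
      using cg_product[OF q r i(1) j(1), of b b'] i(2) j(2) by (simp add: c_def d_def r_def)
    have "amul (amul (tco q (1/2) (hsgn b) (hsgn b')) (tco q r i' j')) y \<in> Oq q"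
      unfolding amul_assoc using less.hyps[of r i' j' y] r i(1) j(1) less.prems(4) n nat 3
      by (intro half_Oq) (simp add: r_def)
    moreover have "amul (fscale d (tco q (r - 1/2) i j)) y \<in> Oq q"
    proof (cases "d = 0")
      case False
      then have "r - 1/2 \<in> spins" "i \<in> wts (r - 1/2)" "j \<in> wts (r - 1/2)"
        using cgm_nonzero[OF r i(1), of q b] cgm_nonzero[OF r j(1), of q b'] i(2) j(2) by (auto simp: d_def)
      then have "amul (tco q (r - 1/2) i j) y \<in> Oq q"
        using less.prems(4) n nat 3 by (intro less.hyps) (simp_all add: r_def)
      then show ?thesis by (simp add: amul_simps Oq_closed)
    qed (simp add: amul_simps Oq_closed)
    ultimately have "amul (fscale c (tco q s i j)) y \<in> Oq q"
      unfolding prod amul_plus_left by (metis Oq_closed(2) add_diff_cancel_right')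
    then have "fscale (1 / c) (fscale c (amul (tco q s i j) y)) \<in> Oq q"
      unfolding amul_fscale_left by (rule Oq_closed(3))
    then show ?thesis using c by simp
  qed
qed

lemma Oq_mult: "x \<in> Oq q \<Longrightarrow> y \<in> Oq q \<Longrightarrow> amul x y \<in> Oq q"
  by (induction rule: Oq_induct) (auto simp: amul_simps intro: Oq_closed tco_mult_Oq)

section \<open>The invariance equation of the sphere\<close>

lemma RB_eq: "RB q a = cst (of_real (q powr (- 1/2))) *
    (cst (of_real (1 / q)) * (uKi * (uF * uK)) - cst (of_real q) * (uKi * uE)) -
    cst (\<i> * of_real (tpar q a / (q - 1 / q))) * uKi"
proof -
  have "Bt q a = Poly_Mapping.single (Word [GE]) (of_real (q powr (- 1/2))) +
      (Poly_Mapping.single (Word [GF, GK]) (- of_real (q powr (- 1/2))) +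
       Poly_Mapping.single (Word [GK]) (- (\<i> * of_real (tpar q a / (q - 1 / q)))))"
    by (simp add: Bt_def gel_def mult_single plus_word_def right_diff_distrib cst_single
        single_uminus del: of_real_divide of_real_diff)
  moreover have "uKi * (cst (of_real (1 / q)) * uF * uK) = cst (of_real (1 / q)) * (uKi * (uF * uK))"
    by (simp only: mult.assoc cst_left_commute[of uKi])
  moreover have "cst (- c) * h = - (cst c * h)" for c and h :: ualg
    by (simp add: cst_def single_uminus)
  ultimately show ?thesis
    by (simp add: RB_def unitary_antipode_def antihom_ext_add antihom_ext_single
        right_diff_distrib mult.assoc del: of_real_divide of_real_diff)
qed

lemma counit_Bt: "counit (Bt q a) = - (\<i> * of_real (tpar q a / (q - 1 / q)))"
proof -
  have "aone (Bt q a) = - (\<i> * of_real (tpar q a / (q - 1 / q)))"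
    unfolding Bt_def using lin_simps[OF lin_aone]
    by (simp add: gel_def mult_single plus_word_def aone_single del: of_real_divide of_real_diff)
  then show ?thesis by (simp add: aone_def)
qed

text \<open>In \<open>ualg\<close> the element \<open>k^(-1) f k\<close> differs from
  \<open>q^2 f\<close>. On \<open>Oq\<close> they act alike, and then both ladder terms carry the
  same factor \<open>q^(1/2)\<close>.\<close>

lemma lact_RB:
  assumes x: "x \<in> Oq q"
  shows "lact (RB q a) x = fscale (of_real (q powr (1/2))) (lact uF x - lact uKi (lact uE x)) -
    fscale (\<i> * of_real (tpar q a / (q - 1 / q))) (lact uKi x)"
proof -
  have q2: "q powr (- 1/2) * q = q powr (1/2)"
    using q powr_add[of q "-1/2" 1] by simp
  have "lact uF (lact uK x) = fscale (of_real (q\<^sup>2)) (lact uK (lact uF x))"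
    using Oq_lact_rels(4)[OF q x] q by simp
  then have "lact uKi (lact uF (lact uK x)) = fscale (of_real (q\<^sup>2)) (lact uF x)"
    using Oq_lact_rels(2)[OF q Oq_lact_gel[OF x, of GF]] by (simp add: act_simps)
  then have "lact (RB q a) x = fscale (of_real (q powr (- 1/2)))
      (fscale (of_real (1/q)) (fscale (of_real (q\<^sup>2)) (lact uF x)) - fscale (of_real q) (lact uKi (lact uE x))) -
    fscale (\<i> * of_real (tpar q a / (q - 1 / q))) (lact uKi x)"
    unfolding RB_eq lact_arg[OF lin_Oq[OF x]] lact_lact[symmetric]
    by (simp add: lact_cst lin_lact lin_minus lin_fscale lin_Oq[OF x] del: of_real_divide of_real_diff)
  also have "fscale (of_real (q powr (- 1/2)))
      (fscale (of_real (1/q)) (fscale (of_real (q\<^sup>2)) (lact uF x)) - fscale (of_real q) (lact uKi (lact uE x))) =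
     fscale (of_real (q powr (1/2))) (lact uF x - lact uKi (lact uE x))"
    unfolding q2[symmetric] using q
    by (simp add: fs.scale_right_diff_distrib power2_eq_square)
  finally show ?thesis .
qed

text \<open>The invariance equation is divided by \<open>q^(1/2)\<close> and solved for the action
  of \<open>f\<close>; \<open>pcoef\<close> is the coefficient that results. In this form it
  eliminates \<open>f\<close>.\<close>

lemma podles_iff: "x \<in> podles q a \<longleftrightarrow>
    x \<in> Oq q \<and> lact uF x = lact uKi (lact uE x) + fscale (pcoef q a) (lact uKi x - x)"
proof (cases "x \<in> Oq q")
  case True
  define T where "T = \<i> * complex_of_real (tpar q a / (q - 1 / q))"
  define Q where "Q = complex_of_real (q powr (1/2))"
  have Q: "Q \<noteq> 0" "of_real (q powr (- 1/2)) = 1 / Q" using q by (simp_all add: Q_def powr_minus_divide)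
  have "x \<in> podles q a \<longleftrightarrow> fscale Q (lact uF x - lact uKi (lact uE x)) - fscale T (lact uKi x) = fscale (- T) x"
    using True by (simp only: podles_def lact_RB counit_Bt T_def Q_def mem_Collect_eq simp_thms)
  also have "\<dots> \<longleftrightarrow> fscale Q (lact uF x - lact uKi (lact uE x)) = fscale Q (fscale (T / Q) (lact uKi x - x))"
    using Q(1) by (auto simp: algebra_simps fs.scale_right_diff_distrib)
  also have "\<dots> \<longleftrightarrow> lact uF x - lact uKi (lact uE x) = fscale (T / Q) (lact uKi x - x)"
    using Q(1) by (simp only: fs.scale_left_imp_eq fs.scale_cancel_left) simp
  also have "T / Q = pcoef q a"
    by (simp only: pcoef_def T_def Q(2)) simp
  finally show ?thesis using True by (simp add: diff_eq_eq add.commute)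
qed (simp add: podles_def)

lemma podles_subspace: "fs.subspace (podles q a)"
proof (rule fs.subspaceI)
  show "0 \<in> podles q a"
    unfolding podles_iff by (simp add: act_simps Oq_closed)
next
  fix x y assume "x \<in> podles q a" "y \<in> podles q a"
  then show "x + y \<in> podles q a"
    unfolding podles_iff by (simp add: act_simps Oq_closed fs.scale_right_diff_distrib fs.scale_right_distrib)
next
  fix c x assume "x \<in> podles q a"
  then show "fscale c x \<in> podles q a"
    unfolding podles_iff
    by (simp add: act_simps Oq_closed fs.scale_right_diff_distrib fs.scale_right_distrib mult.commute)
qed

lemmas podles_closed = fs.subspace_add[OF podles_subspace] fs.subspace_diff[OF podles_subspace]
  fs.subspace_scale[OF podles_subspace] fs.subspace_0[OF podles_subspace] fs.subspace_sum[OF podles_subspace]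

lemma podles_Oq: "x \<in> podles q a \<Longrightarrow> x \<in> Oq q"
  by (simp add: podles_def)

lemma aone_podles: "aone \<in> podles q a"
  by (simp add: podles_iff aone_lact aone_Oq q act_simps)

text \<open>In the Leibniz expansion of the action of \<open>f\<close> the mixed terms with
  \<open>pcoef\<close> cancel. The ladder terms recombine because \<open>k^(-1) k\<close> acts as
  the identity on \<open>Oq\<close>.\<close>

lemma podles_mult: "x \<in> podles q a \<Longrightarrow> y \<in> podles q a \<Longrightarrow> amul x y \<in> podles q a"
proof -
  assume x: "x \<in> podles q a" and y: "y \<in> podles q a"
  have "lact uKi (lact uK z) = z" if "z \<in> podles q a" for z
    using Oq_lact_rels(2)[OF q podles_Oq[OF that]] .
  with x y show ?thesis
    unfolding podles_iff
    by (simp add: Oq_mult amul_lact amul_simps act_simps fs.scale_right_diff_distrib)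
qed

lemma podles_ract: "x \<in> podles q a \<Longrightarrow> ract x (gel g) \<in> podles q a"
  unfolding podles_iff by (simp add: Oq_ract_gel lact_ract act_simps)

end

section \<open>Weight vectors\<close>

text \<open>A weight of functionals for right translation by \<open>k\<close>, to be distinguished
  from the weights of \<open>i R(B_t)\<close> in \<open>weight_space\<close>. In this convention
  translation by \<open>e\<close> lowers the weight.\<close>

definition has_weight :: "real \<Rightarrow> real \<Rightarrow> func \<Rightarrow> bool" where
  "has_weight q j x \<longleftrightarrow> ract x uK = fscale (of_real (q powr (2 * j))) x"

lemma has_weight_closed:
  "has_weight q j 0" "has_weight q j x \<Longrightarrow> has_weight q j (fscale c x)"
  "has_weight q j x \<Longrightarrow> has_weight q j y \<Longrightarrow> has_weight q j (x + y)" "has_weight q j x \<Longrightarrow> has_weight q j y \<Longrightarrow> has_weight q j (x - y)"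
  by (simp_all add: has_weight_def act_simps fs.scale_right_distrib fs.scale_right_diff_distrib mult.commute)

lemma has_weight_lact: "has_weight q j x \<Longrightarrow> has_weight q j (lact g x)"
  by (metis has_weight_def lact_fscale lact_ract)

lemma has_weight_tco: "has_weight q i (tco q s i j)"
  by (simp add: has_weight_def ract_tco)

lemma has_weight_mult: "has_weight q i x \<Longrightarrow> has_weight q j y \<Longrightarrow> has_weight q (i + j) (amul x y)"
  by (simp add: has_weight_def amul_ract amul_simps distrib_left powr_add mult.commute)

lemma wts_half_int: "s \<in> spins \<Longrightarrow> i \<in> wts s \<Longrightarrow> 2 * i \<in> \<int>"
proof -
  assume "s \<in> spins" "i \<in> wts s"
  then obtain m n :: nat where "i = - s + real m" "2 * s = real n"
    by (auto simp: wts_def spins_def Nats_def)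
  then have "2 * i = real_of_int (2 * int m - int n)" by simp
  then show ?thesis by (metis Ints_of_int)
qed

text \<open>Right translation by \<open>e\<close> lowers the row index, so row
  \<open>- s + m\<close> is killed by \<open>m + 1\<close> translations.\<close>

lemma Oq_nilpotent:
  assumes "x \<in> Oq q"
  shows "\<exists>N. \<forall>r\<ge>N. x (uE ^ r) = 0"
  using assms
proof (induction rule: Oq_induct)
  case (add c x y)
  then obtain N M where "\<forall>r\<ge>N. x (uE ^ r) = 0" "\<forall>r\<ge>M. y (uE ^ r) = 0" by blast
  then show ?case by (intro exI[of _ "max N M"]) (simp add: fscale_def plus_fun_apply)
next
  case (tco s i j)
  have "tco q s (- s + real m) j (uE ^ r) = 0" if "m < r" for m r
    using that
  proof (induction r arbitrary: m)
    case (Suc r)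
    have "tco q s (- s + real m - 1) j (uE ^ r) = 0"
    proof (cases m)
      case 0
      then have "- s + real m - 1 \<notin> wts s" using wts_le by fastforce
      then show ?thesis using tco_eq_0 tco by (simp add: zero_fun_apply)
    next
      case (Suc m')
      then show ?thesis using Suc.IH[of m'] Suc.prems by simp
    qed
    moreover have "tco q s (- s + real m) j (uE ^ Suc r) = ract (tco q s (- s + real m) j) uE (uE ^ r)"
      by (simp add: ract_def)
    ultimately show ?case by (simp add: ract_tco fscale_def)
  qed simp
  moreover from tco(2) obtain m where "i = - s + real m" by (auto simp: wts_def)
  ultimately have "\<forall>r\<ge>Suc m. tco q s i j (uE ^ r) = 0" by (simp add: Suc_le_eq)
  then show ?case by blast
qed (simp add: zero_fun_apply)

lemma apply_power_Suc: "x (uE ^ Suc r) = ract x uE (uE ^ r)"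
  by (simp add: ract_def)

context
  fixes q :: real
  assumes q: "0 < q" "q < 1"
begin

lemma has_weight_uKi: "x \<in> Oq q \<Longrightarrow> has_weight q j x \<Longrightarrow> ract x uKi = fscale (of_real (q powr (- 2 * j))) x"
proof -
  assume x: "x \<in> Oq q" "has_weight q j x"
  have "fscale (of_real (q powr (2 * j))) (ract x uKi) = x"
    using Oq_ract_rels(1)[OF q x(1)] x(2) by (simp add: has_weight_def act_simps)
  then have "fscale (of_real (q powr (- 2 * j))) x =
      fscale (of_real (q powr (- 2 * j) * q powr (2 * j))) (ract x uKi)"
    by (metis fs.scale_scale of_real_mult)
  also have "q powr (- 2 * j) * q powr (2 * j) = 1"
    using q by (simp flip: powr_add)
  finally show ?thesis by simp
qed

lemma has_weight_uE: "x \<in> Oq q \<Longrightarrow> has_weight q j x \<Longrightarrow> has_weight q (j - 1) (ract x uE)"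
proof -
  assume x: "x \<in> Oq q" "has_weight q j x"
  have "q powr (2 * j) = q powr (2 * (j - 1)) * q\<^sup>2"
    using q by (simp add: right_diff_distrib powr_diff)
  then have "fscale (of_real (q\<^sup>2)) (fscale (of_real (q powr (2 * (j - 1)))) (ract x uE)) =
      fscale (of_real (q\<^sup>2)) (ract (ract x uE) uK)"
    using Oq_ract_rels(3)[OF q x(1)] x(2) by (simp add: has_weight_def act_simps mult.commute)
  then have "fscale (of_real (q powr (2 * (j - 1)))) (ract x uE) = ract (ract x uE) uK"
    by (rule fs.scale_left_imp_eq[rotated]) (use q in simp)
  then show ?thesis by (simp add: has_weight_def)
qed

lemma has_weight_uF: "x \<in> Oq q \<Longrightarrow> has_weight q j x \<Longrightarrow> has_weight q (j + 1) (ract x uF)"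
proof -
  assume x: "x \<in> Oq q" "has_weight q j x"
  have e: "q powr (2 * j) = q powr (2 * (j + 1)) * (1 / q\<^sup>2)"
    using q by (simp add: distrib_left powr_add)
  have "fscale (of_real (q powr (2 * j))) (ract x uF) = fscale (of_real (1 / q\<^sup>2)) (ract (ract x uF) uK)"
    using Oq_ract_rels(4)[OF q x(1)] x(2) by (simp add: has_weight_def act_simps del: of_real_divide)
  then have "fscale (of_real (1 / q\<^sup>2)) (fscale (of_real (q powr (2 * (j + 1)))) (ract x uF)) =
      fscale (of_real (1 / q\<^sup>2)) (ract (ract x uF) uK)"
    unfolding e by (simp only: of_real_mult fs.scale_scale mult.commute)
  then have "fscale (of_real (q powr (2 * (j + 1)))) (ract x uF) = ract (ract x uF) uK"
    by (rule fs.scale_left_imp_eq[rotated]) (use q in simp)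
  then show ?thesis by (simp add: has_weight_def)
qed

text \<open>Moving \<open>f\<close> to the right through the powers of \<open>e\<close> leaves
  commutators, which on a weight vector are multiples of values on powers of \<open>e\<close>. The
  \<open>f\<close> that reaches the right end is replaced by means of the sphere equation.\<close>

lemma podles_borel_uF:
  "x \<in> podles q a \<Longrightarrow> has_weight q j x \<Longrightarrow> (\<And>r. x (uE ^ r) = 0) \<Longrightarrow> x (uF * uE ^ r) = 0"
proof (induction r arbitrary: x j)
  case 0
  have x: "x \<in> Oq q" using 0(1) by (rule podles_Oq[OF q])
  have "x uF = lact uF x 1" by (simp add: lact_def)
  also have "\<dots> = x (uKi * uE) + pcoef q a * (x uKi - x 1)"
    using 0(1) by (simp add: podles_iff[OF q] plus_fun_apply fscale_def minus_apply lact_lact) (simp add: lact_def)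
  finally have "x uF = ract x uKi (uE ^ 1) + pcoef q a * (ract x uKi 1 - x 1)"
    by (simp add: ract_def)
  then show ?case
    using 0(3)[of 0] 0(3)[of 1] by (simp add: has_weight_uKi[OF x 0(2)] fscale_def)
next
  case (Suc r)
  have x: "x \<in> Oq q" using Suc.prems by (simp add: podles_Oq[OF q])
  have "x (uF * uE ^ Suc r) = ract (ract x uF) uE (uE ^ r)"
    by (simp add: ract_def mult.assoc)
  also have "ract (ract x uF) uE = ract (ract x uE) uF - fscale (of_real (1 / (q - 1 / q))) (ract x uK - ract x uKi)"
    using Oq_ract_rels(5)[OF q x] by simp
  also have "\<dots> (uE ^ r) = ract x uE (uF * uE ^ r)"
    using Suc.prems(3)[of r] Suc.prems(2)[unfolded has_weight_def]
    by (simp add: minus_apply fscale_def has_weight_uKi[OF x Suc.prems(2)]) (simp add: ract_def)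
  also have "\<dots> = 0"
    using Suc.prems(1,2) Suc.prems(3)[of "Suc _", unfolded apply_power_Suc]
    by (intro Suc.IH[OF podles_ract[OF q] has_weight_uE[OF x]])
  finally show ?case .
qed

text \<open>Modulo \<open>R(B\<^sub>t) - \<epsilon>(B\<^sub>t)\<close> the generator \<open>f\<close> can be eliminated on the right, so weight vectors of the
  sphere are determined by their values on powers of \<open>e\<close>.\<close>
lemma podles_borel:
  assumes "x \<in> podles q a" "has_weight q j x" "\<And>r. x (uE ^ r) = 0"
  shows "x = 0"
proof (rule lin_eqI)
  fix w :: word
  \<comment> \<open>Letters are stripped from the left. Each right translation keeps all three
    hypotheses; for \<open>f\<close> the vanishing on powers of \<open>e\<close> is
    \<open>podles_borel_uF\<close>.\<close>
  have "x (Poly_Mapping.single (Word ws) 1) = 0" for ws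
    using assms
  proof (induction ws arbitrary: x j)
    case Nil
    then show ?case using Nil(3)[of 0] by (simp add: single_0_1_word)
  next
    case (Cons g ws)
    have x: "x \<in> Oq q" using Cons.prems by (simp add: podles_Oq[OF q])
    have "\<exists>j. has_weight q j (ract x (gel g))"
    proof (cases g)
      case GK
      then show ?thesis using Cons.prems(2) by (metis has_weight_closed(2) has_weight_def)
    next
      case GKi
      then show ?thesis using Cons.prems(2) has_weight_uKi[OF x] by (metis has_weight_closed(2))
    qed (use has_weight_uE[OF x Cons.prems(2)] has_weight_uF[OF x Cons.prems(2)] in auto)
    moreover have "ract x (gel g) (uE ^ r) = 0" for r
    proof (cases g)
      case GK
      then show ?thesis using Cons.prems by (simp add: has_weight_def fscale_def)
    next
      case GKi
      then show ?thesis using Cons.prems has_weight_uKi[OF x] by (simp add: fscale_def)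
    next
      case GE
      then show ?thesis using Cons.prems(3)[of "Suc r", unfolded apply_power_Suc] by simp
    next
      case GF
      then show ?thesis using podles_borel_uF[OF Cons.prems] by (simp add: ract_def)
    qed
    ultimately have "ract x (gel g) (Poly_Mapping.single (Word ws) 1) = 0"
      using Cons.IH podles_ract[OF q Cons.prems(1)] by blast
    then show ?case by (simp add: single_Cons_apply)
  qed
  from this[of "letters w"] show "x (Poly_Mapping.single w 1) = 0 (Poly_Mapping.single w 1)"
    by (simp add: zero_fun_apply)
qed (use lin_Oq[OF podles_Oq[OF q assms(1)]] lin_zero_func in auto)

section \<open>Decomposition into weight vectors\<close>

lemma has_weight_independent:
  assumes "finite J" "\<And>j. j \<in> J \<Longrightarrow> has_weight q j (y j)" "(\<Sum>j\<in>J. y j) = 0"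
  shows "\<forall>j\<in>J. y j = 0"
  using assms
proof (induction J arbitrary: y rule: finite_induct)
  case (insert a J)
  let ?l = "\<lambda>j. complex_of_real (q powr (2 * j))"
  have sum: "(\<Sum>j\<in>J. y j) = - y a"
    using insert.prems(2) insert.hyps by (simp add: add_eq_0_iff2 add.commute)
  have "0 = ract (\<Sum>j\<in>insert a J. y j) uK"
    unfolding insert.prems(2) by (simp add: act_simps)
  also have "\<dots> = fscale (?l a) (y a) + (\<Sum>j\<in>J. fscale (?l j) (y j))"
    using insert.hyps insert.prems(1) by (simp add: act_simps ract_sum has_weight_def)
  also have "fscale (?l a) (y a) = - (\<Sum>j\<in>J. fscale (?l a) (y j))"
    by (simp add: fs.scale_sum_right[symmetric] sum)
  finally have "(\<Sum>j\<in>J. fscale (?l j - ?l a) (y j)) = 0"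
    \<comment> \<open>Subtracting \<open>q^(2 a)\<close> times the relation from its
      \<open>k\<close>-translate removes the component at \<open>a\<close>; the remaining scalars
      are nonzero because \<open>q powr\<close> is injective.\<close>
    by (simp add: fs.scale_left_diff_distrib sum_subtractf)
  then have "\<forall>j\<in>J. fscale (?l j - ?l a) (y j) = 0"
    using insert.prems(1) by (intro insert.IH) (auto intro: has_weight_closed)
  moreover have "?l j - ?l a \<noteq> 0" if "j \<in> J" for j
  proof -
    have "j \<noteq> a" using that insert.hyps by auto
    then show ?thesis using q by (simp add: powr_inj)
  qed
  ultimately have "\<forall>j\<in>J. y j = 0" by simp
  with sum show ?case by simp
qed simp

text \<open>The family \<open>f\<close> is defined on all reals and vanishes outside
  \<open>J\<close>, so that two decompositions can be added over the union of their index
  sets.\<close>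

lemma Oq_weight_decomp:
  assumes "x \<in> Oq q"
  shows "\<exists>J f. finite J \<and> (\<forall>j\<in>J. 2 * j \<in> \<int>) \<and> (\<forall>j. f j \<in> Oq q \<and> has_weight q j (f j)) \<and>
    (\<forall>j. j \<notin> J \<longrightarrow> f j = 0) \<and> x = (\<Sum>j\<in>J. f j)"
  using assms
proof (induction rule: Oq_induct)
  case zero
  show ?case by (rule exI[of _ "{}"], rule exI[of _ "\<lambda>_. 0"]) (simp add: Oq_closed has_weight_closed)
next
  case (add c x y)
  from add(1) obtain J f where 1: "finite J" "\<forall>j\<in>J. 2 * j \<in> \<int>"
    "\<forall>j. f j \<in> Oq q \<and> has_weight q j (f j)" "\<forall>j. j \<notin> J \<longrightarrow> f j = 0" and x: "x = (\<Sum>j\<in>J. f j)"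
    by (elim exE conjE)
  from add(2) obtain J' f' where 2: "finite J'" "\<forall>j\<in>J'. 2 * j \<in> \<int>"
    "\<forall>j. f' j \<in> Oq q \<and> has_weight q j (f' j)" "\<forall>j. j \<notin> J' \<longrightarrow> f' j = 0" and y: "y = (\<Sum>j\<in>J'. f' j)"
    by (elim exE conjE)
  have "(\<Sum>j\<in>J \<union> J'. fscale c (f j) + f' j) = fscale c (\<Sum>j\<in>J \<union> J'. f j) + (\<Sum>j\<in>J \<union> J'. f' j)"
    by (simp add: sum.distrib fs.scale_sum_right)
  also have "(\<Sum>j\<in>J \<union> J'. f j) = x"
    unfolding x using 1 2 by (intro sum.mono_neutral_right) auto
  also have "(\<Sum>j\<in>J \<union> J'. f' j) = y"
    unfolding y using 1 2 by (intro sum.mono_neutral_right) auto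
  finally show ?case
    using 1 2 by (intro exI[of _ "J \<union> J'"] exI[of _ "\<lambda>j. fscale c (f j) + f' j"] conjI)
      (auto simp: Oq_closed has_weight_closed)
next
  case (tco s i j)
  then show ?case
    by (intro exI[of _ "{i}"] exI[of _ "\<lambda>k. if k = i then tco q s i j else 0"])
      (auto simp: wts_half_int has_weight_tco has_weight_closed Oq_tco Oq_closed)
qed

lemma podles_weight_decomp:
  assumes "x \<in> podles q a"
  shows "\<exists>J f. finite J \<and> (\<forall>j\<in>J. 2 * j \<in> \<int> \<and> f j \<in> podles q a \<and> has_weight q j (f j)) \<and> x = (\<Sum>j\<in>J. f j)"
proof -
  from Oq_weight_decomp[OF podles_Oq[OF q assms]] obtain J f where
    f: "finite J" "\<forall>j\<in>J. 2 * j \<in> \<int>" "\<forall>j. f j \<in> Oq q \<and> has_weight q j (f j)" "x = (\<Sum>j\<in>J. f j)"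
    by (elim exE conjE)
  \<comment> \<open>\<open>D\<close> is the defect of the sphere equation. It is built from left
    translations, which preserve weights, so \<open>D x = 0\<close> splits into its
    components.\<close>
  define D where "D y = lact uF y - (lact uKi (lact uE y) + fscale (pcoef q a) (lact uKi y - y))" for y
  have "(\<Sum>j\<in>J. D (f j)) = D x"
    unfolding D_def f(4) lact_sum
    by (simp add: sum_subtractf sum.distrib lact_sum flip: fs.scale_sum_right)
  also have "D x = 0"
    using assms by (simp add: D_def podles_iff[OF q])
  finally have "\<forall>j\<in>J. D (f j) = 0"
    using f unfolding D_def by (intro has_weight_independent) (auto intro!: has_weight_closed has_weight_lact)
  then have "\<forall>j\<in>J. f j \<in> podles q a"
    using f by (simp add: podles_iff[OF q] D_def)
  with f show ?thesis by blast
qed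

end

section \<open>Derivations at the counit\<close>

lemma wts_1: "wts 1 = {-1, 0, 1}"
proof -
  have "m = 0 \<or> m = 1 \<or> m = 2" if "real m \<le> 2" for m :: nat using that by linarith
  then show ?thesis
    by (force simp: wts_def intro: exI[of _ "0::nat"] exI[of _ "1::nat"] exI[of _ "2::nat"])
qed

lemma spins_1: "1 \<in> spins"
  by (simp add: spins_def)

text \<open>The eigenvector equation of \<open>\<pi>\<^sub>1(i R(B\<^sub>t))\<close> at the eigenvalue \<open>[a]\<close>, solved for the coordinates at \<open>-1\<close> and \<open>0\<close>.\<close>
definition spherical_vec :: "real \<Rightarrow> real \<Rightarrow> (real \<Rightarrow> complex) \<Rightarrow> bool" where
  "spherical_vec q a v \<longleftrightarrow> v 1 \<noteq> 0 \<and> v (-1) = v 1 / of_real q \<and>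
     of_real (sqrt (qbr q 2)) * v 0 = - pcoef q a * (1 / of_real q - of_real q) * v 1"

text \<open>For \<open>v\<close> in \<open>Hs 1\<close> and a weight \<open>i\<close> this is
  \<open>mcoef q 1 (delta i) v\<close>.\<close>

definition sph :: "real \<Rightarrow> (real \<Rightarrow> complex) \<Rightarrow> real \<Rightarrow> func" where
  "sph q v i = fscale (v (-1)) (tco q 1 i (-1)) + fscale (v 0) (tco q 1 i 0) + fscale (v 1) (tco q 1 i 1)"

definition eps_derivation :: "real \<Rightarrow> real \<Rightarrow> (func \<Rightarrow> complex) \<Rightarrow> bool" where
  "eps_derivation q a \<phi> \<longleftrightarrow>
     (\<forall>x\<in>podles q a. \<forall>y\<in>podles q a. \<phi> (x + y) = \<phi> x + \<phi> y \<and>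
        \<phi> (amul x y) = acounit x * \<phi> y + acounit y * \<phi> x) \<and>
     (\<forall>x\<in>podles q a. \<forall>c. \<phi> (fscale c x) = c * \<phi> x)"

lemma mcoef_sph: "v \<in> Hs 1 \<Longrightarrow> mcoef q 1 w v = (\<Sum>i\<in>{-1, 0, 1}. fscale (cnj (w i)) (sph q v i))"
  by (simp add: mcoef_eq wts_1 sph_def fs.scale_right_distrib add.assoc)

lemma has_weight_sph: "has_weight q i (sph q v i)"
  unfolding sph_def by (intro has_weight_closed has_weight_tco)

lemma acounit_sph: "i \<in> {-1, 0, 1} \<Longrightarrow> acounit (sph q v i) = v i"
  by (auto simp: sph_def acounit_simps acounit_tco)

context
  fixes q :: real
  assumes q: "0 < q" "q < 1"
begin

lemma coef_spin_1: "e_coef q 1 (-1) = sqrt (qbr q 2)" "e_coef q 1 0 = q * sqrt (qbr q 2)"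
  "e_coef q 1 1 = 0" "f_coef q 1 1 = sqrt (qbr q 2) / q" "f_coef q 1 0 = sqrt (qbr q 2)" "f_coef q 1 (-1) = 0"
  using q qbr_1[OF q] by (simp_all add: e_coef_def f_coef_def powr_minus_divide)

lemma sqrt_qbr_2: "sqrt (qbr q 2) > 0"
  by (simp add: qbr_pos[OF q])

text \<open>Left translations touch only the column index, so the eigenvector equation for
  \<open>v\<close> becomes the sphere equation, for every row. The identities \<open>c\<close>
  compare the coefficients of the columns -1, 0 and 1.\<close>

lemma sph_podles:
  assumes v: "spherical_vec q a v" and i: "i \<in> {-1, 0, 1}"
  shows "sph q v i \<in> podles q a"
  unfolding podles_iff[OF q]
proof
  show "sph q v i \<in> Oq q"
    unfolding sph_def using i by (intro Oq_closed Oq_tco spins_1) (auto simp: wts_1)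
  define S where "S = complex_of_real (sqrt (qbr q 2))"
  have v': "v (-1) = v 1 / of_real q" "S * v 0 = - pcoef q a * (1 / of_real q - of_real q) * v 1"
    using v by (auto simp: spherical_vec_def S_def)
  have pw: "q powr (2 * 1) = q\<^sup>2" "q powr (2 * - 1) = 1 / q\<^sup>2" "q powr (- 2 * 1) = 1 / q\<^sup>2" "q powr (- 2 * -1) = q\<^sup>2"
    using q by (simp_all add: powr_minus_divide)
  have F: "lact uF (sph q v i) = fscale (v 0 * S) (tco q 1 i (-1)) + fscale (v 1 * S / of_real q) (tco q 1 i 0)"
    by (simp add: sph_def act_simps lact_tco coef_spin_1 S_def)
  have E: "lact uKi (lact uE (sph q v i)) = fscale (v (-1) * S) (tco q 1 i 0) +
      fscale (v 0 * S / of_real q) (tco q 1 i 1)"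
    using q pw by (simp add: sph_def act_simps lact_tco coef_spin_1 S_def power2_eq_square)
  have K: "lact uKi (sph q v i) - sph q v i = fscale (v (-1) * (of_real (q\<^sup>2) - 1)) (tco q 1 i (-1)) +
      fscale (v 1 * (of_real (1 / q\<^sup>2) - 1)) (tco q 1 i 1)"
    using q pw by (simp add: sph_def act_simps lact_tco fs.scale_left_diff_distrib right_diff_distrib)
  have c: "v 0 * S = pcoef q a * (v (-1) * (of_real (q\<^sup>2) - 1))" "v 1 * S / of_real q = v (-1) * S"
    "v 0 * S / of_real q + pcoef q a * (v 1 * (of_real (1 / q\<^sup>2) - 1)) = 0"
    using v' q by (simp_all add: mult.commute[of "v 0"]) (simp_all add: field_simps power2_eq_square)
  have "lact uKi (lact uE (sph q v i)) + fscale (pcoef q a) (lact uKi (sph q v i) - sph q v i) =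
      fscale (pcoef q a * (v (-1) * (of_real (q\<^sup>2) - 1))) (tco q 1 i (-1)) +
      fscale (v (-1) * S) (tco q 1 i 0) +
      fscale (v 0 * S / of_real q + pcoef q a * (v 1 * (of_real (1 / q\<^sup>2) - 1))) (tco q 1 i 1)"
    unfolding E K by (simp add: fs.scale_right_distrib fs.scale_left_distrib add_ac)
  also have "\<dots> = lact uF (sph q v i)"
    unfolding F c(3) unfolding c(1,2) by simp
  finally show "lact uF (sph q v i) =
      lact uKi (lact uE (sph q v i)) + fscale (pcoef q a) (lact uKi (sph q v i) - sph q v i)" ..
qed

lemma RB_spin_1:
  "rep q 1 (cst \<i> * RB q a) v j = \<i> * (of_real (q powr (- 1/2)) *
     (of_real (1 / q) * (of_real (q powr (- 2 * j)) * (of_real (f_coef q 1 (j + 1)) *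
        (of_real (q powr (2 * (j + 1))) * v (j + 1)))) -
      of_real q * (of_real (q powr (- 2 * j)) * (of_real (e_coef q 1 (j - 1)) * v (j - 1)))) -
     \<i> * of_real (qbr q a) * (of_real (q powr (- 2 * j)) * v j))"
  unfolding RB_eq[OF q] qbr_def tpar_def[symmetric] by (simp only: rep_simps rep_gen.simps)

text \<open>The coordinates 0 and 1 of the eigenvector equation give the two conditions. Coordinate
  -1 follows from them (\<open>em\<close>), so \<open>[a]\<close> really is an eigenvalue.\<close>

lemma spherical_vec_eigen:
  assumes v: "v \<in> Hs 1"
  shows "rep q 1 (cst \<i> * RB q a) v = (\<lambda>j. of_real (qbr q a) * v j) \<longleftrightarrow>
    v (-1) = v 1 / of_real q \<and>
    of_real (sqrt (qbr q 2)) * v 0 = - pcoef q a * (1 / of_real q - of_real q) * v 1"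
proof -
  define S where "S = complex_of_real (sqrt (qbr q 2))"
  define Q where "Q = complex_of_real (q powr (- 1/2))"
  define t where "t = complex_of_real (qbr q a)"
  define k where "k = complex_of_real q"
  have "q powr (- 1/2) * q powr (- 1/2) = 1 / q"
    using q by (simp add: powr_minus_divide flip: powr_add)
  then have "Q * Q = complex_of_real (1 / q)"
    unfolding Q_def of_real_mult[symmetric] by simp
  then have Q: "Q * Q = 1 / k" "Q \<noteq> 0" "k \<noteq> 0" "S \<noteq> 0"
    using q sqrt_qbr_2 by (auto simp: k_def Q_def S_def)
  have pc: "pcoef q a = \<i> * t * Q"
    by (simp add: pcoef_def t_def Q_def qbr_def tpar_def)
  have out: "v j = 0" if "j \<notin> {-1, 0, 1}" for j
    using v that by (simp add: Hs_def wts_1)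
  have pw: "q powr 2 = q\<^sup>2" "q powr (-2) = 1 / q\<^sup>2"
    using q by (simp_all add: powr_minus_divide)
  have R1: "rep q 1 (cst \<i> * RB q a) v 1 = - (\<i> * Q * S * v 0) + t * v 1 / k\<^sup>2"
    unfolding RB_spin_1 Q_def[symmetric] t_def[symmetric]
    using out[of 2] pw q by (simp add: coef_spin_1 S_def k_def algebra_simps power2_eq_square)
  have R0: "rep q 1 (cst \<i> * RB q a) v 0 = \<i> * Q * S * (v 1 - k * v (-1)) + t * v 0"
    unfolding RB_spin_1 Q_def[symmetric] t_def[symmetric]
    using pw q by (simp add: coef_spin_1 S_def k_def algebra_simps power2_eq_square)
  have Rm: "rep q 1 (cst \<i> * RB q a) v (-1) = \<i> * Q * k * S * v 0 + t * k\<^sup>2 * v (-1)"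
    unfolding RB_spin_1 Q_def[symmetric] t_def[symmetric]
    using out[of "-2"] pw q by (simp add: coef_spin_1 S_def k_def algebra_simps power2_eq_square)
  have Ro: "rep q 1 (cst \<i> * RB q a) v j = t * v j" if "j \<notin> {-1, 0, 1}" for j
    using rep_Hs[OF spins_1 v, of q "cst \<i> * RB q a"] out[OF that] that by (simp add: Hs_def wts_1)
  have e0: "\<i> * Q * S * (v 1 - k * v (-1)) + t * v 0 = t * v 0 \<longleftrightarrow> v (-1) = v 1 / k"
    using Q by (auto simp: field_simps)
  have e1: "- (\<i> * Q * S * v 0) + t * v 1 / k\<^sup>2 = t * v 1 \<longleftrightarrow> S * v 0 = - pcoef q a * (1 / k - k) * v 1"
  proof -
    have "- (\<i> * Q * S * v 0) + t * v 1 / k\<^sup>2 = t * v 1 \<longleftrightarrow>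
        (- \<i> * Q) * (S * v 0) = (- \<i> * Q) * (- pcoef q a * (1 / k - k) * v 1)"
    proof -
      have "(- \<i> * Q) * (- pcoef q a * (1 / k - k) * v 1) = - (t * (Q * Q) * (1 / k - k) * v 1)"
        by (simp add: pc algebra_simps)
      also have "\<dots> = t * v 1 - t * v 1 / k\<^sup>2"
        unfolding Q(1) using Q(3) by (simp add: field_simps power2_eq_square)
      finally show ?thesis by (auto simp: algebra_simps)
    qed
    then show ?thesis using Q(2) unfolding mult_cancel_left by simp
  qed
  have em: "\<i> * Q * k * S * v 0 + t * k\<^sup>2 * v (-1) = t * v (-1)"
    if "v (-1) = v 1 / k" "S * v 0 = - pcoef q a * (1 / k - k) * v 1"
  proof -
    have "\<i> * Q * k * S * v 0 = \<i> * Q * k * (S * v 0)" by simp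
    also have "\<dots> = - (\<i> * \<i>) * (t * (Q * Q) * k * (1 / k - k) * v 1)"
      unfolding that(2) pc by (simp only: mult_ac mult_minus_left mult_minus_right)
    also have "\<dots> = t * (Q * Q) * k * (1 / k - k) * v 1" by simp
    also have "\<dots> = t * (1 / k - k) * v 1" using Q by simp
    finally show ?thesis unfolding that(1) using Q(3) by (simp add: field_simps power2_eq_square)
  qed
  have "rep q 1 (cst \<i> * RB q a) v = (\<lambda>j. t * v j) \<longleftrightarrow>
      (\<forall>j\<in>{-1, 0, 1}. rep q 1 (cst \<i> * RB q a) v j = t * v j)"
    using Ro unfolding fun_eq_iff by blast
  also have "\<dots> \<longleftrightarrow> v (-1) = v 1 / k \<and> S * v 0 = - pcoef q a * (1 / k - k) * v 1"
    unfolding ball_simps ball_empty simp_thms R1 R0 Rm e0 e1 using em by blast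
  finally show ?thesis unfolding t_def k_def S_def .
qed

lemma spherical_vec_eta: "spherical_vec q a (eta q a 1 (qbr q a))" "eta q a 1 (qbr q a) \<in> Hs 1"
  "ipHs 1 (eta q a 1 (qbr q a)) (eta q a 1 (qbr q a)) = 1"
proof -
  define S where "S = complex_of_real (sqrt (qbr q 2))"
  \<comment> \<open>\<open>eta\<close> is a choice, so an eigenvector must be exhibited. With
    coordinate 1 at weight 1, the coordinates at -1 and 0 are forced to be \<open>1 / q\<close> and
    \<open>z\<close>; \<open>n\<close> is the squared norm and \<open>c\<close> normalises.\<close>
  define z where "z = - pcoef q a * (1 / of_real q - of_real q) / S"
  define n where "n = 1 + 1 / q\<^sup>2 + (cmod z)\<^sup>2"
  define c where "c = 1 / sqrt n"
  define w where "w = (\<lambda>j::real. if j = 1 then complex_of_real c else if j = 0 then z * of_real c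
    else if j = -1 then of_real (c / q) else 0)"
  have n: "n > 0" "c * c = 1 / n" using q by (auto simp: n_def c_def add_pos_nonneg)
  have w: "w \<in> Hs 1" by (auto simp: w_def Hs_def wts_1)
  have "ipHs 1 w w = of_real (c * c) * of_real n"
  proof -
    have "cnj z * z = of_real ((cmod z)\<^sup>2)"
      by (metis complex_norm_square mult.commute)
    then show ?thesis
      using q by (simp add: ipHs_def wts_1 w_def n_def algebra_simps power2_eq_square)
  qed
  then have w1: "ipHs 1 w w = 1"
    using n by (simp flip: of_real_mult)
  have "S \<noteq> 0" using sqrt_qbr_2 by (simp add: S_def)
  then have w2: "rep q 1 (cst \<i> * RB q a) w = (\<lambda>j. of_real (qbr q a) * w j)"
    unfolding spherical_vec_eigen[OF w] S_def[symmetric] by (simp add: w_def z_def)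
  define v where "v = eta q a 1 (qbr q a)"
  have v: "v \<in> Hs 1 \<and> ipHs 1 v v = 1 \<and> rep q 1 (cst \<i> * RB q a) v = (\<lambda>j. of_real (qbr q a) * v j)"
    unfolding v_def eta_def of_nat_1 by (rule someI[of _ w]) (simp add: w w1 w2)
  have eig: "v (-1) = v 1 / of_real q" "S * v 0 = - pcoef q a * (1 / of_real q - of_real q) * v 1"
    using v spherical_vec_eigen[of v a] by (auto simp: S_def)
  have "v 1 \<noteq> 0"
  proof
    assume "v 1 = 0"
    with eig \<open>S \<noteq> 0\<close> have "v (-1) = 0" "v 0 = 0" "v 1 = 0" by auto
    then have "ipHs 1 v v = 0" by (simp add: ipHs_def wts_1)
    with v show False by simp
  qed
  with eig show "spherical_vec q a (eta q a 1 (qbr q a))"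
    by (simp add: spherical_vec_def S_def v_def)
  show "eta q a 1 (qbr q a) \<in> Hs 1" "ipHs 1 (eta q a 1 (qbr q a)) (eta q a 1 (qbr q a)) = 1"
    using v by (simp_all add: v_def)
qed

context
  fixes a :: real and v :: "real \<Rightarrow> complex" and \<phi> :: "func \<Rightarrow> complex"
  assumes v: "spherical_vec q a v" and phi: "eps_derivation q a \<phi>"
begin

private definition "Z = fscale (1 / v (-1)) (sph q v (-1))"
private definition "A = sph q v 0 - fscale (v 0) aone"

private lemma v_nonzero: "v 1 \<noteq> 0" "v (-1) \<noteq> 0"
  using v q by (auto simp: spherical_vec_def)

private lemma Z: "Z \<in> podles q a" "has_weight q (-1) Z" "acounit Z = 1" "ract Z uE = 0"
proof -
  show "Z \<in> podles q a"
    unfolding Z_def using sph_podles[OF v, of "-1"] by (intro podles_closed[OF q]) auto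
  show "has_weight q (-1) Z"
    unfolding Z_def by (intro has_weight_closed has_weight_sph)
  show "acounit Z = 1"
    using v_nonzero by (simp add: Z_def acounit_simps acounit_sph)
  \<comment> \<open>Translation by \<open>e\<close> takes row -1 to row -2, which lies outside the
    spin-one ladder.\<close>
  have "tco q 1 (-2) j = 0" if "j \<in> {-1, 0, 1}" for j
    using that by (intro tco_eq_0 spins_1) (auto simp: wts_1)
  then show "ract Z uE = 0"
    by (simp add: Z_def sph_def act_simps ract_tco)
qed

text \<open>The ladder coefficient from row 0 to row -1, multiplied by the factor
  \<open>v (-1)\<close> that was divided out of \<open>Z\<close>.\<close>

private definition "kap = v (-1) * of_real (sqrt (qbr q 2))"

private lemma A: "A \<in> podles q a" "has_weight q 0 A" "acounit A = 0" "ract A uE = fscale kap Z" "kap \<noteq> 0"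
proof -
  show "A \<in> podles q a"
    unfolding A_def using sph_podles[OF v, of 0] aone_podles[OF q] by (intro podles_closed[OF q]) auto
  have "has_weight q 0 aone" using q by (simp add: has_weight_def aone_ract)
  then show "has_weight q 0 A"
    unfolding A_def by (intro has_weight_closed has_weight_sph)
  show "acounit A = 0"
    by (simp add: A_def acounit_simps acounit_sph)
  show "ract A uE = fscale kap Z"
    using v_nonzero
    by (simp add: A_def Z_def kap_def sph_def act_simps ract_tco aone_ract coef_spin_1 fs.scale_right_distrib mult_ac)
  show "kap \<noteq> 0"
    using v_nonzero sqrt_qbr_2 by (simp add: kap_def)
qed

private lemma phi_simps:
  "x \<in> podles q a \<Longrightarrow> y \<in> podles q a \<Longrightarrow> \<phi> (x + y) = \<phi> x + \<phi> y"
  "x \<in> podles q a \<Longrightarrow> y \<in> podles q a \<Longrightarrow> \<phi> (amul x y) = acounit x * \<phi> y + acounit y * \<phi> x"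
  "x \<in> podles q a \<Longrightarrow> \<phi> (fscale c x) = c * \<phi> x"
  using phi by (auto simp: eps_derivation_def)

private lemma phi_0: "\<phi> 0 = 0"
  using phi_simps(3)[OF podles_closed(4)[OF q], of 0] by simp

private lemma phi_aone: "\<phi> aone = 0"
proof -
  have "amul aone aone = aone" using amul_aone_left[OF lin_aone] .
  then show ?thesis using phi_simps(2)[OF aone_podles[OF q] aone_podles[OF q]] by simp
qed

text \<open>Translation by \<open>e\<close> kills \<open>Z\<close>, so every \<open>e\<close> passes
  over \<open>Z\<close> to \<open>y\<close>, picking up \<open>q^(-2)\<close> from the weight -1 of
  \<open>Z\<close>.\<close>

private lemma Z_mult: "amul Z y (uE ^ r) = of_real ((1 / q\<^sup>2) ^ r) * y (uE ^ r)"
proof (induction r arbitrary: y)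
  case 0
  show ?case using acounit_amul[of Z y] Z(3) by (simp add: acounit_def)
next
  case (Suc r)
  have "q powr (-2) = 1 / q\<^sup>2" using q by (simp add: powr_minus_divide)
  then show ?case
    using Z(2,4) unfolding apply_power_Suc amul_ract
    by (simp add: amul_simps has_weight_def Suc fscale_apply)
qed

text \<open>\<open>geo r\<close> is the sum of \<open>q^(-2 k)\<close> over \<open>k < r\<close>, an
  unnormalised \<open>q\<close>-integer.\<close>

private primrec geo :: "nat \<Rightarrow> real" where
  "geo 0 = 0"
| "geo (Suc r) = (1 / q\<^sup>2) ^ r + geo r"

private lemma geo_pos: "geo (Suc r) > 0"
  using q by (induction r) (auto intro: add_pos_pos)

text \<open>Exactly one \<open>e\<close> must hit \<open>A\<close>, turning it into
  \<open>kap\<close> times \<open>Z\<close>. Those before it pass over \<open>A\<close> with factor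
  1, those after it pass over \<open>Z\<close> with factor \<open>q^(-2)\<close> each; summing over
  the choices gives \<open>geo\<close>.\<close>

private lemma A_mult: "amul A y (uE ^ Suc r) = kap * of_real (geo (Suc r)) * y (uE ^ r)" "amul A y 1 = 0"
proof -
  show A1: "amul A y 1 = 0" for y
    using acounit_amul[of A y] A(3) by (simp add: acounit_def)
  have step: "amul A y (uE ^ Suc r) = kap * amul Z y (uE ^ r) + amul A (ract y uE) (uE ^ r)" for y r
    using A(2,4) q unfolding apply_power_Suc amul_ract
    by (simp add: amul_simps has_weight_def fscale_apply plus_fun_apply)
  show "amul A y (uE ^ Suc r) = kap * of_real (geo (Suc r)) * y (uE ^ r)"
  proof (induction r arbitrary: y)
    case 0
    show ?case unfolding step using A1[of "ract y uE"] Z_mult[of y 0] by simp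
  next
    case (Suc r)
    show ?case
      unfolding step[of _ "Suc r"] Suc Z_mult apply_power_Suc[symmetric]
      by (simp add: algebra_simps)
  qed
qed

private lemma Z_A_values: "Z (uE ^ 0) = 1" "Z (uE ^ Suc r) = 0" "A (uE ^ 0) = 0" "A (uE ^ Suc r) = kap * Z (uE ^ r)"
  using Z A unfolding apply_power_Suc by (simp_all add: acounit_def zero_fun_apply fscale_apply)

private lemma phi_A: "\<phi> A = 0"
proof -
  \<comment> \<open>Among the powers of \<open>e\<close>, both products are nonzero only at
    \<open>e\<close> itself, with value \<open>kap\<close>; the factor \<open>q^2\<close> offsets
    the \<open>q^(-2)\<close> of \<open>Z_mult\<close>.\<close>
  define x where "x = amul A Z - fscale (of_real (q\<^sup>2)) (amul Z A)"
  have "x = 0"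
  proof (rule podles_borel[OF q])
    show "x \<in> podles q a"
      unfolding x_def using A Z by (intro podles_closed[OF q] podles_mult[OF q])
    show "has_weight q (-1) x"
      unfolding x_def using has_weight_mult[OF A(2) Z(2)] has_weight_mult[OF Z(2) A(2)] by (intro has_weight_closed) auto
    show "x (uE ^ r) = 0" for r
    proof (cases r)
      case 0
      then show ?thesis
        using A_mult(2)[of Z] Z_mult[of A 0] Z_A_values(3) by (simp add: x_def minus_apply fscale_apply)
    next
      case (Suc r')
      have "x (uE ^ Suc r') = kap * of_real (geo (Suc r')) * Z (uE ^ r') -
          of_real (q\<^sup>2) * (of_real ((1 / q\<^sup>2) ^ Suc r') * (kap * Z (uE ^ r')))"
        by (simp only: x_def minus_apply fscale_apply A_mult Z_mult Z_A_values)
      also have "\<dots> = 0"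
      proof (cases r')
        case 0
        then show ?thesis using q Z_A_values(1) by simp
      next
        case (Suc r'')
        then show ?thesis by (simp only: Z_A_values mult_zero_right diff_self)
      qed
      finally show ?thesis using Suc by simp
    qed
  qed
  then have "amul A Z = fscale (of_real (q\<^sup>2)) (amul Z A)" by (simp add: x_def)
  then have "\<phi> (amul A Z) = \<phi> (fscale (of_real (q\<^sup>2)) (amul Z A))" by simp
  then have "\<phi> A = of_real (q\<^sup>2) * \<phi> A"
    using A Z by (simp add: phi_simps podles_mult[OF q])
  moreover have "complex_of_real (q\<^sup>2) \<noteq> 1"
    using q by (metis of_real_eq_1_iff power2_eq_1_iff less_irrefl neg_0_less_iff_less not_less_iff_gr_or_eq zero_less_one order_less_trans)
  ultimately show ?thesis by simp
qed

private abbreviation "zpow n \<equiv> (amul Z ^^ n)"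
private abbreviation "apow n \<equiv> ((amul A ^^ n) aone)"

private lemma aone_values: "aone (uE ^ 0) = 1" "aone (uE ^ Suc r) = 0"
  unfolding apply_power_Suc using acounit_aone by (simp_all add: acounit_def aone_ract zero_fun_apply)

text \<open>The last two conjuncts say that \<open>A^n\<close> has degree exactly \<open>n\<close>
  on the powers of \<open>e\<close>; they drive the elimination in
  \<open>phi_nonpos\<close>.\<close>

private lemma apow: "apow n \<in> podles q a \<and> has_weight q 0 (apow n) \<and> \<phi> (apow n) = 0 \<and>
    (\<forall>r>n. apow n (uE ^ r) = 0) \<and> apow n (uE ^ n) \<noteq> 0"
proof (induction n)
  case 0
  have "aone (uE ^ r) = 0" if "0 < r" for r
    using that aone_values(2) by (cases r) auto
  moreover have "has_weight q 0 aone" using q by (simp add: has_weight_def aone_ract)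
  ultimately show ?case
    using aone_values(1) by (simp add: aone_podles[OF q] phi_aone)
next
  case (Suc n)
  have "amul A (apow n) (uE ^ r) = 0" if "Suc n < r" for r
  proof -
    from that obtain r' where "r = Suc r'" "n < r'" by (cases r) auto
    with Suc show ?thesis by (simp only: A_mult) simp
  qed
  moreover have "amul A (apow n) (uE ^ Suc n) \<noteq> 0"
    using Suc A(5) less_imp_neq[OF geo_pos[of n]] by (simp only: A_mult) (simp del: geo.simps)
  moreover have "has_weight q 0 (amul A (apow n))"
    using has_weight_mult[OF A(2)] Suc by fastforce
  ultimately show ?case
    using Suc A phi_A by (simp add: podles_mult[OF q] phi_simps)
qed

private lemma zpow:
  "x \<in> podles q a \<Longrightarrow> zpow n x \<in> podles q a"
  "has_weight q j x \<Longrightarrow> has_weight q (j - real n) (zpow n x)"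
  "acounit (zpow n x) = acounit x"
  "x \<in> podles q a \<Longrightarrow> \<phi> (zpow n x) = \<phi> x + of_nat n * \<phi> Z * acounit x"
  "zpow n x (uE ^ r) = of_real ((1 / q\<^sup>2) ^ (n * r)) * x (uE ^ r)"
proof -
  show B: "zpow n x \<in> podles q a" if "x \<in> podles q a" for n
    using that Z by (induction n) (auto intro: podles_mult[OF q])
  show "has_weight q (j - real n) (zpow n x)" if "has_weight q j x"
  proof (induction n)
    case (Suc n)
    have "- 1 + (j - real n) = j - real (Suc n)" by simp
    with has_weight_mult[OF Z(2) Suc] show ?case by (simp only: funpow.simps o_apply)
  qed (use that in simp)
  show C: "acounit (zpow n x) = acounit x" for n
    by (induction n) (simp_all add: acounit_amul Z)
  show "\<phi> (zpow n x) = \<phi> x + of_nat n * \<phi> Z * acounit x" if "x \<in> podles q a"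
    by (induction n) (simp_all add: phi_simps that B C Z algebra_simps)
  show "zpow n x (uE ^ r) = of_real ((1 / q\<^sup>2) ^ (n * r)) * x (uE ^ r)"
    by (induction n) (simp_all add: Z_mult power_add)
qed

text \<open>Elimination of the top degree: the multiple of \<open>Z^n A^N\<close> that matches
  \<open>x\<close> at \<open>e^N\<close> is subtracted. The formula is linear in \<open>x\<close>
  and known for \<open>Z^n A^N\<close>; for \<open>N = 0\<close> the vector is zero by
  \<open>podles_borel\<close>.\<close>

private lemma phi_nonpos:
  "x \<in> podles q a \<Longrightarrow> has_weight q (- real n) x \<Longrightarrow> (\<And>r. N \<le> r \<Longrightarrow> x (uE ^ r) = 0) \<Longrightarrow>
     \<phi> x = of_nat n * \<phi> Z * acounit x"
proof (induction N arbitrary: x)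
  case 0
  then have "x = 0" by (intro podles_borel[OF q]) auto
  then show ?case by (simp add: phi_0 acounit_simps)
next
  case (Suc N)
  define y where "y = zpow n (apow N)"
  have y: "y \<in> podles q a" "has_weight q (- real n) y" "\<phi> y = of_nat n * \<phi> Z * acounit y"
    using apow[of N] zpow(1)[of "apow N" n] zpow(2)[of 0 "apow N" n] zpow(3)[of n "apow N"] zpow(4)[of "apow N" n]
    by (auto simp: y_def)
  have y0: "y (uE ^ N) \<noteq> 0" "\<And>r. N < r \<Longrightarrow> y (uE ^ r) = 0"
    using apow[of N] q by (auto simp: y_def zpow(5))
  define c where "c = x (uE ^ N) / y (uE ^ N)"
  define x' where "x' = x - fscale c y"
  have x': "x' \<in> podles q a" "has_weight q (- real n) x'"
    unfolding x'_def using Suc.prems y by (simp_all add: podles_closed[OF q] has_weight_closed)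
  have "x' (uE ^ r) = 0" if "N \<le> r" for r
    using y0 Suc.prems(3)[of r] that by (cases "r = N") (auto simp: x'_def c_def minus_apply fscale_apply)
  then have "\<phi> x' = of_nat n * \<phi> Z * acounit x'"
    using Suc.IH[OF x'] by blast
  moreover have "x = x' + fscale c y" by (simp add: x'_def)
  ultimately show ?case
    using x' y by (simp add: phi_simps podles_closed[OF q] acounit_simps algebra_simps)
qed

lemma derivation_weight:
  assumes x: "x \<in> podles q a" "has_weight q (of_int n) x"
  shows "\<phi> x = - of_int n * \<phi> (fscale (1 / v (-1)) (sph q v (-1))) * acounit x"
proof (cases "n \<le> 0")
  case True
  then obtain m where m: "n = - int m" by (metis nonneg_int_cases neg_0_le_iff_le minus_minus)
  obtain N where "\<And>r. N \<le> r \<Longrightarrow> x (uE ^ r) = 0"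
    using Oq_nilpotent[OF podles_Oq[OF q x(1)]] by blast
  from phi_nonpos[OF x(1) _ this, of m] x(2) show ?thesis
    by (simp add: m Z_def)
next
  case False
  then obtain m where m: "n = int m" by (metis nonneg_int_cases nle_le)
  \<comment> \<open>\<open>Z^m x\<close> has weight 0, where \<phi> vanishes. Expanding \<phi> on
    this product yields the formula for \<open>x\<close>.\<close>
  have z: "zpow m x \<in> podles q a" "has_weight q (- real 0) (zpow m x)"
    using zpow(1)[OF x(1), of m] zpow(2)[OF x(2), of m] by (auto simp: m)
  obtain N where "\<And>r. N \<le> r \<Longrightarrow> zpow m x (uE ^ r) = 0"
    using Oq_nilpotent[OF podles_Oq[OF q z(1)]] by blast
  from phi_nonpos[OF z this] zpow(4)[OF x(1), of m] show ?thesis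
    by (simp add: m Z_def eq_neg_iff_add_eq_0)
qed

end

end

section \<open>The *-structure and vanishing of derivations\<close>

lemma antihom_ext_mult: "antihom_ext \<phi> (g * h) = antihom_ext \<phi> h * antihom_ext \<phi> g"
proof (induction g rule: poly_mapping_induct_single)
  case zero
  show ?case by (simp add: antihom_ext_def)
next
  case (add g v c)
  have "antihom_ext \<phi> (Poly_Mapping.single v c * h) = antihom_ext \<phi> h * antihom_ext \<phi> (Poly_Mapping.single v c)"
  proof (induction h rule: poly_mapping_induct_single)
    case zero
    show ?case by (simp add: antihom_ext_def)
  next
    case (add h w d)
    have "cst (c * d) * (P * Q) = cst d * P * (cst c * Q)" for P Q :: ualg
      by (simp only: mult.assoc cst_left_commute[of P] mult.commute[of c d] cst_mult)
    with add show ?case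
      by (simp add: distrib_left distrib_right antihom_ext_add mult_single antihom_ext_single plus_word_def)
  qed
  with add show ?case by (simp add: distrib_left distrib_right antihom_ext_add)
qed

lemma ustar_add: "ustar (g + h) = ustar g + ustar h"
  unfolding ustar_def by (rule sum_keys_add) (simp add: cst_add algebra_simps)

lemma ustar_single: "ustar (Poly_Mapping.single w c) = cst (cnj c) * prod_list (map star_gen (rev (letters w)))"
  by (cases "c = 0") (simp_all add: ustar_def)

lemma ustar_mult: "ustar (g * h) = ustar h * ustar g"
proof (induction g rule: poly_mapping_induct_single)
  case zero
  show ?case by (simp add: ustar_def)
next
  case (add g v c)
  have "ustar (Poly_Mapping.single v c * h) = ustar h * ustar (Poly_Mapping.single v c)"
  proof (induction h rule: poly_mapping_induct_single)
    case zero
    show ?case by (simp add: ustar_def)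
  next
    case (add h w d)
    have "cst (cnj c * cnj d) * (P * Q) = cst (cnj d) * P * (cst (cnj c) * Q)" for P Q :: ualg
      by (simp only: mult.assoc cst_left_commute[of P] mult.commute[of "cnj c" "cnj d"] cst_mult)
    with add show ?case
      by (simp add: distrib_left distrib_right ustar_add mult_single ustar_single plus_word_def)
  qed
  with add show ?case by (simp add: distrib_left distrib_right ustar_add)
qed

lemma ustar_uminus: "ustar (- h) = - ustar h"
  using ustar_add[of h "- h"] by (simp add: ustar_def add_eq_0_iff)

text \<open>Antipode and star both reverse products, so the composite is multiplicative and
  conjugate-linear. Hence \<open>astar\<close> exchanges translations by \<open>g\<close> with
  translations by its image.\<close>

lemma ustar_antipode:
  "ustar (antipode (g + h)) = ustar (antipode g) + ustar (antipode h)"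
  "ustar (antipode (g * h)) = ustar (antipode g) * ustar (antipode h)"
  "ustar (antipode (cst c)) = cst (cnj c)"
  "ustar (antipode uK) = uKi" "ustar (antipode uKi) = uK"
  "ustar (antipode uE) = - (uF * uK * uKi)" "ustar (antipode uF) = - (uK * (uKi * uE))"
proof -
  have g: "antipode (gel g) = S_gen g" "ustar (gel g) = star_gen g" for g
    by (simp_all add: antipode_def gel_def antihom_ext_single ustar_single)
  show "ustar (antipode (g + h)) = ustar (antipode g) + ustar (antipode h)"
    "ustar (antipode (g * h)) = ustar (antipode g) * ustar (antipode h)"
    by (simp_all add: antipode_def antihom_ext_add antihom_ext_mult ustar_add ustar_mult)
  have "ustar (cst c) = cst (cnj c)"
    by (simp add: cst_def ustar_single zero_word_def flip: single_0_1_word)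
  moreover have "antipode (cst c) = cst c"
    by (simp add: cst_def antipode_def antihom_ext_single zero_word_def flip: single_0_1_word)
  ultimately show "ustar (antipode (cst c)) = cst (cnj c)" by simp
  show "ustar (antipode uK) = uKi" "ustar (antipode uKi) = uK"
    "ustar (antipode uE) = - (uF * uK * uKi)" "ustar (antipode uF) = - (uK * (uKi * uE))"
    by (simp_all add: g ustar_uminus ustar_mult)
qed

lemma lact_uminus: "lact g (- x) = - lact g x"
  by (simp add: lact_def fun_eq_iff uminus_apply)

lemma lin_astar: "lin x \<Longrightarrow> lin (astar x)"
  by (simp add: lin_def astar_def ustar_antipode)

lemma lact_astar: "lact g (astar x) = astar (lact (ustar (antipode g)) x)"
  and ract_astar: "ract (astar x) g = astar (ract x (ustar (antipode g)))"
  by (simp_all add: lact_def ract_def astar_def ustar_antipode fun_eq_iff)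

lemma astar_simps: "astar (x + y) = astar x + astar y" "astar (fscale c x) = fscale (cnj c) (astar x)"
  "astar (x - y) = astar x - astar y" "astar (- x) = - astar x" "astar 0 = 0"
  by (simp_all add: astar_def fscale_def fun_eq_iff plus_fun_apply minus_apply uminus_apply zero_fun_apply)

lemma acounit_astar: "acounit (astar x) = cnj (acounit x)"
  using ustar_antipode(3)[of 1] by (simp add: acounit_def astar_def)

context
  fixes q :: real
  assumes q: "0 < q" "q < 1"
begin

text \<open>The image of \<open>e\<close> under antipode and star is \<open>- f k k^(-1)\<close> in
  \<open>ualg\<close>. The factor \<open>k k^(-1)\<close> disappears only on
  \<open>Oq\<close>.\<close>

lemma lact_astar_gen:
  assumes x: "x \<in> Oq q"
  shows "lact uK (astar x) = astar (lact uKi x)" "lact uKi (astar x) = astar (lact uK x)"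
    "lact uE (astar x) = - astar (lact uF x)" "lact uF (astar x) = - astar (lact uE x)"
    "ract (astar x) uK = astar (ract x uKi)"
proof -
  note rels = Oq_lact_rels[OF q x] Oq_lact_rels[OF q Oq_lact_gel[OF x, of GE]]
  show "lact uK (astar x) = astar (lact uKi x)" "lact uKi (astar x) = astar (lact uK x)"
    "ract (astar x) uK = astar (ract x uKi)"
    by (simp_all add: lact_astar ract_astar ustar_antipode)
  show "lact uE (astar x) = - astar (lact uF x)" "lact uF (astar x) = - astar (lact uE x)"
    by (simp_all add: lact_astar ustar_antipode lact_arg[OF lin_Oq[OF x]] astar_simps
        rels flip: lact_lact)
qed

text \<open>The factor is \<open>(- q)\<^sup>i\<^sup>-\<^sup>j\<close>, written with real exponents; \<open>i - j\<close> is an integer.\<close>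
lemma astar_tco:
  assumes s: "s \<in> spins" and i: "i \<in> wts s" and j: "j \<in> wts s"
  shows "astar (tco q s i j) = fscale (of_real (q powr (i - j) * cos (pi * (i - j)))) (tco q s (- i) (- j))"
    (is "?L j = fscale (of_real (?k j)) (?R j)")
proof (rule lin_eqI)
  \<comment> \<open>Lowering \<open>j\<close> multiplies the factor by \<open>- q\<close>. The sign
    absorbs that of \<open>lact_astar_gen\<close>, and \<open>q\<close> is the ratio of ladder
    coefficients in \<open>ef\<close>.\<close>
  have rec: "?k (j - 1) = - q * ?k j" for j
  proof -
    have "q powr (i - (j - 1)) = q * q powr (i - j)"
      using q powr_add[of q 1 "i - j"] by (simp add: algebra_simps)
    moreover have "cos (pi * (i - (j - 1))) = - cos (pi * (i - j))"
      using cos_periodic_pi[of "pi * (i - j)"] by (simp add: algebra_simps)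
    ultimately show ?thesis by simp
  qed
  have ef: "e_coef q s (- j) = q * f_coef q s j" for j
    using q powr_add[of q "- j" 1] by (simp add: e_coef_def f_coef_def mult.commute)
  fix w :: word
  have "?L j (Poly_Mapping.single (Word ws) 1) = of_real (?k j) * ?R j (Poly_Mapping.single (Word ws) 1)" for ws
    using j
  proof (induction ws arbitrary: j rule: rev_induct)
    case Nil
    have "acounit (?L j) = of_real (?k j) * acounit (?R j)"
      using q by (simp add: acounit_astar acounit_tco)
    then show ?case by (simp add: acounit_def single_0_1_word)
  next
    case (snoc g ws)
    let ?w = "Poly_Mapping.single (Word ws) 1 :: ualg"
    note here = snoc.IH[OF snoc.prems]
    note L = lact_astar_gen[OF Oq_tco[OF s i snoc.prems]]
    have down: "of_real (f_coef q s j) * ?L (j - 1) ?w = of_real (f_coef q s j) * (of_real (?k (j - 1)) * ?R (j - 1) ?w)"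
      using snoc.IH[of "j - 1"] wts_pred[OF s snoc.prems] by (cases "j = - s") (auto simp: coef_boundary)
    have up: "of_real (e_coef q s j) * ?L (j + 1) ?w = of_real (e_coef q s j) * (of_real (?k (j + 1)) * ?R (j + 1) ?w)"
      using snoc.IH[of "j + 1"] wts_Suc[OF s snoc.prems] by (cases "j = s") (auto simp: coef_boundary)
    show ?case unfolding single_snoc_apply
    proof (cases g)
      case GK
      then show "lact (gel g) (?L j) ?w = of_real (?k j) * lact (gel g) (?R j) ?w"
        using here by (simp add: L lact_tco astar_simps fscale_apply)
    next
      case GKi
      then show "lact (gel g) (?L j) ?w = of_real (?k j) * lact (gel g) (?R j) ?w"
        using here by (simp add: L lact_tco astar_simps fscale_apply)
    next
      case GE
      have "lact uE (?L j) ?w = - (of_real (f_coef q s j) * ?L (j - 1) ?w)"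
        by (simp add: L lact_tco astar_simps fscale_apply uminus_apply)
      also have "\<dots> = of_real (?k j) * (of_real (e_coef q s (- j)) * ?R (j - 1) ?w)"
        unfolding down rec ef by simp
      also have "\<dots> = of_real (?k j) * lact uE (?R j) ?w"
        by (simp add: lact_tco fscale_apply)
      finally show "lact (gel g) (?L j) ?w = of_real (?k j) * lact (gel g) (?R j) ?w"
        using GE by simp
    next
      case GF
      have "lact uF (?L j) ?w = - (of_real (e_coef q s j) * ?L (j + 1) ?w)"
        by (simp add: L lact_tco astar_simps fscale_apply uminus_apply)
      also have "\<dots> = of_real (?k j) * (of_real (f_coef q s (- j)) * ?R (j + 1) ?w)"
        unfolding up using rec[of "j + 1"] ef[of "- j"] by simp
      also have "\<dots> = of_real (?k j) * lact uF (?R j) ?w"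
        by (simp add: lact_tco fscale_apply)
      finally show "lact (gel g) (?L j) ?w = of_real (?k j) * lact (gel g) (?R j) ?w"
        using GF by simp
    qed
  qed
  from this[of "letters w"]
  show "?L j (Poly_Mapping.single w 1) = fscale (of_real (?k j)) (?R j) (Poly_Mapping.single w 1)"
    by (simp add: fscale_apply)
qed (intro lin_astar lin_fscale lin_tco)+

lemma Oq_astar: "x \<in> Oq q \<Longrightarrow> astar x \<in> Oq q"
proof (induction rule: Oq_induct)
  case (tco s i j)
  then show ?case by (simp add: astar_tco Oq_closed Oq_tco wts_uminus)
qed (simp_all add: astar_simps Oq_closed)

text \<open>The star exchanges \<open>e\<close> with \<open>- f\<close> and \<open>k\<close> with
  its inverse, and \<open>pcoef\<close> is purely imaginary. So the sphere equation, translated by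
  \<open>k\<close>, is carried to itself.\<close>

lemma podles_astar: "x \<in> podles q a \<Longrightarrow> astar x \<in> podles q a"
proof -
  assume x: "x \<in> podles q a"
  have xO: "x \<in> Oq q" by (rule podles_Oq[OF q x])
  have c: "cnj (pcoef q a) = - pcoef q a" by (simp add: pcoef_def)
  have "lact uK (lact uF x) = lact uE x + fscale (pcoef q a) (x - lact uK x)"
    using x Oq_lact_rels(1)[OF q xO] Oq_lact_rels(1)[OF q Oq_lact_gel[OF xO, of GE]]
    by (simp add: podles_iff[OF q] act_simps)
  then have "astar (lact uK (lact uF x)) = astar (lact uE x) - fscale (pcoef q a) (astar x - astar (lact uK x))"
    by (simp add: astar_simps c)
  then show ?thesis
    unfolding podles_iff[OF q] using xO
    by (simp add: Oq_astar lact_astar_gen Oq_lact_gel act_simps lact_uminus fs.scale_right_diff_distrib)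
qed

lemma has_weight_astar: "x \<in> Oq q \<Longrightarrow> has_weight q j x \<Longrightarrow> has_weight q (- j) (astar x)"
  unfolding has_weight_def[of q "- j"] by (simp add: lact_astar_gen has_weight_uKi[OF q] astar_simps)

lemma u1_eq:
  fixes a :: real
  defines "v \<equiv> eta q a 1 (qbr q a)"
  shows "u1 q a = (\<Sum>i\<in>{-1, 0, 1}. fscale (cnj (v i)) (sph q v i))"
  unfolding u1_def v_def[symmetric] using spherical_vec_eta(2)[OF q, of a]
  by (simp add: mcoef_sph v_def)

lemma u1_podles: "u1 q a \<in> podles q a" "acounit (u1 q a) = 1"
proof -
  define v where "v = eta q a 1 (qbr q a)"
  show "u1 q a \<in> podles q a"
    unfolding u1_eq using sph_podles[OF q spherical_vec_eta(1)[OF q]] by (intro podles_closed[OF q]) auto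
  have "ipHs 1 v v = 1" using spherical_vec_eta(3)[OF q] by (simp add: v_def)
  then show "acounit (u1 q a) = 1"
    unfolding u1_eq v_def[symmetric]
    by (simp add: acounit_simps acounit_sph ipHs_def wts_1)
qed

text \<open>The witness is \<open>x\<close> translated \<open>r\<close> times by \<open>e\<close>.
  With \<open>podles_borel\<close> this gives each nonzero weight vector a companion of nonzero
  counit whose weight differs by an integer.\<close>

lemma podles_shift:
  "x \<in> podles q a \<Longrightarrow> has_weight q j x \<Longrightarrow>
    \<exists>y\<in>podles q a. has_weight q (j - real r) y \<and> acounit y = x (uE ^ r)"
proof (induction r arbitrary: x j)
  case 0
  then show ?case by (auto simp: acounit_def)
next
  case (Suc r)
  have "\<exists>y\<in>podles q a. has_weight q (j - 1 - real r) y \<and> acounit y = ract x uE (uE ^ r)"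
    using Suc by (intro Suc.IH podles_ract[OF q] has_weight_uE[OF q] podles_Oq[OF q])
  then show ?case by (simp only: apply_power_Suc of_nat_Suc diff_diff_eq add.commute)
qed

lemma derivation_zero:
  assumes phi: "eps_derivation q a \<phi>" and w: "w = u1 q a \<or> w = astar (u1 q a)" and "\<phi> w = 0"
    and x: "x \<in> podles q a"
  shows "\<phi> x = 0"
proof -
  define v where "v = eta q a 1 (qbr q a)"
  have v: "spherical_vec q a v" using spherical_vec_eta(1)[OF q] by (simp add: v_def)
  define zeta where "zeta = \<phi> (fscale (1 / v (-1)) (sph q v (-1)))"
  have ph: "\<phi> (x + y) = \<phi> x + \<phi> y" "\<phi> (amul x y) = acounit x * \<phi> y + acounit y * \<phi> x"
    if "x \<in> podles q a" "y \<in> podles q a" for x y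
    using phi that by (auto simp: eps_derivation_def)
  have ph_scale: "\<phi> (fscale c x) = c * \<phi> x" if "x \<in> podles q a" for x c
    using phi that by (auto simp: eps_derivation_def)
  have wt: "\<phi> x = - of_int n * zeta * acounit x" if "x \<in> podles q a" "has_weight q (of_int n) x" for x n
    unfolding zeta_def by (rule derivation_weight[OF q v phi that])
  have sph: "sph q v i \<in> podles q a" if "i \<in> {-1, 0, 1}" for i
    using sph_podles[OF q v that] .
  have 1: "\<phi> (sph q v (-1)) = zeta * v (-1)" "\<phi> (sph q v 0) = 0" "\<phi> (sph q v 1) = - zeta * v 1"
    using wt[OF sph, of "-1" "-1"] wt[OF sph, of 0 0] wt[OF sph, of 1 1]
    by (simp_all add: has_weight_sph[of q] acounit_sph has_weight_sph[of q 0, simplified])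
  have 2: "\<phi> (astar (sph q v (-1))) = - zeta * cnj (v (-1))" "\<phi> (astar (sph q v 0)) = 0"
    "\<phi> (astar (sph q v 1)) = zeta * cnj (v 1)"
    using wt[OF podles_astar[OF sph], of "-1" 1] wt[OF podles_astar[OF sph], of 0 0]
      wt[OF podles_astar[OF sph], of 1 "-1"]
      has_weight_astar[OF podles_Oq[OF q sph] has_weight_sph, of "-1"] has_weight_astar[OF podles_Oq[OF q sph] has_weight_sph, of 0]
      has_weight_astar[OF podles_Oq[OF q sph] has_weight_sph, of 1]
    by (simp_all add: acounit_astar acounit_sph)
  have n1: "cnj (v 1) * v 1 = of_real ((cmod (v 1))\<^sup>2)"
    by (metis complex_norm_square mult.commute)
  have "cnj (v (-1)) * v (-1) = cnj (v 1) * v 1 / (of_real q)\<^sup>2"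
    using v by (simp add: spherical_vec_def power2_eq_square)
  then have n: "cnj (v (-1)) * v (-1) = of_real ((cmod (v 1))\<^sup>2 / q\<^sup>2)" "cnj (v 1) * v 1 = of_real ((cmod (v 1))\<^sup>2)"
    unfolding n1 by simp_all
  have "\<phi> (u1 q a) = zeta * (cnj (v (-1)) * v (-1) - cnj (v 1) * v 1)"
    unfolding u1_eq v_def[symmetric] using sph
    by (simp add: ph ph_scale podles_closed[OF q] 1 algebra_simps)
  moreover have "\<phi> (astar (u1 q a)) = - zeta * (cnj (v (-1)) * v (-1) - cnj (v 1) * v 1)"
    unfolding u1_eq v_def[symmetric] using sph
    by (simp add: astar_simps ph ph_scale podles_closed[OF q] podles_astar 2 algebra_simps)
  \<comment> \<open>Both candidates for \<open>w\<close> give the same expression up to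
    sign.\<close>
  ultimately have "zeta * of_real ((cmod (v 1))\<^sup>2 / q\<^sup>2 - (cmod (v 1))\<^sup>2) = 0"
    using w \<open>\<phi> w = 0\<close> unfolding n by auto
  moreover have "(cmod (v 1))\<^sup>2 / q\<^sup>2 - (cmod (v 1))\<^sup>2 \<noteq> 0"
  proof -
    have "q\<^sup>2 < 1" using q by (simp add: power_less_one_iff)
    moreover have "cmod (v 1) \<noteq> 0" using v by (simp add: spherical_vec_def)
    ultimately show ?thesis using q by (simp add: field_simps)
  qed
  ultimately have zeta: "zeta = 0" unfolding mult_eq_0_iff of_real_eq_0_iff by blast
  have even: "\<phi> y = 0" if "y \<in> podles q a" "has_weight q j y" "j \<in> \<int>" for y j
    using wt[of y "\<lfloor>j\<rfloor>"] that zeta by (auto elim!: Ints_cases)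
  \<comment> \<open>Both \<open>z z\<close> and \<open>y z\<close> have integer weight, so \<phi>
    vanishes on them. The first product gives \<open>\<phi> z = 0\<close> since the counit of
    \<open>z\<close> is nonzero, and the second then gives \<open>\<phi> y = 0\<close>.\<close>
  have half: "\<phi> y = 0" if y: "y \<in> podles q a" "has_weight q j y" "2 * j \<in> \<int>" for y j
  proof (cases "y = 0")
    case True
    then show ?thesis using ph_scale[OF y(1), of 0] by simp
  next
    case False
    then obtain r where r: "y (uE ^ r) \<noteq> 0" using podles_borel[OF q y(1,2)] by blast
    obtain z where z: "z \<in> podles q a" "has_weight q (j - real r) z" "acounit z \<noteq> 0"
      using podles_shift[OF y(1,2), of r] r by auto
    have "j - real r + (j - real r) = 2 * j - of_nat (2 * r)" "j + (j - real r) = 2 * j - of_nat r"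
      by simp_all
    then have int: "j - real r + (j - real r) \<in> \<int>" "j + (j - real r) \<in> \<int>"
      using y(3) by (metis Ints_diff Ints_of_nat)+
    have "\<phi> (amul z z) = 0" "\<phi> (amul y z) = 0"
      using even[OF podles_mult[OF q z(1) z(1)] has_weight_mult[OF z(2) z(2)] int(1)]
        even[OF podles_mult[OF q y(1) z(1)] has_weight_mult[OF y(2) z(2)] int(2)] .
    then show ?thesis using y z by (simp add: ph)
  qed
  from podles_weight_decomp[OF q x] obtain J f where f: "finite J"
    "\<forall>j\<in>J. 2 * j \<in> \<int> \<and> f j \<in> podles q a \<and> has_weight q j (f j)" "x = (\<Sum>j\<in>J. f j)" by blast
  have "\<phi> (\<Sum>j\<in>K. f j) = 0" if "K \<subseteq> J" for K
    using finite_subset[OF that f(1)] that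
  proof (induction K rule: finite_induct)
    case empty
    show ?case using ph_scale[OF podles_closed(4)[OF q], of 0] by simp
  next
    case (insert k K)
    then have "(\<Sum>j\<in>K. f j) \<in> podles q a" "f k \<in> podles q a" "\<phi> (f k) = 0"
      using f(2) half by (auto intro!: podles_closed[OF q])
    with insert show ?case by (simp add: ph)
  qed
  then show ?thesis using f(3) by simp
qed

end

section \<open>The Gaussian subspace\<close>

context
  fixes scl :: "complex \<Rightarrow> 'v::ab_group_add \<Rightarrow> 'v" and ip :: "'v \<Rightarrow> 'v \<Rightarrow> complex"
  assumes vs: "vector_space scl" and ip: "inner_product_on scl UNIV ip"
begin

lemma ip_add: "ip u (v + w) = ip u v + ip u w"
  using ip[unfolded inner_product_on_def, THEN conjunct1] by blast

lemma ip_scl: "ip u (scl c v) = c * ip u v"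
  using ip[unfolded inner_product_on_def, THEN conjunct2, THEN conjunct1] by blast

lemma ip_cnj: "ip v u = cnj (ip u v)"
  using ip[unfolded inner_product_on_def, THEN conjunct2, THEN conjunct2, THEN conjunct1] by blast

lemma ip_pos: "v \<noteq> 0 \<Longrightarrow> Re (ip v v) > 0"
  using ip[unfolded inner_product_on_def, THEN conjunct2, THEN conjunct2, THEN conjunct2] by blast

lemma ip_0: "ip u 0 = 0" "ip 0 u = 0"
  using ip_add[of u 0 0] ip_cnj[of 0 u] by simp_all

lemma ip_diff: "ip u (v - w) = ip u v - ip u w" "ip (v - w) u = ip v u - ip w u"
proof -
  show *: "ip u (v - w) = ip u v - ip u w" for u v w
    using ip_add[of u "v - w" w] by simp
  show "ip (v - w) u = ip v u - ip w u"
    using *[of u v w] ip_cnj[of "v - w" u] ip_cnj[of v u] ip_cnj[of w u] by simp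
qed

text \<open>By Pythagoras every \<open>d\<close> orthogonal to \<open>h\<close> has distance at
  least the norm of \<open>h\<close> from it, which contradicts density at that radius.\<close>

lemma orthogonal_to_dense_eq_0:
  assumes dense: "\<And>\<epsilon>. 0 < \<epsilon> \<Longrightarrow> \<exists>d\<in>D. ipnorm ip (h - d) < \<epsilon>" and orth: "\<And>d. d \<in> D \<Longrightarrow> ip h d = 0"
  shows "h = 0"
proof (rule ccontr)
  assume "h \<noteq> 0"
  then have pos: "Re (ip h h) > 0" by (rule ip_pos)
  then obtain d where d: "d \<in> D" "ipnorm ip (h - d) < sqrt (Re (ip h h))"
    using dense[of "sqrt (Re (ip h h))"] by auto
  have "ip d h = 0" using ip_cnj[of d h] orth[OF d(1)] by simp
  then have "Re (ip (h - d) (h - d)) = Re (ip h h) + Re (ip d d)"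
    using orth[OF d(1)] by (simp add: ip_diff)
  moreover have "Re (ip d d) \<ge> 0" using ip_pos[of d] ip_0 by (cases "d = 0") auto
  ultimately show False using d(2) by (simp add: ipnorm_def)
qed

lemma orth_projection_0: "orth_projection ip {0} h = 0"
  unfolding orth_projection_def orth_complement_def by (rule the_equality) (auto simp: ip_0)

end

theorem proposition5p9:
  fixes q a :: real
    and w :: func
    and L :: "real \<Rightarrow> ('l::ab_group_add) bimodule"
    and ipL :: "real \<Rightarrow> 'l \<Rightarrow> 'l \<Rightarrow> complex"
    and eL :: "real \<Rightarrow> 'l"
    and M :: "('m::ab_group_add) bimodule"
    and e\<^sub>a :: 'm
    and ip :: "'m \<Rightarrow> 'm \<Rightarrow> complex"
    and scH :: "complex \<Rightarrow> 'h::ab_group_add \<Rightarrow> 'h"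
    and ipH :: "'h \<Rightarrow> 'h \<Rightarrow> complex"
    and \<iota> :: "'m \<Rightarrow> 'h"
  assumes "0 < q" and "q < 1"
    and "w = u1 q a \<or> w = astar (u1 q a)"
    and "\<And>lam. 0 < lam \<Longrightarrow> lam < q + 1 / q \<Longrightarrow> is_L_plus q a w lam (L lam) (ipL lam) (eL lam)"
    and "is_M_module q a w M e\<^sub>a"
    and "is_limit_inner_product q a L ipL eL M e\<^sub>a ip"
    and "hilbert_completion (sc M) (D2_sum q a M e\<^sub>a) ip scH ipH \<iota>"
  shows "purely_non_gaussian (podles q a) M (cocycle M e\<^sub>a) (D2_sum q a M e\<^sub>a) ipH \<iota>"
proof -
  note q = assms(1,2)
  let ?B = "podles q a" and ?D = "D2_sum q a M e\<^sub>a" and ?C = "cocycle M e\<^sub>a"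
  have we: "bact M w e\<^sub>a = e\<^sub>a" and bm: "bowtie_module q a M"
    using assms(5) by (simp_all add: is_M_module_def)
  note bm = bm[unfolded bowtie_module_def]
  have mod: "vector_space (sc M)"
    "\<And>b c v. b \<in> ?B \<Longrightarrow> c \<in> ?B \<Longrightarrow> bact M (b + c) v = bact M b v + bact M c v"
    "\<And>b z v. b \<in> ?B \<Longrightarrow> bact M (fscale z b) v = sc M z (bact M b v)"
    "\<And>v. bact M aone v = v"
    "\<And>b c v. b \<in> ?B \<Longrightarrow> c \<in> ?B \<Longrightarrow> bact M (amul b c) v = bact M b (bact M c v)"
    subgoal by (rule bm[THEN conjunct1])
    subgoal using bm[THEN conjunct2, THEN conjunct2, THEN conjunct1] by blast
    subgoal using bm[THEN conjunct2, THEN conjunct2, THEN conjunct2, THEN conjunct1] by blast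
    subgoal using bm[THEN conjunct2, THEN conjunct2, THEN conjunct2, THEN conjunct2, THEN conjunct1] by blast
    subgoal using bm[THEN conjunct2, THEN conjunct2, THEN conjunct2, THEN conjunct2, THEN conjunct2, THEN conjunct1] by blast
    done
  have linear: "\<And>b. b \<in> ?B \<Longrightarrow> Vector_Spaces.linear (sc M) (sc M) (bact M b)"
    using bm[THEN conjunct2, THEN conjunct1] by blast
  have H: "vector_space scH" "inner_product_on scH UNIV ipH"
    and iota: "\<And>v w. v \<in> ?D \<Longrightarrow> w \<in> ?D \<Longrightarrow> \<iota> (v + w) = \<iota> v + \<iota> w"
      "\<And>v c. v \<in> ?D \<Longrightarrow> \<iota> (sc M c v) = scH c (\<iota> v)"
    and dense: "\<And>h \<epsilon>. 0 < \<epsilon> \<Longrightarrow> \<exists>v\<in>?D. ipnorm ipH (h - \<iota> v) < \<epsilon>"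
    using assms(7) by (simp_all add: hilbert_completion_def hilbert_space_def)
  interpret M: vector_space "sc M" by (fact mod)
  interpret H: vector_space scH by (fact H)
  have lin: "bact M b (u + v) = bact M b u + bact M b v" "bact M b (sc M c u) = sc M c (bact M b u)"
    if "b \<in> ?B" for b u v c
    using linear[OF that] by (simp_all add: Vector_Spaces.linear_iff)
  have D: "bact M b e\<^sub>a \<in> ?D" if "b \<in> ?B" "acounit b = 0" for b
    using that unfolding D2_sum_def by blast
  have sub: "bact M (b - c) v = bact M b v - bact M c v" if "b \<in> ?B" "c \<in> ?B" for b c v
    using mod(2)[OF podles_closed(2)[OF q that] that(2), of v] by simp
  \<comment> \<open>\<open>r b\<close> is the part of \<open>b\<close> in the kernel of the counit
    and sends \<open>e\<^sub>a\<close> to \<open>?C b\<close>. It places the values of the cocycle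
    in \<open>?D\<close>, the only set on which \<iota> is known to be linear.\<close>
  define r where "r b = b - fscale (acounit b) aone" for b
  have r: "r b \<in> ?B" "acounit (r b) = 0" "bact M (r b) e\<^sub>a = ?C b" if "b \<in> ?B" for b
    using that aone_podles[OF q]
    by (simp_all add: r_def podles_closed[OF q] acounit_simps sub mod cocycle_def)
  have CD: "?C b \<in> ?D" if "b \<in> ?B" for b
    using D[of "r b"] r[OF that] by simp
  have scD: "sc M z (?C b) \<in> ?D" if "b \<in> ?B" for b z
    using D[of "fscale z (r b)"] r[OF that] by (simp add: podles_closed[OF q] acounit_simps mod)
  have bCD: "bact M b (?C c) \<in> ?D" "bact M b (?C c) = ?C (amul b c) - sc M (acounit c) (?C b)"
    if "b \<in> ?B" "c \<in> ?B" for b c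
  proof -
    show "bact M b (?C c) \<in> ?D"
      using D[of "amul b (r c)"] r[OF that(2)] that by (simp add: podles_mult[OF q] acounit_amul mod)
    have "bact M b (bact M c e\<^sub>a) = bact M b (?C c) + sc M (acounit c) (bact M b e\<^sub>a)"
      using lin(1)[OF that(1), where u = "?C c" and v = "sc M (acounit c) e\<^sub>a"] lin(2)[OF that(1)]
      by (simp add: cocycle_def)
    then show "bact M b (?C c) = ?C (amul b c) - sc M (acounit c) (?C b)"
      using that by (simp add: cocycle_def mod acounit_amul M.scale_right_diff_distrib mult.commute)
  qed
  have "gaussian_space ?B M ?C ipH \<iota> = {0}"
  proof
    show "gaussian_space ?B M ?C ipH \<iota> \<subseteq> {0}"
    proof
      fix h assume h: "h \<in> gaussian_space ?B M ?C ipH \<iota>"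
      define \<phi> where "\<phi> b = ipH h (\<iota> (?C b))" for b
      \<comment> \<open>Orthogonality to the Gaussian generators replaces the action of
        \<open>b\<close> by its counit, turning the cocycle identity into the Leibniz rule at the
        counit.\<close>
      have gauss: "ipH h (\<iota> (bact M b (?C c))) = acounit b * \<phi> c" if "b \<in> ?B" "c \<in> ?B" for b c
      proof -
        have "ipH (\<iota> (bact M b (?C c) - sc M (acounit b) (?C c))) h = 0"
          using h that unfolding gaussian_space_def orth_complement_def by blast
        then have "ipH h (\<iota> (bact M b (?C c) + sc M (- acounit b) (?C c))) = 0"
          using ip_cnj[OF H, of h] by simp
        moreover note scD[OF that(2), of "- acounit b"]
        ultimately show ?thesis
          using CD[OF that(2)] bCD(1)[OF that]
          by (simp add: iota ip_diff[OF H] ip_scl[OF H] \<phi>_def del: M.scale_minus_left)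
      qed
      have "eps_derivation q a \<phi>"
        unfolding eps_derivation_def
      proof (intro conjI ballI allI)
        fix x y assume xy: "x \<in> ?B" "y \<in> ?B"
        have "?C (x + y) = ?C x + ?C y"
          using xy by (simp add: cocycle_def mod acounit_simps M.scale_left_distrib)
        then show "\<phi> (x + y) = \<phi> x + \<phi> y"
          using xy CD by (simp add: \<phi>_def iota ip_add[OF H])
        have "?C (amul x y) = bact M x (?C y) + sc M (acounit y) (?C x)"
          using bCD(2)[OF xy] by simp
        moreover note scD[OF xy(1), of "acounit y"]
        ultimately show "\<phi> (amul x y) = acounit x * \<phi> y + acounit y * \<phi> x"
          using gauss[OF xy] CD[OF xy(1)] bCD(1)[OF xy]
          by (simp add: \<phi>_def iota ip_add[OF H] ip_scl[OF H])
      next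
        fix x c assume x: "x \<in> ?B"
        have "?C (fscale c x) = sc M c (?C x)"
          using x by (simp add: cocycle_def mod acounit_simps M.scale_right_diff_distrib)
        then show "\<phi> (fscale c x) = c * \<phi> x"
          using x CD by (simp add: \<phi>_def iota ip_scl[OF H])
      qed
      moreover have "\<phi> w = 0"
      proof -
        have "acounit w = 1" using assms(3) u1_podles(2)[OF q] by (auto simp: acounit_astar)
        then have "?C w = 0" by (simp add: cocycle_def we)
        moreover have "\<iota> 0 = 0"
          using iota(2)[OF CD[OF aone_podles[OF q]], of 0] by simp
        ultimately show ?thesis by (simp add: \<phi>_def ip_0[OF H])
      qed
      ultimately have zero: "\<phi> x = 0" if "x \<in> ?B" for x
        using derivation_zero[OF q _ assms(3)] that by blast
      have "ipH h (\<iota> v) = 0" if v: "v \<in> ?D" for v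
      proof -
        \<comment> \<open>On the kernel of the counit the cocycle is
          \<open>bact M b e\<^sub>a\<close>, so its values exhaust \<open>?D\<close>.\<close>
        obtain b where "b \<in> ?B" "acounit b = 0" "v = bact M b e\<^sub>a"
          using v unfolding D2_sum_def by blast
        then show ?thesis using zero[of b] by (simp add: \<phi>_def cocycle_def)
      qed
      then have "h = 0"
        using dense[of _ h] by (intro orthogonal_to_dense_eq_0[OF H, of "\<iota> ` ?D"]) auto
      then show "h \<in> {0}" by simp
    qed
    show "{0} \<subseteq> gaussian_space ?B M ?C ipH \<iota>"
      unfolding gaussian_space_def orth_complement_def by (auto simp: ip_0[OF H])
  qed
  \<comment> \<open>The projected image has to equal \<open>{0}\<close> rather than be
    empty.\<close>
  moreover have "?D \<noteq> {}" using CD[OF aone_podles[OF q]] by blast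
  ultimately show ?thesis
    unfolding purely_non_gaussian_def by (auto simp: orth_projection_0[OF H])
qed

end
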